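(* Let $G$ be a complex unimodular Lie group with Lie algebra $\mathfrak g$. Then $G$ has at most one algebraic HCF (Hermitian curvature flow) soliton up to homotheties. Moreover, $G$ has a static left-invariant metric if and only if it is semisimple, and in this case the canonical metrics induced by the Killing form of $\mathfrak g$ are static with $\lambda<0$.
   Context: A complex Lie group is always endowed with the complex structure $J$ making multiplication holomorphic ($J$ bi-invariant); unimodular means $\mathrm{tr}\,\mathrm{ad}_X=0$ for all $X\in\mathfrak g$. The tensor $K$: let $(M,J,g)$ be a Hermitian manifold with Chern connection $\nabla$ (the unique connection with $\nabla J=\nabla g=0$ whose torsion $T$ has vanishing $(1,1)$-part) and Chern curvature $\Omega$. In a local $(1,0)$-frame put $T_{ij\bar k}=g_{a\bar k}T_{ij}^a$ (with $T_{\bar i\bar j k}=\overline{T_{ij\bar k}}$), $S_{i\bar j}=g^{k\bar l}\Omega_{k\bar l i\bar j}$, where $\Omega_{k\bar l i\bar j}=g(\nabla_k\nabla_{\bar l}Z_i-\nabla_{\bar l}\nabla_kZ_i-\nabla_{[Z_k,Z_{\bar l}]}Z_i,Z_{\bar j})$, and $Q^1_{i\bar j}=g^{k\bar l}g^{m\bar n}T_{ik\bar n}T_{\bar j\bar l m}$, $Q^2_{i\bar j}=g^{\bar l k}g^{\bar n m}T_{\bar l\bar n i}T_{km\bar j}$, $Q^3_{i\bar j}=g^{\bar l k}g^{\bar n m}T_{ik\bar l}T_{\bar j\bar n m}$, $Q^4_{i\bar j}=\frac12 g^{\bar l k}g^{\bar n m}(T_{mk\bar l}T_{\bar n\bar j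 i}+T_{\bar n\bar l k}T_{mi\bar j})$. Set $Q=\frac12Q^1-\frac14Q^2-\frac12Q^3+Q^4$ and $K(g)=S-Q$, viewed as a $J$-invariant symmetric 2-tensor. The HCF is the flow $\partial_tg_t=-K(g_t)$. A Hermitian metric $g$ is static if $K(g)=\lambda g$ for some $\lambda\in\mathbb R$. A left-invariant Hermitian metric $g$ on $G$ is an algebraic HCF soliton if $K(g)=\lambda g+g(D\cdot,\cdot)+g(\cdot,D\cdot)$ for some $\lambda\in\mathbb R$ and some derivation $D\in\mathrm{Der}(\mathfrak g)$. Canonical metrics: a semisimple Lie algebra $\mathfrak g$ admits Cartan decompositions $\mathfrak g=\mathfrak k\oplus\mathfrak p$, i.e. $[\mathfrak k,\mathfrak k]\subset\mathfrak k$, $[\mathfrak k,\mathfrak p]\subset\mathfrak p$, $[\mathfrak p,\mathfrak p]\subset\mathfrak k$, with the Killing form $\mathrm B(X,Y)=\mathrm{tr}(\mathrm{ad}_X\mathrm{ad}_Y)$ negative definite on $\mathfrak k$, positive definite on $\mathfrak p$, and $\mathrm B(\mathfrak k,\mathfrak p)=0$. Switching the sign of $\mathrm B$ on $\mathfrak k$ gives an inner product on $\mathfrak g$; a left-invariant metric on $G$ is canonical if it induces such an inner product on $\mathfrak g$. (For complex semisimple $\mathfrak g$ a Cartan decomposition is obtained by taking $\mathfrak k=\mathfrak g_{\mathbb R}$ a compact real form and $\mathfrak p=i\mathfrak g_{\mathbb R}$.)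
   Formalization: "Static iff semisimple" is stated for non-abelian Lie algebras only (abelian groups have K=0, so all metrics are static); "up to homotheties" means up to scaling and complex automorphisms of the Lie algebra, since flat metrics on a complex torus need not be homothetic. *)

theory Defs
  imports "HOL-Analysis.Analysis" "HOL-Algebra.Group"
begin

section \<open>Complex Lie groups and their Lie algebras\<close>

abbreviation cplx_J :: "complex ^ 'n \<Rightarrow> complex ^ 'n"
  where "cplx_J v \<equiv> \<i> *s v"

text \<open>
  Holomorphy on an open set, between real normed spaces carrying complex structures \<open>J1\<close> and \<open>J2\<close>:
  Frechet differentiability with complex linear derivative.  The formulation with \<open>J1\<close>, \<open>J2\<close> covers
  functions of two variables, defined on the product of two copies of the model space.
\<close>

definition holomorphic_map ::
    "('v::real_normed_vector \<Rightarrow> 'v) \<Rightarrow> ('w::real_normed_vector \<Rightarrow> 'w) \<Rightarrow> 'v set \<Rightarrow> ('v \<Rightarrow> 'w) \<Rightarrow> bool"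
  where "holomorphic_map J1 J2 S f \<longleftrightarrow>
    (\<forall>x\<in>S. \<exists>D. (f has_derivative D) (at x) \<and> (\<forall>v. D (J1 v) = J2 (D v)))"

text \<open>
  The group \<open>G\<close> carries a topology \<open>\<T>\<close> and a holomorphic atlas \<open>\<A>\<close> of charts \<open>(U, \<phi>)\<close>, where
  only the values of \<open>\<phi>\<close> on \<open>U\<close> matter.
\<close>

locale complex_lie_group = group G
  for G :: "('a, 'b) monoid_scheme" (structure) +
  fixes \<T> :: "'a topology"
    and \<A> :: "('a set \<times> ('a \<Rightarrow> complex ^ 'n)) set"
  assumes topspace_eq: "topspace \<T> = carrier G"
    and Hausdorff: "Hausdorff_space \<T>"
    and second_countable: "second_countable \<T>"
    and charts_cover: "\<Union> (fst ` \<A>) = carrier G"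
    and chart: "\<And>U \<phi>. (U, \<phi>) \<in> \<A> \<Longrightarrow> openin \<T> U \<and> open (\<phi> ` U) \<and>
          homeomorphic_map (subtopology \<T> U) (top_of_set (\<phi> ` U)) \<phi>"
    and transition_holomorphic:
      "\<And>U \<phi> V \<psi>. (U, \<phi>) \<in> \<A> \<Longrightarrow> (V, \<psi>) \<in> \<A> \<Longrightarrow>
          holomorphic_map cplx_J cplx_J (\<phi> ` (U \<inter> V)) (\<lambda>x. \<psi> (inv_into U \<phi> x))"
    and mult_continuous: "continuous_map (prod_topology \<T> \<T>) \<T> (\<lambda>(x, y). x \<otimes> y)"
    and inv_continuous: "continuous_map \<T> \<T> (m_inv G)"
    and mult_holomorphic:
      "\<And>U \<phi> V \<psi> W \<theta>. (U, \<phi>) \<in> \<A> \<Longrightarrow> (V, \<psi>) \<in> \<A> \<Longrightarrow> (W, \<theta>) \<in> \<A> \<Longrightarrow>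
          holomorphic_map (map_prod cplx_J cplx_J) cplx_J
            {(x, y). x \<in> \<phi> ` U \<and> y \<in> \<psi> ` V \<and> inv_into U \<phi> x \<otimes> inv_into V \<psi> y \<in> W}
            (\<lambda>(x, y). \<theta> (inv_into U \<phi> x \<otimes> inv_into V \<psi> y))"
    and inv_holomorphic:
      "\<And>U \<phi> V \<psi>. (U, \<phi>) \<in> \<A> \<Longrightarrow> (V, \<psi>) \<in> \<A> \<Longrightarrow>
          holomorphic_map cplx_J cplx_J {x \<in> \<phi> ` U. m_inv G (inv_into U \<phi> x) \<in> V}
            (\<lambda>x. \<psi> (m_inv G (inv_into U \<phi> x)))"

text \<open>
  A chart \<open>(U, \<phi>)\<close> around the identity identifies \<open>\<gg> = T\<^sub>e G\<close> with the model space, the complex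
  structure becoming multiplication by \<open>\<i>\<close>.  \<open>left_inv_field G U \<phi> v\<close> is the left-invariant vector
  field with value \<open>v\<close> at the identity, written in this chart: its value at \<open>p\<close> is \<open>dL\<^sub>p v\<close>.
  It is meaningful near \<open>\<phi> \<one>\<close> only, which is all that the Lie bracket
  \<open>[X, Y] = DY \<cdot> X - DX \<cdot> Y\<close> at \<open>\<phi> \<one>\<close> needs.
\<close>

definition left_inv_field ::
    "('a, 'b) monoid_scheme \<Rightarrow> 'a set \<Rightarrow> ('a \<Rightarrow> complex ^ 'n) \<Rightarrow> complex ^ 'n \<Rightarrow> complex ^ 'n \<Rightarrow> complex ^ 'n"
  where "left_inv_field G U \<phi> v x =
    frechet_derivative (\<lambda>y. \<phi> (inv_into U \<phi> x \<otimes>\<^bsub>G\<^esub> inv_into U \<phi> y)) (at (\<phi> \<one>\<^bsub>G\<^esub>)) v"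

definition lie_bracket ::
    "('a, 'b) monoid_scheme \<Rightarrow> 'a set \<Rightarrow> ('a \<Rightarrow> complex ^ 'n) \<Rightarrow> complex ^ 'n \<Rightarrow> complex ^ 'n \<Rightarrow> complex ^ 'n"
  where "lie_bracket G U \<phi> v w =
    frechet_derivative (left_inv_field G U \<phi> w) (at (\<phi> \<one>\<^bsub>G\<^esub>)) v
    - frechet_derivative (left_inv_field G U \<phi> v) (at (\<phi> \<one>\<^bsub>G\<^esub>)) w"

section \<open>Lie algebra notions\<close>

text \<open>
  Throughout, \<open>\<gg>\<close> is regarded as a real Lie algebra with complex structure \<open>cplx_J\<close>; in particular
  subspaces, derivations and traces are real.  The Killing form of the Cartan decompositions
  \<open>\<gg> = \<kk> \<oplus> \<i>\<kk>\<close> has to be the real one: the complex Killing form is not real valued.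
\<close>

type_synonym 'v bracket = "'v \<Rightarrow> 'v \<Rightarrow> 'v"

definition real_trace :: "('v::euclidean_space \<Rightarrow> 'v) \<Rightarrow> real"
  where "real_trace f = (\<Sum>b\<in>Basis. f b \<bullet> b)"

definition unimodular :: "'v::euclidean_space bracket \<Rightarrow> bool"
  where "unimodular br \<longleftrightarrow> (\<forall>X. real_trace (br X) = 0)"

definition killing_form :: "'v::euclidean_space bracket \<Rightarrow> 'v \<Rightarrow> 'v \<Rightarrow> real"
  where "killing_form br X Y = real_trace (\<lambda>Z. br X (br Y Z))"

definition abelian :: "'v::real_vector bracket \<Rightarrow> bool"
  where "abelian br \<longleftrightarrow> (\<forall>X Y. br X Y = 0)"

definition lie_ideal :: "'v::real_vector bracket \<Rightarrow> 'v set \<Rightarrow> bool"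
  where "lie_ideal br I \<longleftrightarrow> subspace I \<and> (\<forall>X. \<forall>Y\<in>I. br X Y \<in> I)"

definition derived_algebra :: "'v::real_vector bracket \<Rightarrow> 'v set \<Rightarrow> 'v set"
  where "derived_algebra br I = span {br X Y | X Y. X \<in> I \<and> Y \<in> I}"

definition solvable :: "'v::real_vector bracket \<Rightarrow> 'v set \<Rightarrow> bool"
  where "solvable br I \<longleftrightarrow> (\<exists>n. (derived_algebra br ^^ n) I = {0})"

definition semisimple :: "'v::real_vector bracket \<Rightarrow> bool"
  where "semisimple br \<longleftrightarrow> (\<forall>I. lie_ideal br I \<and> solvable br I \<longrightarrow> I = {0})"

definition derivation :: "'v::real_vector bracket \<Rightarrow> ('v \<Rightarrow> 'v) \<Rightarrow> bool"
  where "derivation br D \<longleftrightarrow> linear D \<and> (\<forall>X Y. D (br X Y) = br (D X) Y + br X (D Y))"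

definition complex_automorphism ::
    "(complex ^ 'n) bracket \<Rightarrow> (complex ^ 'n \<Rightarrow> complex ^ 'n) \<Rightarrow> bool"
  where "complex_automorphism br F \<longleftrightarrow> linear F \<and> bij F \<and>
    (\<forall>X. F (cplx_J X) = cplx_J (F X)) \<and> (\<forall>X Y. F (br X Y) = br (F X) (F Y))"

definition cartan_decomposition :: "'v::euclidean_space bracket \<Rightarrow> 'v set \<Rightarrow> 'v set \<Rightarrow> bool"
  where "cartan_decomposition br \<kk> \<pp> \<longleftrightarrow>
    subspace \<kk> \<and> subspace \<pp> \<and> \<kk> \<inter> \<pp> = {0} \<and> {X + Y | X Y. X \<in> \<kk> \<and> Y \<in> \<pp>} = UNIV \<and>
    (\<forall>X\<in>\<kk>. \<forall>Y\<in>\<kk>. br X Y \<in> \<kk>) \<and>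
    (\<forall>X\<in>\<kk>. \<forall>Y\<in>\<pp>. br X Y \<in> \<pp>) \<and>
    (\<forall>X\<in>\<pp>. \<forall>Y\<in>\<pp>. br X Y \<in> \<kk>) \<and>
    (\<forall>X\<in>\<kk>. X \<noteq> 0 \<longrightarrow> killing_form br X X < 0) \<and>
    (\<forall>X\<in>\<pp>. X \<noteq> 0 \<longrightarrow> killing_form br X X > 0) \<and>
    (\<forall>X\<in>\<kk>. \<forall>Y\<in>\<pp>. killing_form br X Y = 0)"

section \<open>Left-invariant Hermitian metrics and the tensor \<open>K\<close>\<close>

text \<open>
  Left-invariant tensors and connections on \<open>G\<close> are represented by their values on left-invariant
  vector fields, i.e. on \<open>\<gg>\<close>.
\<close>

type_synonym 'v metric = "'v \<Rightarrow> 'v \<Rightarrow> real"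

definition hermitian_metric :: "(complex ^ 'n) metric \<Rightarrow> bool"
  where "hermitian_metric g \<longleftrightarrow> bilinear g \<and> (\<forall>X Y. g X Y = g Y X) \<and> (\<forall>X. X \<noteq> 0 \<longrightarrow> g X X > 0) \<and>
    (\<forall>X Y. g (cplx_J X) (cplx_J Y) = g X Y)"

definition canonical_metric :: "'v::euclidean_space bracket \<Rightarrow> 'v metric \<Rightarrow> bool"
  where "canonical_metric br g \<longleftrightarrow> bilinear g \<and> (\<exists>\<kk> \<pp>. cartan_decomposition br \<kk> \<pp> \<and>
    (\<forall>X\<in>\<kk>. \<forall>Y\<in>\<kk>. g X Y = - killing_form br X Y) \<and>
    (\<forall>X\<in>\<pp>. \<forall>Y\<in>\<pp>. g X Y = killing_form br X Y) \<and>
    (\<forall>X\<in>\<kk>. \<forall>Y\<in>\<pp>. g X Y = 0 \<and> g Y X = 0))"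

text \<open>
  The complexification \<open>\<gg> \<otimes> \<complex>\<close> consists of pairs, \<open>(x, y)\<close> standing for \<open>x + \<surd>-1 y\<close>.  Here
  \<open>\<surd>-1\<close> is not the complex structure \<open>cplx_J\<close> of \<open>\<gg>\<close>; the \<open>\<plusminus>\<surd>-1\<close> eigenspaces of the latter are
  the \<open>(1,0)\<close> and \<open>(0,1)\<close> vectors.  \<open>cext\<close> and \<open>cext_form\<close> are the complex bilinear extensions of
  real bilinear maps with values in \<open>\<gg>\<close> and in the reals.
\<close>

type_synonym 'v complexified = "'v \<times> 'v"

definition cext :: "('v \<Rightarrow> 'v \<Rightarrow> 'v::real_vector) \<Rightarrow> 'v complexified \<Rightarrow> 'v complexified \<Rightarrow> 'v complexified"
  where "cext b Z W =
    (b (fst Z) (fst W) - b (snd Z) (snd W), b (fst Z) (snd W) + b (snd Z) (fst W))"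

definition cext_form :: "'v metric \<Rightarrow> 'v complexified \<Rightarrow> 'v complexified \<Rightarrow> complex"
  where "cext_form g Z W =
    Complex (g (fst Z) (fst W) - g (snd Z) (snd W)) (g (fst Z) (snd W) + g (snd Z) (fst W))"

definition part10 :: "complex ^ 'n \<Rightarrow> (complex ^ 'n) complexified"
  where "part10 X = ((1/2) *\<^sub>R X, - (1/2) *\<^sub>R cplx_J X)"

definition part01 :: "complex ^ 'n \<Rightarrow> (complex ^ 'n) complexified"
  where "part01 X = ((1/2) *\<^sub>R X, (1/2) *\<^sub>R cplx_J X)"

definition torsion :: "'v::real_vector bracket \<Rightarrow> ('v \<Rightarrow> 'v \<Rightarrow> 'v) \<Rightarrow> 'v \<Rightarrow> 'v \<Rightarrow> 'v"
  where "torsion br nabla X Y = nabla X Y - nabla Y X - br X Y"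

text \<open>
  In \<open>\<nabla>g = 0\<close> the term \<open>X (g (Y, Z))\<close> is absent, since \<open>g (Y, Z)\<close> is constant for left-invariant
  \<open>Y\<close> and \<open>Z\<close>.
\<close>

definition is_chern_connection ::
    "(complex ^ 'n) bracket \<Rightarrow> (complex ^ 'n) metric \<Rightarrow> (complex ^ 'n \<Rightarrow> complex ^ 'n \<Rightarrow> complex ^ 'n) \<Rightarrow> bool"
  where "is_chern_connection br g nabla \<longleftrightarrow> bilinear nabla \<and>
    (\<forall>X Y. nabla X (cplx_J Y) = cplx_J (nabla X Y)) \<and>
    (\<forall>X Y Z. g (nabla X Y) Z + g Y (nabla X Z) = 0) \<and>
    (\<forall>X Y. cext (torsion br nabla) (part10 X) (part01 Y) = 0)"

definition chern_connection ::
    "(complex ^ 'n) bracket \<Rightarrow> (complex ^ 'n) metric \<Rightarrow> complex ^ 'n \<Rightarrow> complex ^ 'n \<Rightarrow> complex ^ 'n"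
  where "chern_connection br g = (THE nabla. is_chern_connection br g nabla)"

text \<open>
  Components are taken in the left-invariant \<open>(1,0)\<close>-frame \<open>Z\<^sub>i\<close> given by the \<open>(1,0)\<close>-parts of the
  standard basis; \<open>Zbar i\<close> is the conjugate of \<open>Z\<^sub>i\<close>, and a barred index is recorded only by its
  argument position.
\<close>

definition Zf :: "'n::finite \<Rightarrow> (complex ^ 'n) complexified"
  where "Zf i = part10 (axis i 1)"

definition Zbar :: "'n::finite \<Rightarrow> (complex ^ 'n) complexified"
  where "Zbar i = part01 (axis i 1)"

text \<open>\<open>g_inv g k l\<close> is \<open>g\<close> with raised indices \<open>k\<close>, \<open>l\<close>-bar, so \<open>\<Sum>\<^sub>l g_inv g k l * g (Z\<^sub>i, Zbar l)\<close>
  is \<open>1\<close> for \<open>i = k\<close> and \<open>0\<close> otherwise; hence the transpose.\<close>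

definition g_inv :: "(complex ^ 'n) metric \<Rightarrow> 'n \<Rightarrow> 'n \<Rightarrow> complex"
  where "g_inv g k l = matrix_inv (transpose (\<chi> i j. cext_form g (Zf i) (Zbar j))) $ k $ l"

definition T_comp :: "(complex ^ 'n) bracket \<Rightarrow> (complex ^ 'n) metric \<Rightarrow> 'n \<Rightarrow> 'n \<Rightarrow> 'n \<Rightarrow> complex"
  where "T_comp br g i j k =
    cext_form g (cext (torsion br (chern_connection br g)) (Zf i) (Zf j)) (Zbar k)"

definition Omega_comp ::
    "(complex ^ 'n) bracket \<Rightarrow> (complex ^ 'n) metric \<Rightarrow> 'n \<Rightarrow> 'n \<Rightarrow> 'n \<Rightarrow> 'n \<Rightarrow> complex"
  where "Omega_comp br g k l i j =
    (let nabla = cext (chern_connection br g) in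
      cext_form g
        (nabla (Zf k) (nabla (Zbar l) (Zf i)) - nabla (Zbar l) (nabla (Zf k) (Zf i))
          - nabla (cext br (Zf k) (Zbar l)) (Zf i))
        (Zbar j))"

definition S_comp :: "(complex ^ 'n) bracket \<Rightarrow> (complex ^ 'n) metric \<Rightarrow> 'n \<Rightarrow> 'n \<Rightarrow> complex"
  where "S_comp br g i j = (\<Sum>k\<in>UNIV. \<Sum>l\<in>UNIV. g_inv g k l * Omega_comp br g k l i j)"

definition Q1_comp :: "(complex ^ 'n) bracket \<Rightarrow> (complex ^ 'n) metric \<Rightarrow> 'n \<Rightarrow> 'n \<Rightarrow> complex"
  where "Q1_comp br g i j = (\<Sum>k\<in>UNIV. \<Sum>l\<in>UNIV. \<Sum>m\<in>UNIV. \<Sum>n\<in>UNIV.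
    g_inv g k l * g_inv g m n * T_comp br g i k n * cnj (T_comp br g j l m))"

definition Q2_comp :: "(complex ^ 'n) bracket \<Rightarrow> (complex ^ 'n) metric \<Rightarrow> 'n \<Rightarrow> 'n \<Rightarrow> complex"
  where "Q2_comp br g i j = (\<Sum>k\<in>UNIV. \<Sum>l\<in>UNIV. \<Sum>m\<in>UNIV. \<Sum>n\<in>UNIV.
    g_inv g k l * g_inv g m n * cnj (T_comp br g l n i) * T_comp br g k m j)"

definition Q3_comp :: "(complex ^ 'n) bracket \<Rightarrow> (complex ^ 'n) metric \<Rightarrow> 'n \<Rightarrow> 'n \<Rightarrow> complex"
  where "Q3_comp br g i j = (\<Sum>k\<in>UNIV. \<Sum>l\<in>UNIV. \<Sum>m\<in>UNIV. \<Sum>n\<in>UNIV.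
    g_inv g k l * g_inv g m n * T_comp br g i k l * cnj (T_comp br g j n m))"

definition Q4_comp :: "(complex ^ 'n) bracket \<Rightarrow> (complex ^ 'n) metric \<Rightarrow> 'n \<Rightarrow> 'n \<Rightarrow> complex"
  where "Q4_comp br g i j = (1/2) * (\<Sum>k\<in>UNIV. \<Sum>l\<in>UNIV. \<Sum>m\<in>UNIV. \<Sum>n\<in>UNIV.
    g_inv g k l * g_inv g m n *
      (T_comp br g m k l * cnj (T_comp br g n j i) + cnj (T_comp br g n l k) * T_comp br g m i j))"

definition K_comp :: "(complex ^ 'n) bracket \<Rightarrow> (complex ^ 'n) metric \<Rightarrow> 'n \<Rightarrow> 'n \<Rightarrow> complex"
  where "K_comp br g i j = S_comp br g i j -
    ((1/2) * Q1_comp br g i j - (1/4) * Q2_comp br g i j - (1/2) * Q3_comp br g i j + Q4_comp br g i j)"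

text \<open>
  The real \<open>J\<close>-invariant tensor with components \<open>K (Z\<^sub>i, Zbar j) = K_comp i j\<close>, evaluated using that
  \<open>X = \<Sum>\<^sub>i X\<^sub>i Z\<^sub>i + cnj X\<^sub>i Zbar i\<close>.
\<close>

definition K_tensor :: "(complex ^ 'n) bracket \<Rightarrow> (complex ^ 'n) metric \<Rightarrow> complex ^ 'n \<Rightarrow> complex ^ 'n \<Rightarrow> real"
  where "K_tensor br g X Y = 2 * Re (\<Sum>i\<in>UNIV. \<Sum>j\<in>UNIV. X $ i * cnj (Y $ j) * K_comp br g i j)"

definition static_with :: "(complex ^ 'n) bracket \<Rightarrow> (complex ^ 'n) metric \<Rightarrow> real \<Rightarrow> bool"
  where "static_with br g c \<longleftrightarrow> hermitian_metric g \<and> (\<forall>X Y. K_tensor br g X Y = c * g X Y)"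

definition static :: "(complex ^ 'n) bracket \<Rightarrow> (complex ^ 'n) metric \<Rightarrow> bool"
  where "static br g \<longleftrightarrow> (\<exists>c. static_with br g c)"

definition algebraic_HCF_soliton :: "(complex ^ 'n) bracket \<Rightarrow> (complex ^ 'n) metric \<Rightarrow> bool"
  where "algebraic_HCF_soliton br g \<longleftrightarrow> hermitian_metric g \<and>
    (\<exists>c D. derivation br D \<and> (\<forall>X Y. K_tensor br g X Y = c * g X Y + g (D X) Y + g X (D Y)))"

text \<open>
  Homothety of left-invariant metrics is understood equivariantly, through automorphisms of \<open>\<gg>\<close>:
  these are the differentials of automorphisms of the universal cover.  Asking for homotheties of
  \<open>G\<close> itself would be too much: invariant metrics on complex tori are flat, hence solitons, but not
  all homothetic.
\<close>

definition homothetic ::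
    "(complex ^ 'n) bracket \<Rightarrow> (complex ^ 'n) metric \<Rightarrow> (complex ^ 'n) metric \<Rightarrow> bool"
  where "homothetic br g1 g2 \<longleftrightarrow>
    (\<exists>c>0. \<exists>F. complex_automorphism br F \<and> (\<forall>X Y. g2 (F X) (F Y) = c * g1 X Y))"

end

theory Submission
  imports Defs "HOL-Complex_Analysis.Cauchy_Integral_Formula"
begin

text \<open>
  \<^emph>\<open>Reduction to algebra.\<close>  Holomorphic maps of several variables are smooth by Cauchy's formula, and
  differentiating associativity three times gives a complex Lie algebra \<open>\<gg>\<close>.  For a left-invariant
  Hermitian metric the Chern connection vanishes on left-invariant fields, because those of type
  \<open>(1,0)\<close> commute with those of type \<open>(0,1)\<close>.  The curvature is therefore zero, the torsion is minus the
  bracket, and unimodularity kills \<open>Q\<^sup>3\<close> and \<open>Q\<^sup>4\<close>.  What remains of \<open>K\<close> is, for any unitary frame \<open>v\<close>, the real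
  part of the Hermitian form \<open>1/2 \<Sum>\<^sub>p\<^sub>q h(X, [v\<^sub>p, v\<^sub>q]) h([v\<^sub>p, v\<^sub>q], Y) - \<Sum>\<^sub>p h([X, v\<^sub>p], [Y, v\<^sub>p])\<close>
  (\<open>K_tensor_eq_kform\<close>).  Up to normalization this is the gradient of the squared norm of the
  bracket, as a function of the metric: it is the moment map of the action of \<open>GL(\<gg>)\<close> on brackets.

  Two facts about this function carry the proof.  Along the geodesic from a metric with unitary frame
  \<open>v\<close> in the direction of a self-adjoint \<open>A\<close> with eigenvalues \<open>a\<close> it is the sum of exponentials
  \<open>\<Sum> exp (2t (a\<^sub>k - a\<^sub>i - a\<^sub>j)) \<bar>c\<^sub>i\<^sub>j\<^sub>k\<bar>\<^sup>2\<close>, so it is convex.  And for a derivation \<open>D\<close> the pairing of \<open>K\<close> with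
  \<open>[D, D\<^sup>*]\<close> is half the squared norm of the failure of \<open>D\<^sup>*\<close> to be a derivation
  (\<open>moment_commutator\<close>).

  \<^emph>\<open>Uniqueness of solitons.\<close>  The second fact shows that for a soliton \<open>K = c + P\<close> with a self-adjoint
  derivation \<open>P\<close> (\<open>soliton_normal_form\<close>).  Given two solitons, move the second one by automorphisms and
  scalings as close to the first as possible, and let \<open>exp (2 a\<^sub>i)\<close> be its eigenvalues relative to the
  first.  Minimality makes \<open>A\<close> orthogonal to the identity and to all derivations that occur, hence to
  both tensors \<open>K\<close>.  So the squared norm of the bracket has vanishing derivative at both ends of the
  geodesic; being convex, it is constant, which forces \<open>A\<close> to be a derivation.  Then \<open>A\<close> is orthogonal
  to itself and vanishes (\<open>soliton_frames_equivalent\<close>).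

  \<^emph>\<open>Static implies semisimple.\<close>  If \<open>K = c g\<close> then \<open>c < 0\<close> unless the bracket is zero.  Pairing \<open>K\<close> with the
  orthogonal projection onto an abelian ideal gives \<open>c\<close> times its dimension, but also a sum of squares
  with nonnegative weights (\<open>no_abelian_ideal\<close>).

  \<^emph>\<open>Semisimple implies static.\<close>  A minimum of the squared norm of the bracket, balanced by the logarithm
  of the volume, is a static metric.  Penalize the squared distance to a base point by \<open>\<epsilon>\<close>, so
  that a minimum exists, and let \<open>\<epsilon>\<close> tend to zero.  If the minima escape to infinity, their limiting direction
  is a self-adjoint \<open>A\<close> whose eigenspaces define a filtration.  The pairing with \<open>[ad X, (ad X)\<^sup>*]\<close> shows
  that the filtration consists of ideals; boundedness of the functional shows that the bracket
  respects degrees and that \<open>A\<close> has a negative eigenvalue.  The part of negative degree is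
  then a nonzero nilpotent ideal, which semisimplicity excludes (\<open>semisimple_energy_minimizer\<close>).

  \<^emph>\<open>Canonical metrics.\<close>  For the Cartan involution \<open>\<theta>\<close>, the endomorphism \<open>J (\<theta> J \<theta>)\<close> is a positive
  involution, hence the identity; thus \<open>\<theta>\<close> is antilinear and the metric is Hermitian.  The structure
  constants are skew up to \<open>\<theta>\<close>, and both sums in \<open>K\<close> become the Killing form: \<open>K = - g / 4\<close>
  (\<open>canonical_static\<close>).
\<close>

section \<open>Holomorphic maps of several variables\<close>

text \<open>
  The parametrization of a complex line, with \<open>J\<close> in the role of multiplication by \<open>\<i>\<close>; the source of a
  holomorphic map may be a product of two copies of the model space, on which \<open>*s\<close> does not act.
\<close>

definition complex_line :: "('v::real_vector \<Rightarrow> 'v) \<Rightarrow> 'v \<Rightarrow> 'v \<Rightarrow> complex \<Rightarrow> 'v"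
  where "complex_line J x v z = x + Re z *\<^sub>R v + Im z *\<^sub>R J v"

lemma bounded_linear_vector_scalar_mult: "bounded_linear (\<lambda>x::complex^'n. c *s x)"
proof -
  have "linear (\<lambda>x::complex^'n. c *s x)"
    by (rule linearI) (auto simp: vec_eq_iff algebra_simps)
  then show ?thesis by (rule linear_conv_bounded_linear[THEN iffD1])
qed

lemma holomorphic_map_has_derivative:
  assumes "holomorphic_map J1 J2 S f" "x \<in> S"
  shows "(f has_derivative frechet_derivative f (at x)) (at x)"
    and "frechet_derivative f (at x) (J1 v) = J2 (frechet_derivative f (at x) v)"
proof -
  obtain D where D: "(f has_derivative D) (at x)" "\<forall>v. D (J1 v) = J2 (D v)"
    using assms unfolding holomorphic_map_def by blast
  have "D = frechet_derivative f (at x)" using D(1) by (rule frechet_derivative_at)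
  with D show "(f has_derivative frechet_derivative f (at x)) (at x)"
    "frechet_derivative f (at x) (J1 v) = J2 (frechet_derivative f (at x) v)" by auto
qed

text \<open>
  Cauchy's formula for the derivative, with the contour integral written out as an integral over an
  interval: this is the form that can be differentiated with respect to a further parameter.
\<close>

lemma Cauchy_derivative_integral:
  fixes f :: "complex \<Rightarrow> complex"
  assumes "continuous_on (cball 0 r) f" "f holomorphic_on ball 0 r" "0 < r"
  shows "(f has_field_derivative
           (integral {0..2*pi} (\<lambda>\<theta>. cis (-\<theta>) * f (complex_of_real r * cis \<theta>)) / (2 * pi * r))) (at 0)"
proof -
  let ?h = "\<lambda>u. f u / (u - 0)\<^sup>2"
  have *: "(f has_field_derivative (1/(2 * of_real pi * \<i>) * contour_integral(circlepath 0 r) ?h)) (at 0)"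
    using Cauchy_derivative_integral_circlepath(2)[OF assms(1,2), of 0] assms(3) by simp
  have "contour_integral (circlepath 0 r) ?h
      = integral {0..2*pi} (\<lambda>\<theta>. ?h (0 + complex_of_real r * cis \<theta>) * complex_of_real r * \<i> * cis \<theta>)"
    unfolding circlepath_def by (rule contour_integral_part_circlepath_eq) simp
  also have "\<dots> = integral {0..2*pi} (\<lambda>\<theta>. (\<i> / complex_of_real r) * (cis (-\<theta>) * f (complex_of_real r * cis \<theta>)))"
  proof (rule integral_cong)
    fix \<theta> :: real assume "\<theta> \<in> {0..2*pi}"
    have [simp]: "cis \<theta> \<noteq> 0" by simp
    have c: "cis (-\<theta>) = 1 / cis \<theta>" by (metis cis_inverse inverse_eq_divide)
    show "?h (0 + complex_of_real r * cis \<theta>) * complex_of_real r * \<i> * cis \<theta>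
       = (\<i> / complex_of_real r) * (cis (-\<theta>) * f (complex_of_real r * cis \<theta>))"
      unfolding c using assms(3) by (simp add: field_simps power2_eq_square)
  qed
  also have "\<dots> = (\<i> / complex_of_real r) * integral {0..2*pi} (\<lambda>\<theta>. cis (-\<theta>) * f (complex_of_real r * cis \<theta>))"
    by (rule integral_mult_right)
  finally have e: "contour_integral (circlepath 0 r) ?h = (\<i> / complex_of_real r) * integral {0..2*pi} (\<lambda>\<theta>. cis (-\<theta>) * f (complex_of_real r * cis \<theta>))" .
  show ?thesis using * unfolding e using assms(3) by (simp add: field_simps)
qed

locale holomorphic_family =
  fixes J :: "'v::euclidean_space \<Rightarrow> 'v" and S :: "'v set"
  assumes J: "bounded_linear J" and JJ: "\<And>v. J (J v) = - v" and openS: "open S"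
begin

lemma complex_line_has_derivative:
  "(complex_line J x v has_derivative (\<lambda>z. Re z *\<^sub>R v + Im z *\<^sub>R J v)) (at z)"
  unfolding complex_line_def[abs_def] by (auto intro!: derivative_eq_intros)

lemma continuous_on_complex_line [continuous_intros]:
  assumes "continuous_on A a" "continuous_on A z"
  shows "continuous_on A (\<lambda>p. complex_line J (a p) v (z p))"
  unfolding complex_line_def using assms by (intro continuous_intros)

lemma line_deriv:
  fixes f :: "'v \<Rightarrow> complex ^ 'n"
  assumes f: "holomorphic_map J cplx_J S f" and z: "complex_line J x v z \<in> S"
  shows "((\<lambda>z. f (complex_line J x v z) $ i) has_field_derivative
            frechet_derivative f (at (complex_line J x v z)) v $ i) (at z)"
proof -
  let ?D = "frechet_derivative f (at (complex_line J x v z))"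
  note D = holomorphic_map_has_derivative[OF f z]
  have lin: "linear ?D" using D(1) by (rule has_derivative_linear)
  have "((\<lambda>z. f (complex_line J x v z)) has_derivative (\<lambda>w. ?D (Re w *\<^sub>R v + Im w *\<^sub>R J v))) (at z)"
    by (rule has_derivative_compose[OF complex_line_has_derivative D(1)])
  then have "((\<lambda>z. f (complex_line J x v z) $ i) has_derivative (\<lambda>w. ?D (Re w *\<^sub>R v + Im w *\<^sub>R J v) $ i)) (at z)"
    by (rule bounded_linear.has_derivative[OF bounded_linear_vec_nth])
  moreover have "?D (Re w *\<^sub>R v + Im w *\<^sub>R J v) $ i = ?D v $ i * w" for w
  proof -
    have "?D (Re w *\<^sub>R v + Im w *\<^sub>R J v) = Re w *\<^sub>R ?D v + Im w *\<^sub>R (\<i> *s ?D v)"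
      using lin D(2)[of v] by (simp add: linear_add linear_cmul)
    then have "?D (Re w *\<^sub>R v + Im w *\<^sub>R J v) $ i = (of_real (Re w) + \<i> * of_real (Im w)) * ?D v $ i"
      by (simp add: scaleR_conv_of_real[where 'a=complex] algebra_simps)
    then show ?thesis by (simp add: complex_eq[symmetric] mult.commute)
  qed
  ultimately show ?thesis unfolding has_field_derivative_def by simp
qed

lemma holomorphic_imp_continuous:
  assumes f: "holomorphic_map J J2 S f" shows "continuous_on S f"
  using holomorphic_map_has_derivative(1)[OF f] has_derivative_continuous continuous_at_imp_continuous_on
  by blast

text \<open>
  Restricted to a complex line a holomorphic map is holomorphic in one variable, so its directional
  derivatives are integrals of the map itself.  This is the source of all smoothness below:
  differentiability alone says nothing about the continuity of the derivative.
\<close>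

lemma Cauchy_formula:
  fixes f :: "'v \<Rightarrow> complex ^ 'n"
  assumes f: "holomorphic_map J cplx_J S f" and r: "0 < r"
    and sub: "\<And>z. cmod z \<le> r \<Longrightarrow> complex_line J x v z \<in> S"
  shows "frechet_derivative f (at x) v = (1 / (2*pi*r)) *\<^sub>R
    integral (cbox 0 (2*pi)) (\<lambda>\<theta>. cis (-\<theta>) *s f (complex_line J x v (complex_of_real r * cis \<theta>)))"
proof -
  let ?F = "\<lambda>\<theta>. cis (-\<theta>) *s f (complex_line J x v (complex_of_real r * cis \<theta>))"
  have cont: "continuous_on (cbox 0 (2*pi)) ?F"
  proof -
    have "continuous_on (cbox 0 (2*pi)) (\<lambda>\<theta>. f (complex_line J x v (complex_of_real r * cis \<theta>)))"
      by (rule continuous_on_compose2[OF holomorphic_imp_continuous[OF f]])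
         (use r in \<open>auto intro!: continuous_intros sub simp: norm_mult\<close>)
    then show ?thesis
      by (subst continuous_on_componentwise) (auto simp: Basis_vec_def inner_axis intro!: continuous_intros)
  qed
  have "frechet_derivative f (at x) v $ i = (1 / (2*pi*r)) *\<^sub>R integral (cbox 0 (2*pi)) ?F $ i" for i
  proof -
    let ?f = "\<lambda>z. f (complex_line J x v z) $ i"
    have d: "(?f has_field_derivative frechet_derivative f (at (complex_line J x v z)) v $ i) (at z)" if "cmod z \<le> r" for z
      by (rule line_deriv[OF f sub[OF that]])
    have c: "continuous_on (cball 0 r) ?f"
      using d by (intro continuous_at_imp_continuous_on ballI) (metis DERIV_isCont mem_cball_0)
    have h: "?f holomorphic_on ball 0 r"
      using d by (intro holomorphic_onI) (auto simp: field_differentiable_def intro: DERIV_subset less_imp_le has_field_derivative_at_within)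
    have "(?f has_field_derivative (integral {0..2*pi} (\<lambda>\<theta>. cis (-\<theta>) * ?f (complex_of_real r * cis \<theta>)) / (2 * pi * r))) (at 0)"
      by (rule Cauchy_derivative_integral[OF c h r])
    moreover have "(?f has_field_derivative frechet_derivative f (at x) v $ i) (at 0)"
      using d[of 0] r by (simp add: complex_line_def)
    ultimately have "frechet_derivative f (at x) v $ i = integral {0..2*pi} (\<lambda>\<theta>. cis (-\<theta>) * ?f (complex_of_real r * cis \<theta>)) / (2 * pi * r)"
      by (rule DERIV_unique[symmetric])
    also have "integral {0..2*pi} (\<lambda>\<theta>. cis (-\<theta>) * ?f (complex_of_real r * cis \<theta>)) = integral (cbox 0 (2*pi)) (\<lambda>\<theta>. ?F \<theta> $ i)"
      by (simp add: cbox_interval)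
    also have "\<dots> = integral (cbox 0 (2*pi)) ?F $ i"
      using integral_linear[OF integrable_continuous[OF cont] bounded_linear_vec_nth, of i]
      by (simp add: o_def del: cbox_interval box_real)
    finally show ?thesis by (simp add: scaleR_conv_of_real[where 'a=complex] field_simps)
  qed
  then show ?thesis by (simp add: vec_eq_iff)
qed

text \<open>
  Differentiating \<open>Cauchy_formula\<close> in the base point requires one radius that serves all base points
  near \<open>x\<close>.
\<close>

lemma radius_exists:
  assumes "x \<in> S"
  obtains e r where "0 < e" "0 < r" "ball x e \<subseteq> S"
    "\<And>y z. y \<in> ball x e \<Longrightarrow> cmod z \<le> r \<Longrightarrow> complex_line J y v z \<in> S"
proof -
  obtain e where e: "0 < e" "ball x e \<subseteq> S" using openS assms open_contains_ball by blast
  define c where "c = norm v + norm (J v) + 1"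
  have c: "c > 0" unfolding c_def by (simp add: add_nonneg_pos)
  have "complex_line J y v z \<in> S" if y: "y \<in> ball x (e/2)" and z: "cmod z \<le> e/(2*c)" for y z
  proof -
    have "norm (Re z *\<^sub>R v + Im z *\<^sub>R J v) \<le> cmod z * norm v + cmod z * norm (J v)"
      by (rule norm_triangle_le) (auto intro!: add_mono mult_right_mono simp: abs_Re_le_cmod abs_Im_le_cmod)
    also have "\<dots> \<le> cmod z * c" by (simp add: c_def algebra_simps)
    also have "\<dots> \<le> e/2" using z c by (simp add: field_simps)
    finally have "norm (Re z *\<^sub>R v + Im z *\<^sub>R J v) \<le> e/2" .
    moreover have "norm (x - y) < e/2" using y by (simp add: dist_norm)
    ultimately have "norm ((x - y) - (Re z *\<^sub>R v + Im z *\<^sub>R J v)) < e"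
      using norm_triangle_ineq4[of "x-y" "Re z *\<^sub>R v + Im z *\<^sub>R J v"] by linarith
    then have "complex_line J y v z \<in> ball x e" by (simp add: complex_line_def dist_norm algebra_simps)
    then show ?thesis using e by blast
  qed
  moreover have "ball x (e/2) \<subseteq> S" using e by auto
  ultimately show ?thesis using that[of "e/2" "e/(2*c)"] e c by simp
qed

lemma derivative_continuous:
  fixes f :: "'v \<Rightarrow> complex ^ 'n"
  assumes f: "holomorphic_map J cplx_J S f"
  shows "continuous_on S (\<lambda>x. frechet_derivative f (at x) v)"
proof (rule continuous_at_imp_continuous_on, rule ballI)
  fix x assume "x \<in> S"
  obtain e r where er: "0 < e" "0 < r" "ball x e \<subseteq> S"
    "\<And>y z. y \<in> ball x e \<Longrightarrow> cmod z \<le> r \<Longrightarrow> complex_line J y v z \<in> S"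
    using radius_exists[OF \<open>x \<in> S\<close>] by metis
  let ?F = "\<lambda>y \<theta>. cis (-\<theta>) *s f (complex_line J y v (complex_of_real r * cis \<theta>))"
  have "continuous_on (ball x e \<times> cbox 0 (2*pi)) (\<lambda>(y, \<theta>). f (complex_line J y v (complex_of_real r * cis \<theta>)))"
    unfolding split_beta
    by (rule continuous_on_compose2[OF holomorphic_imp_continuous[OF f]])
       (use er(1-3) in \<open>auto intro!: continuous_intros er(4) simp: norm_mult\<close>)
  then have "continuous_on (ball x e \<times> cbox 0 (2*pi)) (\<lambda>(y, \<theta>). ?F y \<theta>)"
    by (subst continuous_on_componentwise) (auto simp: Basis_vec_def inner_axis split_beta intro!: continuous_intros)
  then have "continuous_on (ball x e) (\<lambda>y. integral (cbox 0 (2*pi)) (?F y))"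
    by (rule integral_continuous_on_param)
  then have "continuous_on (ball x e) (\<lambda>y. (1 / (2*pi*r)) *\<^sub>R integral (cbox 0 (2*pi)) (?F y))"
    by (intro continuous_intros)
  moreover have "frechet_derivative f (at y) v = (1 / (2*pi*r)) *\<^sub>R integral (cbox 0 (2*pi)) (?F y)"
    if "y \<in> ball x e" for y
    by (rule Cauchy_formula[OF f]) (use er that in auto)
  ultimately have "continuous_on (ball x e) (\<lambda>y. frechet_derivative f (at y) v)"
    by (metis (no_types, lifting) continuous_on_cong)
  then show "isCont (\<lambda>x. frechet_derivative f (at x) v) x"
    using er(1) by (simp add: continuous_on_eq_continuous_at)
qed

text \<open>
  Differentiation under the integral sign in \<open>Cauchy_formula\<close>, which is justified by the continuity of
  the derivative.
\<close>

lemma second_derivative: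
  fixes f :: "'v \<Rightarrow> complex ^ 'n"
  assumes f: "holomorphic_map J cplx_J S f" and r: "0 < r" and e: "0 < e"
    and sub: "\<And>y z. y \<in> ball x e \<Longrightarrow> cmod z \<le> r \<Longrightarrow> complex_line J y v z \<in> S"
  shows "((\<lambda>y. frechet_derivative f (at y) v) has_derivative
    (\<lambda>u. (1 / (2*pi*r)) *\<^sub>R integral (cbox 0 (2*pi)) (\<lambda>\<theta>. cis (-\<theta>) *s
          frechet_derivative f (at (complex_line J x v (complex_of_real r * cis \<theta>))) u))) (at x)"
proof -
  let ?F = "\<lambda>y \<theta>. cis (-\<theta>) *s f (complex_line J y v (complex_of_real r * cis \<theta>))"
  let ?l = "\<lambda>y \<theta>. complex_line J y v (complex_of_real r * cis \<theta>)"
  let ?D = "\<lambda>y \<theta>. Blinfun (\<lambda>u. cis (-\<theta>) *s frechet_derivative f (at (?l y \<theta>)) u)"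
  have lS: "?l y \<theta> \<in> S" if "y \<in> ball x e" for y \<theta>
    by (rule sub[OF that]) (use r in \<open>simp add: norm_mult\<close>)
  have bl: "bounded_linear (\<lambda>u. cis (-\<theta>) *s frechet_derivative f (at (?l y \<theta>)) u)" if "y \<in> ball x e" for y \<theta>
    by (rule bounded_linear_compose[OF bounded_linear_vector_scalar_mult])
       (rule has_derivative_bounded_linear[OF holomorphic_map_has_derivative(1)[OF f lS[OF that]]])
  have app: "blinfun_apply (?D y \<theta>) = (\<lambda>u. cis (-\<theta>) *s frechet_derivative f (at (?l y \<theta>)) u)"
    if "y \<in> ball x e" for y \<theta>
    by (rule bounded_linear_Blinfun_apply[OF bl[OF that]])
  have der: "((\<lambda>y. ?F y \<theta>) has_derivative blinfun_apply (?D y \<theta>)) (at y within ball x e)"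
    if y: "y \<in> ball x e" for y \<theta>
  proof -
    have "((\<lambda>y. ?l y \<theta>) has_derivative (\<lambda>u. u)) (at y)"
      unfolding complex_line_def by (auto intro!: derivative_eq_intros)
    from has_derivative_compose[OF this holomorphic_map_has_derivative(1)[OF f lS[OF y]]]
    have "((\<lambda>y. f (?l y \<theta>)) has_derivative frechet_derivative f (at (?l y \<theta>))) (at y)" .
    then have "((\<lambda>y. ?F y \<theta>) has_derivative (\<lambda>u. cis (-\<theta>) *s frechet_derivative f (at (?l y \<theta>)) u)) (at y)"
      by (rule bounded_linear.has_derivative[OF bounded_linear_vector_scalar_mult])
    then show ?thesis unfolding app[OF y] by (rule has_derivative_at_withinI)
  qed
  have contF: "continuous_on (cbox 0 (2*pi)) (?F y)" if y: "y \<in> ball x e" for y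
  proof -
    have "continuous_on (cbox 0 (2*pi)) (\<lambda>\<theta>. f (?l y \<theta>))"
      by (rule continuous_on_compose2[OF holomorphic_imp_continuous[OF f]])
         (use lS[OF y] in \<open>auto intro!: continuous_intros\<close>)
    then show ?thesis
      by (subst continuous_on_componentwise) (auto simp: Basis_vec_def inner_axis intro!: continuous_intros)
  qed
  have contD: "continuous_on (ball x e \<times> cbox 0 (2*pi)) (\<lambda>(y, \<theta>). ?D y \<theta>)"
  proof (rule continuous_on_blinfun_componentwise)
    fix u :: 'v
    have "continuous_on (ball x e \<times> cbox 0 (2*pi)) (\<lambda>p. frechet_derivative f (at (?l (fst p) (snd p))) u)"
      by (rule continuous_on_compose2[OF derivative_continuous[OF f]])
         (use lS in \<open>auto intro!: continuous_intros\<close>)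
    then have "continuous_on (ball x e \<times> cbox 0 (2*pi)) (\<lambda>p. cis (- snd p) *s frechet_derivative f (at (?l (fst p) (snd p))) u)"
      by (subst continuous_on_componentwise) (auto simp: Basis_vec_def inner_axis intro!: continuous_intros)
    then show "continuous_on (ball x e \<times> cbox 0 (2*pi)) (\<lambda>p. blinfun_apply (case p of (y, \<theta>) \<Rightarrow> ?D y \<theta>) u)"
      by (rule continuous_on_eq) (auto simp: app)
  qed
  \<comment> \<open>The Leibniz rule works relative to a convex set; on the open ball this is the derivative proper.\<close>
  have xin: "x \<in> ball x e" using e by simp
  have "((\<lambda>y. integral (cbox 0 (2*pi)) (?F y)) has_derivative integral (cbox 0 (2*pi)) (?D x)) (at x within ball x e)"
    by (rule leibniz_rule[OF der _ contD xin]) (auto intro!: integrable_continuous contF simp del: cbox_interval box_real)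
  then have "((\<lambda>y. integral (cbox 0 (2*pi)) (?F y)) has_derivative blinfun_apply (integral (cbox 0 (2*pi)) (?D x))) (at x)"
    using e by (simp add: at_within_open[OF xin])
  then have 1: "((\<lambda>y. (1 / (2*pi*r)) *\<^sub>R integral (cbox 0 (2*pi)) (?F y)) has_derivative
      (\<lambda>u. (1 / (2*pi*r)) *\<^sub>R blinfun_apply (integral (cbox 0 (2*pi)) (?D x)) u)) (at x)"
    by (intro derivative_intros)
  have contDx: "continuous_on (cbox 0 (2*pi)) (?D x)"
  proof -
    have "continuous_on (cbox 0 (2*pi)) (\<lambda>\<theta>. (\<lambda>(y, \<theta>). ?D y \<theta>) (x, \<theta>))"
      by (rule continuous_on_compose2[OF contD]) (use e in \<open>auto intro!: continuous_intros\<close>)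
    then show ?thesis by simp
  qed
  have 2: "blinfun_apply (integral (cbox 0 (2*pi)) (?D x)) u
      = integral (cbox 0 (2*pi)) (\<lambda>\<theta>. cis (-\<theta>) *s frechet_derivative f (at (?l x \<theta>)) u)" for u
    by (subst blinfun_apply_integral[OF integrable_continuous[OF contDx]])
       (simp add: app[OF xin] del: cbox_interval box_real)
  have ev: "\<forall>\<^sub>F y in nhds x. (1 / (2*pi*r)) *\<^sub>R integral (cbox 0 (2*pi)) (?F y) = frechet_derivative f (at y) v"
  proof -
    have "\<forall>\<^sub>F y in nhds x. y \<in> ball x e" using e by (intro eventually_nhds_in_open) auto
    then show ?thesis
      by eventually_elim (rule Cauchy_formula[OF f r sub, symmetric])
  qed
  show ?thesis
    by (rule has_derivative_transform_eventually[OF 1[unfolded 2]])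
       (use ev eventually_nhds_x_imp_x[OF ev] in \<open>auto simp: eventually_at_filter elim: eventually_mono\<close>)
qed

text \<open>
  Complex linearity of the derivative passes through the integral in \<open>second_derivative\<close>.  By
  iteration, holomorphic maps have derivatives of every order; the Jacobi identity takes three.
\<close>

lemma holomorphic_derivative:
  fixes f :: "'v \<Rightarrow> complex ^ 'n"
  assumes f: "holomorphic_map J cplx_J S f"
  shows "holomorphic_map J cplx_J S (\<lambda>x. frechet_derivative f (at x) v)"
  unfolding holomorphic_map_def
proof
  fix x assume "x \<in> S"
  obtain e r where er: "0 < e" "0 < r" "ball x e \<subseteq> S"
    "\<And>y z. y \<in> ball x e \<Longrightarrow> cmod z \<le> r \<Longrightarrow> complex_line J y v z \<in> S"
    using radius_exists[OF \<open>x \<in> S\<close>] by metis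
  let ?l = "\<lambda>\<theta>. complex_line J x v (complex_of_real r * cis \<theta>)"
  have lS: "?l \<theta> \<in> S" for \<theta> using er by (auto simp: norm_mult)
  let ?G = "\<lambda>u \<theta>. cis (-\<theta>) *s frechet_derivative f (at (?l \<theta>)) u"
  have i: "?G u integrable_on cbox 0 (2*pi)" for u
  proof (rule integrable_continuous)
    have "continuous_on (cbox 0 (2*pi)) (\<lambda>\<theta>. frechet_derivative f (at (?l \<theta>)) u)"
      by (rule continuous_on_compose2[OF derivative_continuous[OF f]])
         (use lS in \<open>auto intro!: continuous_intros\<close>)
    then show "continuous_on (cbox 0 (2*pi)) (?G u)"
      by (subst continuous_on_componentwise) (auto simp: Basis_vec_def inner_axis intro!: continuous_intros)
  qed
  have "integral (cbox 0 (2*pi)) (?G (J u)) = \<i> *s integral (cbox 0 (2*pi)) (?G u)" for u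
  proof -
    have "integral (cbox 0 (2*pi)) (?G (J u)) = integral (cbox 0 (2*pi)) ((\<lambda>x. \<i> *s x) \<circ> ?G u)"
      by (rule integral_cong)
         (use holomorphic_map_has_derivative(2)[OF f lS] in \<open>simp add: vector_smult_assoc mult.commute\<close>)
    also have "\<dots> = \<i> *s integral (cbox 0 (2*pi)) (?G u)"
      by (rule integral_linear[OF i bounded_linear_vector_scalar_mult])
    finally show ?thesis .
  qed
  moreover have "c *\<^sub>R (\<i> *s (w :: complex^'n)) = \<i> *s (c *\<^sub>R w)" for c w by (simp add: vec_eq_iff)
  ultimately show "\<exists>D. ((\<lambda>x. frechet_derivative f (at x) v) has_derivative D) (at x) \<and> (\<forall>v. D (J v) = cplx_J (D v))"
    by (intro exI[of _ "\<lambda>u. (1 / (2*pi*r)) *\<^sub>R integral (cbox 0 (2*pi)) (?G u)"] conjI allI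
          second_derivative[OF f er(2,1) er(4)]) simp_all
qed

text \<open>
  By \<open>second_derivative\<close> the left side is a mean of the \<open>u\<close>-derivatives of \<open>f\<close> over a circle in direction
  \<open>v\<close>; Cauchy's formula for the holomorphic map \<open>D\<^sub>u f\<close> turns the same mean into the right side.
\<close>

lemma second_derivative_symmetric:
  fixes f :: "'v \<Rightarrow> complex ^ 'n"
  assumes f: "holomorphic_map J cplx_J S f" and x: "x \<in> S"
  shows "frechet_derivative (\<lambda>y. frechet_derivative f (at y) v) (at x) u
       = frechet_derivative (\<lambda>y. frechet_derivative f (at y) u) (at x) v"
proof -
  obtain e r where er: "0 < e" "0 < r" "ball x e \<subseteq> S"
    "\<And>y z. y \<in> ball x e \<Longrightarrow> cmod z \<le> r \<Longrightarrow> complex_line J y v z \<in> S"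
    using radius_exists[OF x] by metis
  have "x \<in> ball x e" using er by simp
  from Cauchy_formula[OF holomorphic_derivative[OF f] er(2) er(4)[OF this]]
    frechet_derivative_at[OF second_derivative[OF f er(2,1) er(4)], symmetric]
  show ?thesis by simp
qed

end

section \<open>The Lie algebra of a complex Lie group\<close>

locale complex_lie_algebra =
  fixes br :: "complex ^ 'n \<Rightarrow> complex ^ 'n \<Rightarrow> complex ^ 'n"
  assumes br_add_left: "br (X + Y) Z = br X Z + br Y Z"
    and br_scale_left: "br (c *s X) Z = c *s br X Z"
    and br_anti: "br X Y = - br Y X"
    and jacobi: "br X (br Y Z) + br Y (br Z X) + br Z (br X Y) = 0"

lemma smult_split: "c *s (X :: complex ^ 'n) = Re c *\<^sub>R X + Im c *\<^sub>R cplx_J X"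
  by (subst complex_eq[of c]) (simp add: vec_eq_iff scaleR_conv_of_real[where 'a=complex] algebra_simps)

lemma has_derivative_transform_nhds:
  assumes "(f has_derivative D) (at x)" "\<forall>\<^sub>F y in nhds x. f y = g y"
  shows "(g has_derivative D) (at x)"
  by (rule has_derivative_transform_eventually[OF assms(1)])
     (use assms(2) eventually_nhds_x_imp_x[OF assms(2)] in \<open>auto simp: eventually_at_filter elim: eventually_mono\<close>)

text \<open>
  The product rule for the evaluation of a varying linear map at a varying vector.  Only the values
  \<open>F x w\<close> at fixed \<open>w\<close> are assumed differentiable, so the vector is expanded in a basis.
\<close>

lemma has_derivative_linear_family:
  fixes F :: "'a::real_normed_vector \<Rightarrow> 'w::euclidean_space \<Rightarrow> 'c::real_normed_vector"
  assumes F: "\<And>w. ((\<lambda>x. F x w) has_derivative F' w) (at x0)"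
    and lin: "\<forall>\<^sub>F x in nhds x0. linear (F x)"
    and om: "(om has_derivative om') (at x0)"
  shows "((\<lambda>x. F x (om x)) has_derivative (\<lambda>u. F x0 (om' u) + F' (om x0) u)) (at x0)"
proof -
  have exp: "f w = (\<Sum>b\<in>Basis. (w \<bullet> b) *\<^sub>R f b)" if "linear f" for f :: "'w \<Rightarrow> 'c" and w
    using that by (subst euclidean_representation[of w, symmetric]) (simp add: linear_sum linear_cmul)
  have lin0: "linear (F x0)" using lin by (rule eventually_nhds_x_imp_x)
  have F'exp: "F' w u = (\<Sum>b\<in>Basis. (w \<bullet> b) *\<^sub>R F' b u)" for w u
  proof -
    have "((\<lambda>x. \<Sum>b\<in>Basis. (w \<bullet> b) *\<^sub>R F x b) has_derivative (\<lambda>u. \<Sum>b\<in>Basis. (w \<bullet> b) *\<^sub>R F' b u)) (at x0)"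
      by (intro derivative_intros F)
    then have "((\<lambda>x. F x w) has_derivative (\<lambda>u. \<Sum>b\<in>Basis. (w \<bullet> b) *\<^sub>R F' b u)) (at x0)"
      by (rule has_derivative_transform_nhds) (use lin in \<open>eventually_elim, metis exp\<close>)
    from has_derivative_unique[OF F this] show ?thesis by metis
  qed
  have "((\<lambda>x. \<Sum>b\<in>Basis. (om x \<bullet> b) *\<^sub>R F x b) has_derivative
      (\<lambda>u. \<Sum>b\<in>Basis. (om x0 \<bullet> b) *\<^sub>R F' b u + (om' u \<bullet> b) *\<^sub>R F x0 b)) (at x0)"
    by (intro derivative_intros F om)
  then have "((\<lambda>x. F x (om x)) has_derivative
      (\<lambda>u. \<Sum>b\<in>Basis. (om x0 \<bullet> b) *\<^sub>R F' b u + (om' u \<bullet> b) *\<^sub>R F x0 b)) (at x0)"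
    by (rule has_derivative_transform_nhds) (use lin in \<open>eventually_elim, metis exp\<close>)
  moreover have "(\<Sum>b\<in>Basis. (om x0 \<bullet> b) *\<^sub>R F' b u + (om' u \<bullet> b) *\<^sub>R F x0 b) = F x0 (om' u) + F' (om x0) u" for u
    unfolding sum.distrib F'exp[of "om x0" u] exp[OF lin0, of "om' u"] by (rule add.commute)
  ultimately show ?thesis by simp
qed

text \<open>
  The multiplication of a complex Lie group read in a chart around the identity \<open>x0\<close>: it is defined on
  the open set \<open>S\<close> of those pairs whose product stays in the chart domain \<open>D\<close>.
\<close>

locale local_complex_group =
  fixes m :: "(complex ^ 'n) \<times> (complex ^ 'n) \<Rightarrow> complex ^ 'n"
    and S D and x0 :: "complex ^ 'n"
  assumes openS: "open S" and openD: "open D" and x0D: "x0 \<in> D"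
    and hol: "holomorphic_map (map_prod cplx_J cplx_J) cplx_J S m"
    and mD: "p \<in> S \<Longrightarrow> m p \<in> D"
    and unit_right: "x \<in> D \<Longrightarrow> (x, x0) \<in> S \<and> m (x, x0) = x"
    and unit_left: "x \<in> D \<Longrightarrow> (x0, x) \<in> S \<and> m (x0, x) = x"
    and assoc: "(x, y) \<in> S \<Longrightarrow> (y, z) \<in> S \<Longrightarrow> (m (x, y), z) \<in> S \<Longrightarrow> (x, m (y, z)) \<in> S \<Longrightarrow>
       m (m (x, y), z) = m (x, m (y, z))"
begin

abbreviation JJ :: "(complex ^ 'n) \<times> (complex ^ 'n) \<Rightarrow> (complex ^ 'n) \<times> (complex ^ 'n)"
  where "JJ \<equiv> map_prod cplx_J cplx_J"

sublocale prod: holomorphic_family JJ S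
proof (rule holomorphic_family.intro)
  have "JJ = (\<lambda>p. (\<i> *s fst p, \<i> *s snd p))" by auto
  then show "bounded_linear JJ"
    by (simp only:) (intro bounded_linear_Pair bounded_linear_compose[OF bounded_linear_vector_scalar_mult]
        bounded_linear_fst bounded_linear_snd)
  show "JJ (JJ v) = - v" for v by (cases v) (simp add: vector_smult_assoc vec_eq_iff)
qed (rule openS)

sublocale one: holomorphic_family cplx_J D
proof (rule holomorphic_family.intro)
  show "bounded_linear cplx_J" by (rule bounded_linear_vector_scalar_mult)
  show "cplx_J (cplx_J v) = - v" for v by (simp add: vector_smult_assoc vec_eq_iff)
qed (rule openD)

abbreviation Dm where "Dm p \<equiv> frechet_derivative m (at p)"
text \<open>
  The left-invariant vector field with value \<open>v\<close> at the identity.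
\<close>

definition L :: "complex ^ 'n \<Rightarrow> complex ^ 'n \<Rightarrow> complex ^ 'n" where "L v x = Dm (x, x0) (0, v)"

lemma Dm: "p \<in> S \<Longrightarrow> (m has_derivative Dm p) (at p)"
  by (rule holomorphic_map_has_derivative(1)[OF hol])

lemma m_snd_derivative:
  assumes "(x, y) \<in> S" "(f has_derivative f') (at z)" "f z = y"
  shows "((\<lambda>z. m (x, f z)) has_derivative (\<lambda>v. Dm (x, y) (0, f' v))) (at z)"
proof -
  have "((\<lambda>z. (x, f z)) has_derivative (\<lambda>v. (0, f' v))) (at z)"
    using assms(2) by (auto intro!: derivative_eq_intros)
  from has_derivative_compose[OF this, of m] Dm[OF assms(1)] assms(3) show ?thesis by simp
qed

lemma L_partial:
  assumes "x \<in> D" shows "frechet_derivative (\<lambda>y. m (x, y)) (at x0) v = L v x"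
proof -
  have "((\<lambda>y. m (x, y)) has_derivative (\<lambda>v. Dm (x, x0) (0, v))) (at x0)"
    by (rule m_snd_derivative) (use unit_right[OF assms] in auto)
  from frechet_derivative_at[OF this, symmetric] show ?thesis by (simp add: L_def)
qed

lemma L_hol: "holomorphic_map cplx_J cplx_J D (L v)"
  unfolding holomorphic_map_def
proof
  fix a assume a: "a \<in> D"
  let ?P = "\<lambda>p. Dm p (0, v)"
  have hP: "holomorphic_map JJ cplx_J S ?P" by (rule prod.holomorphic_derivative[OF hol])
  have aS: "(a, x0) \<in> S" using unit_right[OF a] by simp
  note P = holomorphic_map_has_derivative[OF hP aS]
  have "((\<lambda>a. (a, x0)) has_derivative (\<lambda>u. (u, 0))) (at a)" by (auto intro!: derivative_eq_intros)
  from has_derivative_compose[OF this P(1)]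
  have "(L v has_derivative (\<lambda>u. frechet_derivative ?P (at (a, x0)) (u, 0))) (at a)" by (simp add: L_def[abs_def])
  moreover have "frechet_derivative ?P (at (a, x0)) (\<i> *s u, 0) = \<i> *s frechet_derivative ?P (at (a, x0)) (u, 0)" for u
    using P(2)[of "(u, 0)"] by simp
  ultimately show "\<exists>Da. (L v has_derivative Da) (at a) \<and> (\<forall>v. Da (cplx_J v) = cplx_J (Da v))" by blast
qed

abbreviation DL where "DL v a \<equiv> frechet_derivative (L v) (at a)"

lemma DL: "a \<in> D \<Longrightarrow> (L v has_derivative DL v a) (at a)"
  by (rule holomorphic_map_has_derivative(1)[OF L_hol])

lemma linear_Dm: "p \<in> S \<Longrightarrow> linear (Dm p)"
  using Dm has_derivative_linear by blast

lemma linear_DL: "a \<in> D \<Longrightarrow> linear (DL v a)"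
  using DL has_derivative_linear by blast

lemma L_unit: "L v x0 = v"
proof -
  have "((\<lambda>y. m (x0, y)) has_derivative (\<lambda>v. v)) (at x0)"
  proof (rule has_derivative_transform_within_open[OF has_derivative_ident openD x0D])
    show "\<And>x. x \<in> D \<Longrightarrow> x = m (x0, x)" using unit_left by simp
  qed
  from frechet_derivative_at[OF this, symmetric] L_partial[OF x0D] show ?thesis by simp
qed

lemma L_linear: "x \<in> D \<Longrightarrow> linear (\<lambda>v. L v x)"
proof -
  assume x: "x \<in> D"
  have "linear (\<lambda>v. (0::complex^'n, v::complex^'n))" by (rule linearI) auto
  from linear_compose[OF this linear_Dm] unit_right[OF x] show ?thesis
    by (simp add: o_def L_def)
qed

lemma L_scale: assumes x: "x \<in> D" shows "L (\<i> *s v) x = \<i> *s L v x"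
  using holomorphic_map_has_derivative(2)[OF hol, of "(x,x0)" "(0, v)"] unit_right[OF x]
  by (simp add: L_def)

text \<open>
  Left invariance is associativity \<open>(a x) y = a (x y)\<close>, differentiated in \<open>y\<close> at the identity.
\<close>

lemma L_equivariant:
  assumes S: "(a, x) \<in> S" "x \<in> D"
  shows "L v (m (a, x)) = Dm (a, x) (0, L v x)"
proof -
  let ?f = "\<lambda>y. m (m (a, x), y)" and ?g = "\<lambda>y. m (a, m (x, y))"
  have xS: "(x, x0) \<in> S" "m (x, x0) = x" using unit_right S by auto
  have maD: "m (a, x) \<in> D" using mD S by blast
  have mS: "(m (a, x), x0) \<in> S" "m (m (a,x), x0) = m (a,x)" using unit_right[OF maD] by auto
  have isD: "((\<lambda>y. m (x, y)) has_derivative (\<lambda>v. Dm (x, x0) (0, v))) (at x0)"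
    by (rule m_snd_derivative) (use xS in auto)
  have f: "(?f has_derivative (\<lambda>v. Dm (m (a, x), x0) (0, v))) (at x0)"
    by (rule m_snd_derivative) (use mS in auto)
  have g: "(?g has_derivative (\<lambda>v. Dm (a, x) (0, Dm (x, x0) (0, v)))) (at x0)"
    by (rule m_snd_derivative[OF _ isD]) (use S xS in auto)
  have c1: "isCont (\<lambda>y. (x, y)) x0" "isCont (\<lambda>y. (m (a, x), y)) x0" by (auto intro!: continuous_intros)
  have c2: "isCont (\<lambda>y. (a, m (x, y))) x0"
    using has_derivative_continuous[OF isD] by (intro continuous_intros)
  have e: "\<forall>\<^sub>F y in nhds x0. f y \<in> S" if "isCont f x0" "f x0 \<in> S" for f
    using topological_tendstoD[OF _ openS that(2)] that(1)
    by (simp add: isCont_def tendsto_at_iff_tendsto_nhds)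
  have "\<forall>\<^sub>F y in nhds x0. (x, y) \<in> S" "\<forall>\<^sub>F y in nhds x0. (m (a, x), y) \<in> S" "\<forall>\<^sub>F y in nhds x0. (a, m (x, y)) \<in> S"
    using xS mS S by (auto intro!: e c1 c2)
  then have "\<forall>\<^sub>F y in nhds x0. ?g y = ?f y"
    by eventually_elim (use S assoc in auto)
  from has_derivative_transform_nhds[OF g this]
  have "(?f has_derivative (\<lambda>v. Dm (a, x) (0, Dm (x, x0) (0, v)))) (at x0)" .
  from has_derivative_unique[OF f this] show ?thesis by (metis L_def)
qed

text \<open>
  The mixed second derivative of the multiplication at the identity; the Lie bracket is its
  antisymmetrization.
\<close>

definition b where "b u v = DL v x0 u"

text \<open>
  Left-invariant fields are closed under the bracket of vector fields.  Differentiating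
  \<open>L_equivariant\<close> in \<open>x\<close> in direction \<open>u\<close> yields \<open>L (b u v)\<close> and a pure second derivative of the
  multiplication; the latter is symmetric in \<open>u\<close> and \<open>v\<close> and disappears in the difference.
\<close>

lemma DL_bracket:
  assumes a: "a \<in> D"
  shows "DL v a (L u a) - DL u a (L v a) = L (b u v - b v u) a"
proof -
  have aS: "(a, x0) \<in> S" "m (a, x0) = a" using unit_right[OF a] by auto
  define P where "P w = (\<lambda>p. Dm p (0, w))" for w
  have hP: "holomorphic_map JJ cplx_J S (P w)" for w unfolding P_def by (rule prod.holomorphic_derivative[OF hol])
  define P' where "P' w = frechet_derivative (P w) (at (a, x0))" for w
  have key: "DL v a (L u a) = L (b u v) a + P' v (0, u)" for u v
  proof -
    have dma: "((\<lambda>x. m (a, x)) has_derivative (\<lambda>u. L u a)) (at x0)"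
      unfolding L_def by (rule m_snd_derivative) (use aS in auto)
    have d1: "((\<lambda>x. L v (m (a, x))) has_derivative (\<lambda>u. DL v a (L u a))) (at x0)"
      using has_derivative_compose[OF dma, of "L v"] DL[OF a] aS by simp
    have d2: "((\<lambda>x. Dm (a, x) (0, L v x)) has_derivative (\<lambda>u. Dm (a, x0) (0, DL v x0 u) + P' (L v x0) (0, u))) (at x0)"
    proof (rule has_derivative_linear_family[where F="\<lambda>x w. Dm (a, x) (0, w)" and F'="\<lambda>w u. P' w (0, u)"])
      show "((\<lambda>x. Dm (a, x) (0, w)) has_derivative (\<lambda>u. P' w (0, u))) (at x0)" for w
      proof -
        have "((\<lambda>x. (a, x)) has_derivative (\<lambda>u. (0, u))) (at x0)" by (auto intro!: derivative_eq_intros)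
        from has_derivative_compose[OF this holomorphic_map_has_derivative(1)[OF hP aS(1)]]
        show ?thesis by (simp add: P_def P'_def)
      qed
      have "\<forall>\<^sub>F x in nhds x0. (a, x) \<in> S"
      proof -
        have "open ((\<lambda>x. (a, x)) -` S)" by (rule open_vimage[OF openS]) (intro continuous_intros)
        from eventually_nhds_in_open[OF this, of x0] show ?thesis using aS by simp
      qed
      then show "\<forall>\<^sub>F x in nhds x0. linear (\<lambda>w. Dm (a, x) (0, w))"
      proof eventually_elim
        case (elim x)
        have "linear (\<lambda>v. (0::complex^'n, v::complex^'n))" by (rule linearI) auto
        from linear_compose[OF this linear_Dm[OF elim]] show ?case by (simp add: o_def)
      qed
      show "(L v has_derivative DL v x0) (at x0)" by (rule DL[OF x0D])
    qed
    have d3: "\<forall>\<^sub>F x in nhds x0. Dm (a, x) (0, L v x) = L v (m (a, x))"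
    proof -
      have "open ((\<lambda>x. (a, x)) -` S \<inter> D)" by (intro open_Int openD open_vimage[OF openS]) (intro continuous_intros)
      from eventually_nhds_in_open[OF this, of x0] have "\<forall>\<^sub>F x in nhds x0. x \<in> (\<lambda>x. (a, x)) -` S \<inter> D" using aS x0D by simp
      then show ?thesis by eventually_elim (auto simp: L_equivariant)
    qed
    from fun_cong[OF has_derivative_unique[OF d1 has_derivative_transform_nhds[OF d2 d3]], of u] show ?thesis by (simp add: L_unit b_def) (simp add: L_def)
  qed
  have sym: "P' v (0, u) = P' u (0, v)"
    unfolding P'_def P_def by (rule prod.second_derivative_symmetric[OF hol aS(1)])
  have "L (b u v - b v u) a = L (b u v) a - L (b v u) a" by (rule linear_diff[OF L_linear[OF a]])
  then show ?thesis using key[of u v] key[of v u] sym by simp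
qed

definition q where "q v u z = frechet_derivative (\<lambda>a. DL v a u) (at x0) z"

lemma q_sym: "q v u z = q v z u"
  unfolding q_def by (rule one.second_derivative_symmetric[OF L_hol x0D])

text \<open>
  The derivative of \<open>DL_bracket\<close> at the identity.  Summed cyclically over \<open>z\<close>, \<open>u\<close>, \<open>v\<close> it becomes the
  Jacobi identity, since the third order terms \<open>q\<close> are symmetric in their last two arguments and
  cancel in pairs.
\<close>

lemma DL_bracket_derivative:
  "b (b z u) v + q v u z - (b (b z v) u + q u v z) = b z (b u v - b v u)"
proof -
  have d: "((\<lambda>a. DL v a (L u a)) has_derivative (\<lambda>z. DL v x0 (DL u x0 z) + q v (L u x0) z)) (at x0)" for u v
  proof (rule has_derivative_linear_family[where F="\<lambda>a w. DL v a w"])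
    show "((\<lambda>a. DL v a w) has_derivative q v w) (at x0)" for w
      unfolding q_def
      by (rule holomorphic_map_has_derivative(1)[OF one.holomorphic_derivative[OF L_hol] x0D])
    show "\<forall>\<^sub>F a in nhds x0. linear (DL v a)"
      using eventually_nhds_in_open[OF openD x0D] by eventually_elim (rule linear_DL)
    show "(L u has_derivative DL u x0) (at x0)" by (rule DL[OF x0D])
  qed
  have "((\<lambda>a. DL v a (L u a) - DL u a (L v a)) has_derivative
     (\<lambda>z. (DL v x0 (DL u x0 z) + q v (L u x0) z) - (DL u x0 (DL v x0 z) + q u (L v x0) z))) (at x0)"
    by (rule has_derivative_diff[OF d d])
  then have "(L (b u v - b v u) has_derivative
     (\<lambda>z. (DL v x0 (DL u x0 z) + q v (L u x0) z) - (DL u x0 (DL v x0 z) + q u (L v x0) z))) (at x0)"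
    by (rule has_derivative_transform_within_open[OF _ openD x0D]) (rule DL_bracket)
  from has_derivative_unique[OF DL[OF x0D] this]
  show ?thesis by (simp add: L_unit b_def fun_eq_iff)
qed

lemma b_add_left: "b (u + u') v = b u v + b u' v"
  unfolding b_def by (rule linear_add[OF linear_DL[OF x0D]])

lemma b_i_left: "b (\<i> *s u) v = \<i> *s b u v"
  unfolding b_def by (rule holomorphic_map_has_derivative(2)[OF L_hol x0D])

lemma b_add_right: "b u (v + v') = b u v + b u v'"
proof -
  have "(L (v + v') has_derivative (\<lambda>u. DL v x0 u + DL v' x0 u)) (at x0)"
    by (rule has_derivative_transform_within_open[OF has_derivative_add[OF DL[OF x0D] DL[OF x0D]] openD x0D])
       (simp add: linear_add[OF L_linear])
  from has_derivative_unique[OF DL[OF x0D] this] show ?thesis by (simp add: b_def)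
qed

lemma b_i_right: "b u (\<i> *s v) = \<i> *s b u v"
proof -
  have "(L (\<i> *s v) has_derivative (\<lambda>u. \<i> *s DL v x0 u)) (at x0)"
    by (rule has_derivative_transform_within_open[OF bounded_linear.has_derivative[OF bounded_linear_vector_scalar_mult DL[OF x0D]] openD x0D])
       (simp add: L_scale)
  from has_derivative_unique[OF DL[OF x0D] this] show ?thesis by (simp add: b_def)
qed

lemma b_scaleR: "b (r *\<^sub>R u) v = r *\<^sub>R b u v" "b u (r *\<^sub>R v) = r *\<^sub>R b u v"
proof -
  show "b (r *\<^sub>R u) v = r *\<^sub>R b u v" unfolding b_def by (rule linear_cmul[OF linear_DL[OF x0D]])
  have "(L (r *\<^sub>R v) has_derivative (\<lambda>u. r *\<^sub>R DL v x0 u)) (at x0)"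
    by (rule has_derivative_transform_within_open[OF has_derivative_scaleR_right[OF DL[OF x0D]] openD x0D])
       (simp add: linear_cmul[OF L_linear])
  from has_derivative_unique[OF DL[OF x0D] this] show "b u (r *\<^sub>R v) = r *\<^sub>R b u v" by (simp add: b_def)
qed

lemma lie_algebra: "complex_lie_algebra (\<lambda>u v. b u v - b v u)"
proof
  fix X Y Z :: "complex^'n" and c
  have sl: "b (c *s X) Z = c *s b X Z"
    by (subst smult_split, simp only: b_add_left b_scaleR b_i_left, subst smult_split[of c "b X Z"], rule refl)
  have sr: "b Z (c *s X) = c *s b Z X"
    by (subst smult_split, simp only: b_add_right b_scaleR b_i_right, subst smult_split[of c "b Z X"], rule refl)
  show "b (X + Y) Z - b Z (X + Y) = b X Z - b Z X + (b Y Z - b Z Y)"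
    by (simp add: b_add_left b_add_right)
  show "b (c *s X) Z - b Z (c *s X) = c *s (b X Z - b Z X)"
    by (simp add: sl sr vec_eq_iff algebra_simps)
  show "b X Y - b Y X = - (b Y X - b X Y)" by simp
  have minus: "b (u - u') v = b u v - b u' v" for u u' v
    using b_add_left[of u "- u'" v] b_scaleR(1)[of "-1" u' v] by simp
  define br where "br u v = b u v - b v u" for u v
  show "b X (b Y Z - b Z Y) - b (b Y Z - b Z Y) X + (b Y (b Z X - b X Z) - b (b Z X - b X Z) Y)
      + (b Z (b X Y - b Y X) - b (b X Y - b Y X) Z) = 0"
    unfolding DL_bracket_derivative[symmetric] minus
    using q_sym[of Z Y X] q_sym[of Y Z X] q_sym[of X Z Y] by simp
qed

end


context complex_lie_group
begin

lemma chart_inverse: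
  assumes "(U, \<phi>) \<in> \<A>"
  shows "inj_on \<phi> U" "U \<subseteq> carrier G" "continuous_map (top_of_set (\<phi> ` U)) \<T> (inv_into U \<phi>)"
    "continuous_map (subtopology \<T> U) euclidean \<phi>"
proof -
  note c = chart[OF assms]
  show sub: "U \<subseteq> carrier G" using c openin_subset topspace_eq by blast
  then have tU: "topspace (subtopology \<T> U) = U" using topspace_eq by auto
  have hm: "homeomorphic_map (subtopology \<T> U) (top_of_set (\<phi> ` U)) \<phi>" using c by blast
  show inj: "inj_on \<phi> U" using homeomorphic_imp_injective_map[OF hm] tU by simp
  show "continuous_map (subtopology \<T> U) euclidean \<phi>"
    using homeomorphic_imp_continuous_map[OF hm] continuous_map_in_subtopology by blast
  obtain g where g: "homeomorphic_maps (subtopology \<T> U) (top_of_set (\<phi> ` U)) \<phi> g"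
    using hm homeomorphic_map_maps by blast
  then have cg: "continuous_map (top_of_set (\<phi> ` U)) (subtopology \<T> U) g"
    and gi: "\<And>u. u \<in> U \<Longrightarrow> g (\<phi> u) = u"
    unfolding homeomorphic_maps_def using tU by auto
  have "continuous_map (top_of_set (\<phi> ` U)) (subtopology \<T> U) (inv_into U \<phi>)"
    by (rule continuous_map_eq[OF cg]) (use gi inj in auto)
  then show "continuous_map (top_of_set (\<phi> ` U)) \<T> (inv_into U \<phi>)"
    by (simp add: continuous_map_in_subtopology)
qed

theorem lie_algebra:
  assumes U: "(U, \<phi>) \<in> \<A>" and one: "\<one> \<in> U"
  shows "complex_lie_algebra (lie_bracket G U \<phi>)"
proof -
  note c = chart[OF U] and ci = chart_inverse[OF U]
  let ?iv = "inv_into U \<phi>" and ?D = "\<phi> ` U"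
  define m where "m = (\<lambda>(x, y). \<phi> (?iv x \<otimes> ?iv y))"
  define S where "S = {(x, y). x \<in> ?D \<and> y \<in> ?D \<and> ?iv x \<otimes> ?iv y \<in> U}"
  have ivU: "?iv x \<in> U" if "x \<in> ?D" for x using that by (rule inv_into_into)
  have ivphi[simp]: "?iv (\<phi> u) = u" if "u \<in> U" for u using ci(1) that by simp
  have openS: "open S"
  proof -
    have "continuous_map (top_of_set (?D \<times> ?D)) (prod_topology \<T> \<T>) (\<lambda>p. (?iv (fst p), ?iv (snd p)))"
      by (intro continuous_map_pairedI continuous_map_compose[OF _ ci(3), unfolded o_def])
         (auto simp: continuous_map_in_subtopology intro!: continuous_intros)
    from continuous_map_compose[OF this mult_continuous]
    have cm: "continuous_map (top_of_set (?D \<times> ?D)) \<T> (\<lambda>p. ?iv (fst p) \<otimes> ?iv (snd p))" by (simp add: o_def)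
    have "openin (top_of_set (?D \<times> ?D)) {p \<in> topspace (top_of_set (?D \<times> ?D)). ?iv (fst p) \<otimes> ?iv (snd p) \<in> U}"
      by (rule openin_continuous_map_preimage[OF cm]) (use c in blast)
    moreover have "{p \<in> topspace (top_of_set (?D \<times> ?D)). ?iv (fst p) \<otimes> ?iv (snd p) \<in> U} = S"
      unfolding S_def by auto
    moreover have "open (?D \<times> ?D)" using c by (intro open_Times) auto
    ultimately show ?thesis by (simp add: openin_open_eq)
  qed
  interpret lg: local_complex_group m S ?D "\<phi> \<one>"
  proof (rule local_complex_group.intro)
    show "open S" by (rule openS)
    show "open ?D" using c by blast
    show "\<phi> \<one> \<in> ?D" using one by blast
    show "holomorphic_map (map_prod cplx_J cplx_J) cplx_J S m"
      unfolding S_def m_def using mult_holomorphic[OF U U U] .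
    show "m p \<in> ?D" if "p \<in> S" for p using that unfolding S_def m_def by auto
    show "(x, \<phi> \<one>) \<in> S \<and> m (x, \<phi> \<one>) = x" if "x \<in> ?D" for x
      using that one ci(2) unfolding S_def m_def by auto
    show "(\<phi> \<one>, x) \<in> S \<and> m (\<phi> \<one>, x) = x" if "x \<in> ?D" for x
      using that one ci(2) unfolding S_def m_def by auto
    show "m (m (x, y), z) = m (x, m (y, z))"
      if "(x, y) \<in> S" "(y, z) \<in> S" "(m (x, y), z) \<in> S" "(x, m (y, z)) \<in> S" for x y z
    proof -
      have "?iv x \<in> carrier G" "?iv y \<in> carrier G" "?iv z \<in> carrier G"
        using that ivU ci(2) unfolding S_def by blast+
      then show ?thesis using that unfolding S_def m_def by (auto simp: m_assoc)
    qed
  qed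
  have field: "left_inv_field G U \<phi> v x = lg.L v x" if "x \<in> ?D" for v x
    using lg.L_partial[OF that, of v] unfolding left_inv_field_def m_def by simp
  have fd: "frechet_derivative (left_inv_field G U \<phi> v) (at (\<phi> \<one>)) u = lg.b u v" for u v
  proof -
    have "(left_inv_field G U \<phi> v has_derivative lg.DL v (\<phi> \<one>)) (at (\<phi> \<one>))"
      by (rule has_derivative_transform_within_open[OF lg.DL[OF lg.x0D] lg.openD lg.x0D]) (simp add: field)
    from frechet_derivative_at[OF this] show ?thesis by (simp add: lg.b_def)
  qed
  have "lie_bracket G U \<phi> = (\<lambda>u v. lg.b u v - lg.b v u)"
    unfolding lie_bracket_def fd by (intro ext) simp
  then show ?thesis using lg.lie_algebra by simp
qed

end

section \<open>Hermitian forms, unitary frames and the spectral theorem\<close>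

lemma scaleR_eq_smult: "r *\<^sub>R (X :: complex ^ 'n) = complex_of_real r *s X"
  by (simp add: vec_eq_iff scaleR_conv_of_real[where 'a=complex])

locale sesquilinear =
  fixes s :: "complex ^ 'n \<Rightarrow> complex ^ 'n \<Rightarrow> complex"
  assumes add_left: "s (X + Y) Z = s X Z + s Y Z"
    and scale_left: "s (c *s X) Z = c * s X Z"
    and add_right: "s Z (X + Y) = s Z X + s Z Y"
    and scale_right: "s Z (c *s X) = cnj c * s Z X"
begin

lemma zero_left [simp]: "s 0 Z = 0" using scale_left[of 0 0 Z] by simp
lemma zero_right [simp]: "s Z 0 = 0" using scale_right[of Z 0 0] by simp
lemma minus_left: "s (- X) Z = - s X Z"
  using scale_left[of "-1" X Z] by (simp add: vector_sneg_minus1[symmetric])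
lemma minus_right: "s Z (- X) = - s Z X"
  using scale_right[of Z "-1" X] by (simp add: vector_sneg_minus1[symmetric])
lemma diff_left: "s (X - Y) Z = s X Z - s Y Z" using add_left[of X "-Y" Z] by (simp add: minus_left)
lemma diff_right: "s Z (X - Y) = s Z X - s Z Y" using add_right[of Z X "-Y"] by (simp add: minus_right)
lemma sum_left: "s (sum f A) Z = (\<Sum>i\<in>A. s (f i) Z)"
  by (induction A rule: infinite_finite_induct) (auto simp: add_left)
lemma sum_right: "s Z (sum f A) = (\<Sum>i\<in>A. s Z (f i))"
  by (induction A rule: infinite_finite_induct) (auto simp: add_right)
lemma scaleR_left: "s (r *\<^sub>R X) Z = r * s X Z" by (simp add: scaleR_eq_smult scale_left)
lemma scaleR_right: "s Z (r *\<^sub>R X) = r * s Z X" by (simp add: scaleR_eq_smult scale_right)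

lemma components: "s X Y = (\<Sum>i\<in>UNIV. \<Sum>j\<in>UNIV. X $ i * cnj (Y $ j) * s (axis i 1) (axis j 1))"
proof -
  have e: "Z = (\<Sum>i\<in>UNIV. Z $ i *s axis i 1)" for Z :: "complex ^ 'n"
    by (simp add: basis_expansion)
  show ?thesis
    by (subst e[of X], subst e[of Y])
       (subst sum_left, simp add: sum_right scale_left scale_right sum_distrib_left mult_ac)
qed

lemma continuous_on_form [continuous_intros]:
  assumes "continuous_on A f" "continuous_on A g"
  shows "continuous_on A (\<lambda>x. s (f x) (g x))"
  by (subst components) (intro continuous_intros assms)

lemma bounded_bilinear: "bounded_bilinear s"
proof -
  have "bilinear s" unfolding bilinear_def
    by (intro conjI allI linearI)
       (simp_all only: add_left add_right scaleR_left scaleR_right scaleR_conv_of_real[where 'a=complex])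
  then show ?thesis by (rule bilinear_conv_bounded_bilinear[THEN iffD1])
qed

end

locale hermitian =
  fixes h :: "complex ^ 'n \<Rightarrow> complex ^ 'n \<Rightarrow> complex"
  assumes hadd: "h (X + Y) Z = h X Z + h Y Z"
    and hscale: "h (c *s X) Z = c * h X Z"
    and cnj_sym: "cnj (h X Y) = h Y X"

sublocale hermitian \<subseteq> sesquilinear h
proof
  show "h (X + Y) Z = h X Z + h Y Z" for X Y Z by (rule hadd)
  show "h (c *s X) Z = c * h X Z" for c X Z by (rule hscale)
  show "h Z (X + Y) = h Z X + h Z Y" for X Y Z by (metis hadd cnj_sym complex_cnj_add)
  show "h Z (c *s X) = cnj c * h Z X" for c X Z by (metis hscale cnj_sym complex_cnj_mult)
qed

lemma (in hermitian) self_real: "h X X = of_real (Re (h X X))"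
  using cnj_sym[of X X] by (simp add: complex_eq_iff)

locale hermitian_inner = hermitian h for h :: "complex ^ 'n \<Rightarrow> complex ^ 'n \<Rightarrow> complex" +
  assumes pos: "X \<noteq> 0 \<Longrightarrow> Re (h X X) > 0"

text \<open>
  Completeness is part of the notion, so that vectors can be expanded at once; for orthonormal systems
  indexed by \<open>'n\<close> it is automatic by \<open>orthonormal_is_frame\<close>.
\<close>

definition unitary_frame ::
    "(complex ^ 'n \<Rightarrow> complex ^ 'n \<Rightarrow> complex) \<Rightarrow> ('n \<Rightarrow> complex ^ 'n) \<Rightarrow> bool"
  where "unitary_frame h v \<longleftrightarrow> (\<forall>i j. h (v i) (v j) = (if i = j then 1 else 0)) \<and>
    (\<forall>X. X = (\<Sum>i\<in>UNIV. h X (v i) *s v i))"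

lemma unitary_frameD:
  assumes "unitary_frame h v"
  shows "h (v i) (v j) = (if i = j then 1 else 0)" and "X = (\<Sum>i\<in>UNIV. h X (v i) *s v i)"
  using assms unfolding unitary_frame_def by blast+

context hermitian_inner
begin

lemma nonneg: "Re (h X X) \<ge> 0" using pos[of X] by (cases "X = 0") auto

lemma definite: "h X X = 0 \<longleftrightarrow> X = 0" using pos[of X] by (cases "X = 0") auto

lemma frame_parseval:
  assumes "unitary_frame h v" shows "h X Y = (\<Sum>i\<in>UNIV. h X (v i) * cnj (h Y (v i)))"
  by (subst unitary_frameD(2)[OF assms, of X]) (simp add: sum_left scale_left cnj_sym)

lemma frame_parseval_norm:
  assumes "unitary_frame h v" shows "Re (h X X) = (\<Sum>i\<in>UNIV. (cmod (h X (v i)))\<^sup>2)"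
  unfolding frame_parseval[OF assms, of X X] by (simp add: complex_mult_cnj cmod_power2)

lemma frame_ext:
  assumes "unitary_frame h v" "\<And>i. h X (v i) = h Y (v i)" shows "X = Y"
  using unitary_frameD(2)[OF assms(1), of X] unitary_frameD(2)[OF assms(1), of Y] assms(2) by simp

text \<open>
  The trace of \<open>s\<close> relative to \<open>h\<close> does not depend on the frame.
\<close>

lemma sum_frame:
  assumes s: "sesquilinear s" and v: "unitary_frame h v" and w: "unitary_frame h w"
  shows "(\<Sum>p\<in>UNIV. s (v p) (v p)) = (\<Sum>p\<in>UNIV. s (w p) (w p))"
proof -
  interpret s: sesquilinear s by fact
  have "s (v p) (v p) = (\<Sum>i\<in>UNIV. \<Sum>j\<in>UNIV. s (w i) (w j) * (h (v p) (w i) * h (w j) (v p)))" for p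
    by (subst (1 2) unitary_frameD(2)[OF w, of "v p"])
       (subst s.sum_left, simp add: s.sum_right s.scale_left s.scale_right cnj_sym sum_distrib_left mult_ac)
  then have "(\<Sum>p\<in>UNIV. s (v p) (v p)) =
      (\<Sum>p\<in>UNIV. \<Sum>i\<in>UNIV. \<Sum>j\<in>UNIV. s (w i) (w j) * (h (v p) (w i) * h (w j) (v p)))" by simp
  also have "\<dots> = (\<Sum>i\<in>UNIV. \<Sum>j\<in>UNIV. \<Sum>p\<in>UNIV. s (w i) (w j) * (h (v p) (w i) * h (w j) (v p)))"
    by (subst sum.swap, rule sum.cong[OF refl], rule sum.swap)
  also have "\<dots> = (\<Sum>i\<in>UNIV. \<Sum>j\<in>UNIV. s (w i) (w j) * h (w j) (w i))"
  proof (intro sum.cong refl)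
    fix i j
    have "(\<Sum>p\<in>UNIV. h (w j) (v p) * h (v p) (w i)) = h (w j) (w i)"
      using frame_parseval[OF v, of "w j" "w i"] by (simp add: cnj_sym)
    then show "(\<Sum>p\<in>UNIV. s (w i) (w j) * (h (v p) (w i) * h (w j) (v p))) = s (w i) (w j) * h (w j) (w i)"
      by (simp add: sum_distrib_left[symmetric] mult.commute)
  qed
  also have "\<dots> = (\<Sum>i\<in>UNIV. s (w i) (w i))"
    by (simp add: unitary_frameD(1)[OF w] if_distrib[of "\<lambda>x. _ * x"] cong: if_cong)
  finally show ?thesis .
qed

lemma norm_lower_bound: obtains m where "m > 0" "\<And>X. Re (h X X) \<ge> m * (norm X)\<^sup>2"
proof -
  have c: "compact (sphere (0::complex^'n) 1)" by simp
  have "(axis undefined 1 :: complex^'n) \<in> sphere 0 1" by simp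
  then have ne: "sphere (0::complex^'n) 1 \<noteq> {}" by blast
  have co: "continuous_on (sphere 0 1) (\<lambda>X. Re (h X X))" by (intro continuous_intros)
  obtain X0 where X0: "X0 \<in> sphere 0 1" "\<And>X. X \<in> sphere 0 1 \<Longrightarrow> Re (h X0 X0) \<le> Re (h X X)"
    using continuous_attains_inf[OF c ne co] by blast
  have "X0 \<noteq> 0" using X0(1) by auto
  then have "Re (h X0 X0) > 0" by (rule pos)
  moreover have "Re (h X X) \<ge> Re (h X0 X0) * (norm X)\<^sup>2" for X
  proof (cases "X = 0")
    case False
    then have "(1 / norm X) *\<^sub>R X \<in> sphere 0 1" by simp
    from X0(2)[OF this] have "Re (h X0 X0) \<le> Re (h X X) / (norm X)\<^sup>2"
      by (simp add: scaleR_left scaleR_right power2_eq_square)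
    then show ?thesis using False by (simp add: field_simps)
  qed simp
  ultimately show ?thesis using that by blast
qed

text \<open>
  The map from coefficients to linear combinations is injective, and it is an endomorphism of
  \<open>complex ^ 'n\<close>, hence surjective.
\<close>

lemma orthonormal_is_frame:
  fixes v :: "'n \<Rightarrow> complex ^ 'n"
  assumes on: "\<And>i j. h (v i) (v j) = (if i = j then 1 else 0)"
  shows "unitary_frame h v"
proof -
  let ?g = "\<lambda>c :: complex^'n. \<Sum>i\<in>UNIV. c $ i *s v i"
  have hg: "h (?g c) (v j) = c $ j" for c j
    by (simp add: sum_left scale_left on if_distrib[of "\<lambda>x. _ * x"] cong: if_cong)
  have "linear ?g"
    by (rule linearI) (auto simp: vec_eq_iff sum.distrib algebra_simps sum_distrib_left scaleR_sum_right)
  moreover have "inj ?g" using hg by (intro injI) (metis vec_eq_iff)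
  ultimately have "surj ?g" by (rule linear_inj_imp_surj)
  have "X = (\<Sum>i\<in>UNIV. h X (v i) *s v i)" for X
  proof -
    obtain c where c: "X = ?g c" using \<open>surj ?g\<close> by (rule surjE)
    show ?thesis unfolding c hg by (rule refl)
  qed
  then show ?thesis using on unfolding unitary_frame_def by blast
qed

text \<open>
  The new eigenvector \<open>x\<close> minimizes the Rayleigh quotient on the orthogonal complement \<open>W\<close> of the old
  ones.  With \<open>l\<close> the minimum, \<open>k - l h\<close> is nonnegative on \<open>W\<close> and vanishes at \<open>x\<close>, so \<open>x\<close> lies in its
  kernel; orthogonality to the old eigenvectors extends this from \<open>W\<close> to the whole space.
\<close>

lemma eigenvector_step:
  fixes v :: "'n \<Rightarrow> complex ^ 'n" and I :: "'n set"
  assumes k: "hermitian k" and i0: "i0 \<notin> I"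
    and on: "\<And>i j. i \<in> I \<Longrightarrow> j \<in> I \<Longrightarrow> h (v i) (v j) = (if i = j then 1 else 0)"
    and ev: "\<And>i X. i \<in> I \<Longrightarrow> k (v i) X = complex_of_real (d i) * h (v i) X"
  shows "\<exists>x l. h x x = 1 \<and> (\<forall>i\<in>I. h x (v i) = 0) \<and> (\<forall>X. k x X = complex_of_real l * h x X)"
proof -
  interpret k: hermitian k by fact
  let ?W = "{X. \<forall>i\<in>I. h X (v i) = 0}"
  have W_scale: "c *s X \<in> ?W" if "X \<in> ?W" for c X using that by (simp add: scale_left)
  have W_add: "X + Y \<in> ?W" if "X \<in> ?W" "Y \<in> ?W" for X Y using that by (simp add: add_left)
  have "\<exists>X\<in>?W. X \<noteq> 0"
  proof (rule ccontr)
    assume none: "\<not> ?thesis"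
    let ?f = "\<lambda>X. (\<chi> i. if i \<in> I then h X (v i) else 0) :: complex^'n"
    have lin: "linear ?f"
      by (rule linearI) (auto simp: vec_eq_iff add_left scaleR_left scaleR_conv_of_real[where 'a=complex])
    have "inj ?f"
    proof (rule linear_injective_0[OF lin, THEN iffD2], intro allI impI)
      fix X assume *: "?f X = 0"
      have z: "?f X $ i = 0" for i unfolding * by simp
      have "h X (v i) = 0" if "i \<in> I" for i using z[of i] that by simp
      then have "X \<in> ?W" by blast
      with none show "X = 0" by blast
    qed
    then have sf: "surj ?f" using lin by (rule linear_inj_imp_surj[rotated])
    obtain X where X: "axis i0 1 = ?f X" using sf by (rule surjE)
    have "?f X $ i0 = 1" unfolding X[symmetric] by simp
    then show False using i0 by simp
  qed
  then obtain X1 where X1: "X1 \<in> ?W" "X1 \<noteq> 0" by blast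
  let ?T = "{X. X \<in> ?W \<and> Re (h X X) = 1}"
  obtain m where m: "m > 0" "\<And>X. Re (h X X) \<ge> m * (norm X)\<^sup>2" using norm_lower_bound by metis
  have "closed ?T"
  proof -
    have "closed {X. h X (v i) = 0}" for i
      by (rule closed_Collect_eq) (auto intro!: continuous_intros)
    moreover have "closed {X. Re (h X X) = 1}"
      by (rule closed_Collect_eq) (auto intro!: continuous_intros)
    moreover have "?T = (\<Inter>i\<in>I. {X. h X (v i) = 0}) \<inter> {X. Re (h X X) = 1}" by auto
    ultimately show ?thesis by auto
  qed
  moreover have "bounded ?T"
    unfolding bounded_iff
  proof (intro exI ballI)
    fix X assume "X \<in> ?T"
    then have "m * (norm X)\<^sup>2 \<le> 1" using m(2)[of X] by simp
    then have "(norm X)\<^sup>2 \<le> 1 / m" using m(1) by (simp add: field_simps)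
    then show "norm X \<le> sqrt (1 / m)" by (rule real_le_rsqrt)
  qed
  ultimately have c: "compact ?T" by (simp add: compact_eq_bounded_closed)
  have T_norm: "complex_of_real (1 / sqrt (Re (h X X))) *s X \<in> ?T" if "X \<in> ?W" "X \<noteq> 0" for X
  proof -
    have "Re (h X X) > 0" using pos that(2) by blast
    then have "Re (1 / sqrt (Re (h X X)) * (1 / sqrt (Re (h X X)) * h X X)) = 1"
      by (simp flip: power2_eq_square add: field_simps)
    then show ?thesis using that W_scale by (simp add: scale_left scale_right)
  qed
  then have ne: "?T \<noteq> {}" using X1 by blast
  have co: "continuous_on ?T (\<lambda>X. Re (k X X))" by (intro continuous_intros k.continuous_on_form)
  obtain x where x: "x \<in> ?T" "\<And>X. X \<in> ?T \<Longrightarrow> Re (k x x) \<le> Re (k X X)"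
    using continuous_attains_inf[OF c ne co] by blast
  define l where "l = Re (k x x)"
  have hx: "h x x = 1" using x(1) self_real[of x] by simp
  let ?q = "\<lambda>X Y. k X Y - l * h X Y"
  have q_nonneg: "Re (?q X X) \<ge> 0" if "X \<in> ?W" for X
  proof (cases "X = 0")
    case False
    let ?c = "1 / sqrt (Re (h X X))"
    have p: "Re (h X X) > 0" using pos False by blast
    have "l \<le> Re (k (complex_of_real ?c *s X) (complex_of_real ?c *s X))"
      unfolding l_def by (rule x(2)[OF T_norm[OF that False]])
    also have "\<dots> = Re (k X X) / Re (h X X)"
      using p by (simp add: k.scale_left k.scale_right field_simps)
    finally show ?thesis using p by (simp add: field_simps)
  qed simp
  have q_zero: "?q x Y = 0" if Y: "Y \<in> ?W" for Y
  proof (rule ccontr)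
    assume nz: "?q x Y \<noteq> 0"
    define z where "z = ?q x Y"
    define N where "N = (cmod z)\<^sup>2"
    define B where "B = Re (?q Y Y)"
    have N: "N > 0" using nz by (simp add: N_def z_def)
    have B: "B \<ge> 0" using q_nonneg[OF Y] by (simp add: B_def)
    have zz: "?q Y x = cnj z" by (simp add: z_def cnj_sym k.cnj_sym)
    have zc: "z * cnj z = complex_of_real N" unfolding N_def complex_norm_square ..
    have xx: "?q x x = 0" using k.self_real[of x] hx by (simp add: l_def)
    have "?q (x + c *s Y) (x + c *s Y) = ?q x x + cnj c * ?q x Y + c * ?q Y x + c * cnj c * ?q Y Y" for c
      by (simp add: k.add_left k.add_right k.scale_left k.scale_right add_left add_right scale_left scale_right algebra_simps)
    then have q_expand: "?q (x + c *s Y) (x + c *s Y) = cnj c * z + c * cnj z + c * cnj c * ?q Y Y" for c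
      unfolding xx zz z_def[symmetric] by simp
    \<comment> \<open>The first order term in \<open>e\<close> has the wrong sign unless \<open>z\<close> vanishes.\<close>
    have *: "0 \<le> - 2 * e * N + e\<^sup>2 * N * B" for e :: real
    proof -
      let ?c = "complex_of_real (- e) * z"
      have "x + ?c *s Y \<in> ?W" using x(1) Y W_add[of x "?c *s Y"] W_scale[of Y ?c] by blast
      from q_nonneg[OF this]
      have "0 \<le> Re (?q (x + ?c *s Y) (x + ?c *s Y))" .
      also have "?q (x + ?c *s Y) (x + ?c *s Y)
          = - (2 * complex_of_real e) * (z * cnj z) + (complex_of_real e)\<^sup>2 * (z * cnj z) * ?q Y Y"
        unfolding q_expand by (simp add: algebra_simps power2_eq_square)
      also have "\<dots> = complex_of_real (- 2 * e * N) + complex_of_real (e\<^sup>2 * N) * ?q Y Y"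
        unfolding zc by simp
      finally show ?thesis by (simp add: B_def)
    qed
    define e where "e = 1 / (B + 1)"
    have e: "e > 0" "e * B < 2" using B by (auto simp: e_def field_simps)
    have "0 \<le> e * N * (e * B - 2)" using *[of e] by (simp add: algebra_simps power2_eq_square)
    moreover have "e * N * (e * B - 2) < 0" using e N by (intro mult_pos_neg) auto
    ultimately show False by simp
  qed
  have "k x X = l * h x X" for X
  proof -
    let ?P = "\<Sum>i\<in>I. h X (v i) *s v i"
    have xv: "h x (v i) = 0" if "i \<in> I" for i using x(1) that by blast
    have kxv: "k x (v i) = 0" if "i \<in> I" for i
      using ev[OF that, of x] xv[OF that] k.cnj_sym[of "v i" x] cnj_sym[of "v i" x]
      by (metis complex_cnj_zero_iff mult_zero_right)
    have "X - ?P \<in> ?W"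
    proof (intro CollectI ballI)
      fix j assume j: "j \<in> I"
      have "finite I" by simp
      then show "h (X - ?P) (v j) = 0"
        using j by (simp add: diff_left sum_left scale_left on if_distrib[of "\<lambda>x. _ * x"] sum.delta cong: if_cong sum.cong)
    qed
    from q_zero[OF this] show ?thesis
      by (simp add: diff_right k.diff_right sum_right k.sum_right scale_right k.scale_right xv kxv)
  qed
  then show ?thesis using hx x(1) by blast
qed

text \<open>
  Simultaneous diagonalization of \<open>h\<close> and \<open>k\<close>.  The eigenvalue equation is stated with arbitrary second
  argument, which spares the expansion of that argument in the frame.
\<close>

theorem spectral:
  assumes k: "hermitian k"
  shows "\<exists>v d. unitary_frame h v \<and> (\<forall>i X. k (v i) X = complex_of_real (d i) * h (v i) X)"
proof -
  have "\<exists>(v :: 'n \<Rightarrow> complex ^ 'n) d. (\<forall>i\<in>I. \<forall>j\<in>I. h (v i) (v j) = (if i = j then 1 else 0)) \<and>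
        (\<forall>i\<in>I. \<forall>X. k (v i) X = complex_of_real (d i) * h (v i) X)" for I
  proof -
    have "finite I" by simp
    then show ?thesis
  proof (induction I)
    case empty then show ?case by simp
  next
    case (insert i0 I)
    then obtain v d where vd: "\<forall>i\<in>I. \<forall>j\<in>I. h (v i) (v j) = (if i = j then 1 else 0)"
      "\<forall>i\<in>I. \<forall>X. k (v i) X = complex_of_real (d i) * h (v i) X" by blast
    then obtain x l where x: "h x x = 1" "\<forall>i\<in>I. h x (v i) = 0" "\<forall>X. k x X = complex_of_real l * h x X"
      using eigenvector_step[OF k insert(2), of v d] by auto
    have "h (v i) x = 0" if "i \<in> I" for i using x(2) that cnj_sym by (metis complex_cnj_zero)
    then show ?case using vd x insert(2)
      by (intro exI[of _ "v(i0 := x)"] exI[of _ "d(i0 := l)"]) auto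
  qed
  qed
  from this[of UNIV] obtain v :: "'n \<Rightarrow> complex ^ 'n" and d where vd: "\<forall>i j. h (v i) (v j) = (if i = j then 1 else 0)"
      "\<forall>i X. k (v i) X = complex_of_real (d i) * h (v i) X" by auto
  then show ?thesis using orthonormal_is_frame[of v] by blast
qed

lemma frame_exists: "\<exists>v. unitary_frame h v"
  using spectral hermitian_axioms by blast

end

section \<open>The first variation of the logarithmic distance between two metrics\<close>

text \<open>
  The quantity to be minimized is a sum of \<open>\<epsilon> (ln x)\<^sup>2 + \<beta> ln x\<close> over the eigenvalues \<open>x\<close> of one metric
  relative to another.  This function is not concave, but it becomes so when \<open>\<epsilon> / x\<close> is subtracted, and
  the sum of the inverse eigenvalues is a trace, hence differentiable in the metric.
\<close>

definition log_cost :: "real \<Rightarrow> real \<Rightarrow> real \<Rightarrow> real"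
  where "log_cost \<epsilon> \<beta> x = \<epsilon> * (ln x)\<^sup>2 + \<beta> * ln x - \<epsilon> / x"

lemma log_cost_derivative:
  "x > 0 \<Longrightarrow> (log_cost \<epsilon> \<beta> has_real_derivative 2 * \<epsilon> * ln x / x + \<beta> / x + \<epsilon> / x\<^sup>2) (at x)"
  unfolding log_cost_def[abs_def]
  by (auto intro!: derivative_eq_intros simp: field_simps power2_eq_square)

lemma log_cost_concave:
  assumes "\<epsilon> \<ge> 0" "\<beta> \<ge> 0" shows "convex_on {0<..} (\<lambda>x. - log_cost \<epsilon> \<beta> x)"
proof (rule f''_ge0_imp_convex)
  show "convex {0::real<..}" by simp
  fix x :: real assume "x \<in> {0<..}"
  then have x: "x > 0" by simp
  show "((\<lambda>x. - log_cost \<epsilon> \<beta> x) has_real_derivative - (2 * \<epsilon> * ln x / x + \<beta> / x + \<epsilon> / x\<^sup>2)) (at x)"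
    by (intro derivative_intros log_cost_derivative x)
  show "((\<lambda>x. - (2 * \<epsilon> * ln x / x + \<beta> / x + \<epsilon> / x\<^sup>2)) has_real_derivative
      (2 * \<epsilon> / x ^ 3) * (1 - x + x * ln x) + \<beta> / x\<^sup>2) (at x)"
    using x by (auto intro!: derivative_eq_intros simp: field_simps power2_eq_square power3_eq_cube)
  have "ln (1 / x) \<le> 1 / x - 1" using x by (intro ln_le_minus_one) simp
  then have "1 - x + x * ln x \<ge> 0" using x by (simp add: ln_div field_simps)
  moreover have "0 \<le> 2 * \<epsilon> / x ^ 3" "0 \<le> \<beta> / x\<^sup>2" using x assms by auto
  ultimately show "0 \<le> (2 * \<epsilon> / x ^ 3) * (1 - x + x * ln x) + \<beta> / x\<^sup>2"
    by (metis add_nonneg_nonneg mult_nonneg_nonneg)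
qed

text \<open>
  Eigenvalues of one metric relative to another are written \<open>exp (2 * b i)\<close> throughout, so that the
  frame rescales by \<open>exp (- b i)\<close> and structure constants by exponentials of differences.
\<close>

lemma frame_scaled:
  fixes h h' :: "complex ^ 'n \<Rightarrow> complex ^ 'n \<Rightarrow> complex"
  assumes h: "hermitian_inner h" and h': "hermitian_inner h'" and u: "unitary_frame h u"
    and diag: "\<And>i X. h' (u i) X = complex_of_real (exp (2 * b i)) * h (u i) X"
  shows "unitary_frame h' (\<lambda>i. complex_of_real (exp (- b i)) *s u i)"
proof -
  interpret h: hermitian_inner h by fact
  interpret h': hermitian_inner h' by fact
  show ?thesis
  proof (rule h'.orthonormal_is_frame)
    fix i j
    have "exp (- b i) * (exp (- b i) * exp (2 * b i)) = 1" for i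
      by (simp flip: exp_add)
    then have "complex_of_real (exp (- b i)) * (complex_of_real (exp (- b i)) * complex_of_real (exp (2 * b i))) = 1" for i
      by (simp flip: of_real_mult)
    then show "h' (complex_of_real (exp (- b i)) *s u i) (complex_of_real (exp (- b j)) *s u j) = (if i = j then 1 else 0)"
      by (simp add: h'.scale_left h'.scale_right diag unitary_frameD(1)[OF u])
  qed
qed

text \<open>
  Peierls' inequality.  The diagonal entries of \<open>h'\<close> in the frame \<open>e\<close> are averages of the eigenvalues of
  \<open>h'\<close> with doubly stochastic weights \<open>p i k\<close>, so Jensen's inequality applies to the concave
  \<open>log_cost\<close>; the remaining \<open>\<epsilon> / x\<close> sum up to the trace of \<open>h\<close> in any frame \<open>w\<close> of \<open>h'\<close>.  Equality holds
  if \<open>e\<close> itself diagonalizes \<open>h'\<close>.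
\<close>

lemma peierls:
  fixes h h' :: "complex ^ 'n \<Rightarrow> complex ^ 'n \<Rightarrow> complex"
  assumes h: "hermitian_inner h" and h': "hermitian_inner h'"
    and u: "unitary_frame h u" and e: "unitary_frame h e" and w: "unitary_frame h' w"
    and diag: "\<And>i X. h' (u i) X = complex_of_real (exp (2 * b i)) * h (u i) X"
    and eb: "\<epsilon> \<ge> 0" "\<beta> \<ge> 0"
  shows "(\<Sum>i\<in>UNIV. 4 * \<epsilon> * (b i)\<^sup>2 + 2 * \<beta> * b i)
    \<le> \<epsilon> * (\<Sum>i\<in>UNIV. Re (h (w i) (w i))) + (\<Sum>i\<in>UNIV. log_cost \<epsilon> \<beta> (Re (h' (e i) (e i))))"
proof -
  interpret h: hermitian_inner h by fact
  interpret h': hermitian_inner h' by fact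
  let ?x = "\<lambda>k. exp (2 * b k)" and ?u' = "\<lambda>i. complex_of_real (exp (- b i)) *s u i"
  have u': "unitary_frame h' ?u'" by (rule frame_scaled[OF h h' u diag])
  have "(\<Sum>i\<in>UNIV. h (w i) (w i)) = (\<Sum>i\<in>UNIV. h (?u' i) (?u' i))"
    by (rule h'.sum_frame[OF h.sesquilinear_axioms w u'])
  also have "\<dots> = (\<Sum>i\<in>UNIV. complex_of_real (1 / ?x i))"
  proof (rule sum.cong[OF refl])
    fix i
    have "exp (- b i) * exp (- b i) = 1 / ?x i" by (simp flip: exp_add exp_minus add: field_simps)
    then show "h (?u' i) (?u' i) = complex_of_real (1 / ?x i)"
      by (simp add: h.scale_left h.scale_right unitary_frameD(1)[OF u] flip: of_real_mult)
  qed
  also have "\<dots> = complex_of_real (\<Sum>i\<in>UNIV. 1 / ?x i)" by simp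
  finally have "Re (\<Sum>i\<in>UNIV. h (w i) (w i)) = (\<Sum>i\<in>UNIV. 1 / ?x i)"
    by (simp only: Re_complex_of_real)
  then have 1: "(\<Sum>i\<in>UNIV. Re (h (w i) (w i))) = (\<Sum>i\<in>UNIV. 1 / ?x i)" by simp
  define p where "p i k = (cmod (h (e i) (u k)))\<^sup>2" for i k
  have p1: "(\<Sum>k\<in>UNIV. p i k) = 1" for i
  proof -
    have "(\<Sum>k\<in>UNIV. p i k) = Re (h (e i) (e i))"
      unfolding p_def by (rule h.frame_parseval_norm[OF u, symmetric])
    then show ?thesis by (simp add: unitary_frameD(1)[OF e])
  qed
  have p2: "(\<Sum>i\<in>UNIV. p i k) = 1" for k
  proof -
    have "cmod (h (e i) (u k)) = cmod (h (u k) (e i))" for i by (metis h.cnj_sym complex_mod_cnj)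
    then show ?thesis
      unfolding p_def by (simp add: h.frame_parseval_norm[OF e, symmetric] unitary_frameD(1)[OF u])
  qed
  have he: "Re (h' (e i) (e i)) = (\<Sum>k\<in>UNIV. p i k *\<^sub>R ?x k)" for i
  proof -
    have "h' (e i) (e i) = (\<Sum>k\<in>UNIV. h (e i) (u k) * h' (u k) (e i))"
      by (subst unitary_frameD(2)[OF u, of "e i"]) (subst h'.sum_left, simp add: h'.scale_left)
    also have "\<dots> = (\<Sum>k\<in>UNIV. complex_of_real (p i k * ?x k))"
    proof (rule sum.cong[OF refl])
      fix k
      have "h (e i) (u k) * h (u k) (e i) = p i k"
        unfolding p_def complex_norm_square h.cnj_sym ..
      then show "h (e i) (u k) * h' (u k) (e i) = complex_of_real (p i k * ?x k)"
        unfolding diag by (simp add: mult_ac)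
    qed
    finally show ?thesis by simp
  qed
  have pnn: "p i k \<ge> 0" for i k by (simp add: p_def)
  have jensen: "- log_cost \<epsilon> \<beta> (Re (h' (e i) (e i))) \<le> (\<Sum>k\<in>UNIV. p i k * - log_cost \<epsilon> \<beta> (?x k))" for i
    unfolding he
    by (rule convex_on_sum[OF _ _ log_cost_concave[OF eb]]) (auto simp: p1 pnn)
  have "(\<Sum>i\<in>UNIV. - log_cost \<epsilon> \<beta> (Re (h' (e i) (e i)))) \<le> (\<Sum>i\<in>UNIV. \<Sum>k\<in>UNIV. p i k * - log_cost \<epsilon> \<beta> (?x k))"
    by (rule sum_mono) (rule jensen)
  also have "\<dots> = (\<Sum>k\<in>UNIV. (\<Sum>i\<in>UNIV. p i k) * - log_cost \<epsilon> \<beta> (?x k))"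
    by (subst sum.swap) (simp add: sum_distrib_right sum_negf)
  also have "\<dots> = (\<Sum>k\<in>UNIV. - log_cost \<epsilon> \<beta> (?x k))" by (simp add: p2)
  finally have "(\<Sum>k\<in>UNIV. log_cost \<epsilon> \<beta> (?x k)) \<le> (\<Sum>i\<in>UNIV. log_cost \<epsilon> \<beta> (Re (h' (e i) (e i))))"
    by (simp add: sum_negf)
  moreover have "log_cost \<epsilon> \<beta> (?x k) = 4 * \<epsilon> * (b k)\<^sup>2 + 2 * \<beta> * b k - \<epsilon> * (1 / ?x k)" for k
    by (simp add: log_cost_def power2_eq_square)
  ultimately show ?thesis unfolding 1 by (simp add: sum.distrib sum_subtractf sum_distrib_left)
qed

text \<open>
  The eigenvalues of the deformed metric \<open>h' (E t X) (E t Y)\<close> need not depend differentiably on \<open>t\<close>.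
  By \<open>peierls\<close>, however, their total cost is bounded above by a differentiable function \<open>\<Psi>\<close> of \<open>t\<close>, with
  equality at \<open>t = 0\<close>.  So if \<open>t = 0\<close> minimizes \<open>F\<close> plus the cost, it minimizes \<open>F + \<Psi>\<close>, and the
  derivative of the latter vanishes.  With \<open>A\<close> the endomorphism \<open>A (v i) = a i *s v i\<close> and \<open>F\<close>
  constant, the conclusion says that \<open>D\<close> is orthogonal to \<open>8 \<epsilon> A + 2 \<beta>\<close>.
\<close>

lemma first_variation:
  fixes h h' :: "complex ^ 'n \<Rightarrow> complex ^ 'n \<Rightarrow> complex" and E :: "real \<Rightarrow> complex ^ 'n \<Rightarrow> complex ^ 'n"
  assumes h: "hermitian_inner h" and h': "hermitian_inner h'" and e: "unitary_frame h e"
    and diag: "\<And>i X. h' (e i) X = complex_of_real (exp (2 * a i)) * h (e i) X"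
    and v: "v = (\<lambda>i. complex_of_real (exp (- a i)) *s e i)"
    and eb: "\<epsilon> \<ge> 0" "\<beta> \<ge> 0"
    and E_add: "\<And>t X Y. E t (X + Y) = E t X + E t Y" and E_scale: "\<And>t c X. E t (c *s X) = c *s E t X"
    and E_inv: "\<And>t X. E t (E (- t) X) = X" and E_zero: "\<And>X. E 0 X = X"
    and E_deriv: "\<And>X. ((\<lambda>t. E t X) has_vector_derivative D X) (at 0)"
    and F: "(F has_real_derivative F') (at 0)"
    and min: "\<And>t u b. unitary_frame h u \<Longrightarrow>
        (\<And>i X. h' (E t (u i)) (E t X) = complex_of_real (exp (2 * b i)) * h (u i) X) \<Longrightarrow>
        F 0 + (\<Sum>i\<in>UNIV. 4 * \<epsilon> * (a i)\<^sup>2 + 2 * \<beta> * a i) \<le> F t + (\<Sum>i\<in>UNIV. 4 * \<epsilon> * (b i)\<^sup>2 + 2 * \<beta> * b i)"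
  shows "F' + (\<Sum>i\<in>UNIV. (8 * \<epsilon> * a i + 2 * \<beta>) * Re (h' (D (v i)) (v i))) = 0"
proof -
  interpret h: hermitian_inner h by fact
  interpret h': hermitian_inner h' by fact
  define \<Psi> where "\<Psi> t = \<epsilon> * (\<Sum>i\<in>UNIV. Re (h (E (- t) (v i)) (E (- t) (v i))))
      + (\<Sum>i\<in>UNIV. log_cost \<epsilon> \<beta> (Re (h' (E t (e i)) (E t (e i)))))" for t
  have vfr: "unitary_frame h' v" unfolding v by (rule frame_scaled[OF h h' e diag])
  have ht: "hermitian_inner (\<lambda>X Y. h' (E t X) (E t Y))" for t
  proof
    fix X Y Z c
    show "h' (E t (X + Y)) (E t Z) = h' (E t X) (E t Z) + h' (E t Y) (E t Z)" by (simp add: E_add h'.add_left)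
    show "h' (E t (c *s X)) (E t Z) = c * h' (E t X) (E t Z)" by (simp add: E_scale h'.scale_left)
    show "cnj (h' (E t X) (E t Y)) = h' (E t Y) (E t X)" by (rule h'.cnj_sym)
    show "0 < Re (h' (E t X) (E t X))" if "X \<noteq> 0"
    proof (rule h'.pos)
      have E0: "E s 0 = 0" for s using E_scale[of s 0 0] by simp
      show "E t X \<noteq> 0" using that E_inv[of "- t" X] E0 by auto
    qed
  qed
  have wfr: "unitary_frame (\<lambda>X Y. h' (E t X) (E t Y)) (\<lambda>i. E (- t) (v i))" for t
  proof -
    interpret ht: hermitian_inner "\<lambda>X Y. h' (E t X) (E t Y)" by (rule ht)
    show ?thesis by (rule ht.orthonormal_is_frame) (simp add: E_inv unitary_frameD(1)[OF vfr])
  qed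
  have dv: "h' X (v i) = complex_of_real (exp (a i)) * h X (e i)" for X i
  proof -
    have "h' (e i) X = complex_of_real (exp (2 * a i)) * h (e i) X" by (rule diag)
    then have "cnj (h' (e i) X) = cnj (complex_of_real (exp (2 * a i)) * h (e i) X)" by simp
    then have "h' X (e i) = complex_of_real (exp (2 * a i)) * h X (e i)" by (simp add: h.cnj_sym h'.cnj_sym)
    moreover have "complex_of_real (exp (- a i)) * complex_of_real (exp (2 * a i)) = complex_of_real (exp (a i))"
      by (simp flip: of_real_mult exp_add)
    ultimately show ?thesis unfolding v by (simp add: h'.scale_right mult.assoc[symmetric])
  qed
  have D_scale: "D (c *s X) = c *s D X" for c X
  proof (rule vector_derivative_unique_at[OF E_deriv])
    have "((\<lambda>t. c *s E t X) has_vector_derivative c *s D X) (at 0)"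
    proof -
      have "bounded_linear (\<lambda>X :: complex^'n. c *s X)"
        unfolding linear_conv_bounded_linear[symmetric]
        by (rule linearI) (auto simp: vec_eq_iff algebra_simps)
      from bounded_linear.has_vector_derivative[OF this E_deriv] show ?thesis .
    qed
    then show "((\<lambda>t. E t (c *s X)) has_vector_derivative c *s D X) (at 0)" by (simp add: E_scale)
  qed
  define R where "R i = Re (h' (D (v i)) (v i))" for i
  have R1: "Re (h (D (v i)) (v i)) = exp (- 2 * a i) * R i" for i
  proof -
    have "h (D (v i)) (v i) = complex_of_real (exp (- a i)) * h (D (v i)) (e i)"
      by (subst (2) v) (simp add: h.scale_right)
    moreover have "h' (D (v i)) (v i) = complex_of_real (exp (a i)) * h (D (v i)) (e i)" by (rule dv)
    moreover have "exp (- a i) = exp (- 2 * a i) * exp (a i)" by (simp flip: exp_add)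
    ultimately show ?thesis by (simp add: R_def mult.assoc)
  qed
  have R2: "Re (h' (D (e i)) (e i)) = exp (2 * a i) * R i" for i
  proof -
    have ei: "e i = complex_of_real (exp (a i)) *s v i"
      unfolding v by (simp add: vector_smult_assoc flip: of_real_mult exp_add)
    have "h' (D (e i)) (e i) = complex_of_real (exp (a i)) * (complex_of_real (exp (a i)) * h' (D (v i)) (v i))"
      by (subst (1 2) ei) (simp add: D_scale h'.scale_left h'.scale_right)
    also have "\<dots> = complex_of_real (exp (2 * a i)) * h' (D (v i)) (v i)"
      by (simp add: mult.assoc[symmetric] flip: of_real_mult exp_add)
    finally show ?thesis by (simp add: R_def)
  qed
  have sq: "((\<lambda>t. Re (k (E (c * t) X) (E (c * t) X))) has_real_derivative 2 * c * Re (k (D X) X)) (at 0)"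
    if k: "hermitian k" for k c X
  proof -
    interpret k: hermitian k by fact
    have 1: "((\<lambda>t. E (c * t) X) has_vector_derivative c *\<^sub>R D X) (at 0)"
    proof -
      have "((\<lambda>t. c * t) has_vector_derivative c) (at 0)"
        by (auto intro!: derivative_eq_intros simp: has_real_derivative_iff_has_vector_derivative[symmetric])
      from vector_diff_chain_at[OF this, of "\<lambda>t. E t X"] E_deriv[of X] show ?thesis by (simp add: o_def)
    qed
    have "((\<lambda>t. k (E (c * t) X) (E (c * t) X)) has_vector_derivative k X (c *\<^sub>R D X) + k (c *\<^sub>R D X) X) (at 0)"
      using bounded_bilinear.has_vector_derivative[OF k.bounded_bilinear 1 1] by (simp add: E_zero)
    then have "((\<lambda>t. Re (k (E (c * t) X) (E (c * t) X))) has_vector_derivative Re (k X (c *\<^sub>R D X) + k (c *\<^sub>R D X) X)) (at 0)"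
      by (rule bounded_linear.has_vector_derivative[OF bounded_linear_Re])
    moreover have "Re (k X (D X)) = Re (k (D X) X)" using arg_cong[OF k.cnj_sym[of X "D X"], of Re] by simp
    ultimately show ?thesis
      by (simp add: has_real_derivative_iff_has_vector_derivative k.scaleR_left k.scaleR_right mult.assoc)
  qed
  have s1: "((\<lambda>t. Re (h (E (- t) (v i)) (E (- t) (v i)))) has_real_derivative - 2 * (exp (- 2 * a i) * R i)) (at 0)" for i
    using sq[OF h.hermitian_axioms, of "-1" "v i"] by (simp add: R1)
  have s2: "((\<lambda>t. log_cost \<epsilon> \<beta> (Re (h' (E t (e i)) (E t (e i))))) has_real_derivative
       (8 * \<epsilon> * a i + 2 * \<beta> + 2 * \<epsilon> * exp (- 2 * a i)) * R i) (at 0)" for i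
  proof -
    have x: "Re (h' (e i) (e i)) = exp (2 * a i)" by (simp add: diag unitary_frameD(1)[OF e])
    have 1: "((\<lambda>t. Re (h' (E t (e i)) (E t (e i)))) has_real_derivative 2 * (exp (2 * a i) * R i)) (at 0)"
      using sq[OF h'.hermitian_axioms, of 1 "e i"] by (simp add: R2)
    have 2: "(log_cost \<epsilon> \<beta> has_real_derivative 2 * \<epsilon> * (2 * a i) / exp (2 * a i) + \<beta> / exp (2 * a i) + \<epsilon> / (exp (2 * a i))\<^sup>2)
        (at (Re (h' (E 0 (e i)) (E 0 (e i)))))"
      using log_cost_derivative[of "exp (2 * a i)" \<epsilon> \<beta>] by (simp add: E_zero x)
    have eq: "(2 * \<epsilon> * (2 * a i) / exp (2 * a i) + \<beta> / exp (2 * a i) + \<epsilon> / (exp (2 * a i))\<^sup>2) * (2 * (exp (2 * a i) * R i))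
        = (8 * \<epsilon> * a i + 2 * \<beta> + 2 * \<epsilon> * exp (- 2 * a i)) * R i"
      by (simp add: exp_minus field_simps power2_eq_square)
    from DERIV_chain2[OF 2 1] show ?thesis unfolding eq .
  qed
  have "(\<Psi> has_real_derivative \<epsilon> * (\<Sum>i\<in>UNIV. - 2 * (exp (- 2 * a i) * R i))
      + (\<Sum>i\<in>UNIV. (8 * \<epsilon> * a i + 2 * \<beta> + 2 * \<epsilon> * exp (- 2 * a i)) * R i)) (at 0)"
    unfolding \<Psi>_def[abs_def] by (intro DERIV_add DERIV_cmult DERIV_sum s1 s2)
  also have "\<epsilon> * (\<Sum>i\<in>UNIV. - 2 * (exp (- 2 * a i) * R i))
      + (\<Sum>i\<in>UNIV. (8 * \<epsilon> * a i + 2 * \<beta> + 2 * \<epsilon> * exp (- 2 * a i)) * R i)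
      = (\<Sum>i\<in>UNIV. (8 * \<epsilon> * a i + 2 * \<beta>) * R i)"
    by (simp add: sum_distrib_left sum.distrib[symmetric] algebra_simps)
  finally have Psi': "(\<Psi> has_real_derivative (\<Sum>i\<in>UNIV. (8 * \<epsilon> * a i + 2 * \<beta>) * R i)) (at 0)" .
  have Psi0: "\<Psi> 0 = (\<Sum>i\<in>UNIV. 4 * \<epsilon> * (a i)\<^sup>2 + 2 * \<beta> * a i)"
  proof -
    have "exp (- a i) * exp (- a i) = exp (- 2 * a i)" for i by (simp flip: exp_add)
    then have "Re (h (v i) (v i)) = exp (- 2 * a i)" for i
      unfolding v by (simp add: h.scale_left h.scale_right unitary_frameD(1)[OF e] flip: of_real_mult)
    moreover have "Re (h' (e i) (e i)) = exp (2 * a i)" for i by (simp add: diag unitary_frameD(1)[OF e])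
    moreover have "\<epsilon> * exp (- 2 * a i) + log_cost \<epsilon> \<beta> (exp (2 * a i)) = 4 * \<epsilon> * (a i)\<^sup>2 + 2 * \<beta> * a i" for i
      by (simp add: log_cost_def exp_minus power2_eq_square field_simps)
    ultimately show ?thesis by (simp add: \<Psi>_def E_zero sum_distrib_left sum.distrib[symmetric])
  qed
  have "F 0 + \<Psi> 0 \<le> F t + \<Psi> t" for t
  proof -
    interpret ht: hermitian_inner "\<lambda>X Y. h' (E t X) (E t Y)" by (rule ht)
    obtain u d where u: "unitary_frame h u" and d: "\<And>i X. h' (E t (u i)) (E t X) = complex_of_real (d i) * h (u i) X"
      using h.spectral[OF ht.hermitian_axioms] by metis
    have dpos: "d i > 0" for i
    proof -
      have "u i \<noteq> 0" using unitary_frameD(1)[OF u, of i i] by auto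
      from ht.pos[OF this] show ?thesis using d[of i "u i"] unitary_frameD(1)[OF u, of i i] by simp
    qed
    define b where "b i = ln (d i) / 2" for i
    have d': "h' (E t (u i)) (E t X) = complex_of_real (exp (2 * b i)) * h (u i) X" for i X
      using d dpos by (simp add: b_def)
    have "(\<Sum>i\<in>UNIV. 4 * \<epsilon> * (b i)\<^sup>2 + 2 * \<beta> * b i) \<le> \<Psi> t"
      unfolding \<Psi>_def by (rule peierls[OF h ht u e wfr d' eb])
    then show ?thesis using min[OF u d'] unfolding Psi0 by linarith
  qed
  moreover have "((\<lambda>t. F t + \<Psi> t) has_real_derivative F' + (\<Sum>i\<in>UNIV. (8 * \<epsilon> * a i + 2 * \<beta>) * R i)) (at 0)"
    by (rule DERIV_add[OF F Psi'])
  ultimately have "F' + (\<Sum>i\<in>UNIV. (8 * \<epsilon> * a i + 2 * \<beta>) * R i) = 0"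
    by (intro DERIV_local_min[where d=1]) auto
  then show ?thesis by (simp add: R_def)
qed

section \<open>The moment map of a bracket\<close>

definition complex_linear :: "(complex ^ 'n \<Rightarrow> complex ^ 'n) \<Rightarrow> bool"
  where "complex_linear f \<longleftrightarrow> (\<forall>X Y. f (X + Y) = f X + f Y) \<and> (\<forall>c X. f (c *s X) = c *s f X)"

lemma complex_linear_sum:
  assumes "complex_linear f" shows "f (sum g A) = (\<Sum>i\<in>A. f (g i))"
proof -
  have "f 0 = 0" using assms unfolding complex_linear_def by (metis vector_smult_lzero)
  then show ?thesis
    using assms unfolding complex_linear_def by (induction A rule: infinite_finite_induct) auto
qed

context complex_lie_algebra
begin

lemma br_add_right: "br Z (X + Y) = br Z X + br Z Y"
  using br_add_left[of X Y Z] br_anti[of Z "X + Y"] br_anti[of Z X] br_anti[of Z Y] by simp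

lemma br_scale_right: "br Z (c *s X) = c *s br Z X"
  using br_scale_left[of c X Z] br_anti[of Z "c *s X"] br_anti[of Z X] by (simp add: vec_eq_iff)

lemma br_zero [simp]: "br 0 X = 0" "br X 0 = 0"
  using br_scale_left[of 0 0 X] br_scale_right[of X 0 0] by auto

lemma br_minus: "br (- X) Y = - br X Y" "br X (- Y) = - br X Y"
  using br_scale_left[of "-1" X Y] br_scale_right[of X "-1" Y] by (simp_all add: vector_sneg_minus1[symmetric])

lemma br_diff: "br (X - Z) Y = br X Y - br Z Y" "br Y (X - Z) = br Y X - br Y Z"
  using br_add_left[of X "- Z" Y] br_add_right[of Y X "- Z"] by (simp_all add: br_minus)

lemma br_scaleR: "br (r *\<^sub>R X) Y = r *\<^sub>R br X Y" "br Y (r *\<^sub>R X) = r *\<^sub>R br Y X"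
  by (simp_all add: scaleR_eq_smult br_scale_left br_scale_right)

lemma complex_linear_ad: "complex_linear (br X)" "complex_linear (\<lambda>Y. br Y X)"
  unfolding complex_linear_def by (auto simp: br_add_left br_add_right br_scale_left br_scale_right)

lemma ad_derivation: "br X (br Y Z) = br (br X Y) Z + br Y (br X Z)"
proof -
  have "br X (br Y Z) = - (br Y (br Z X) + br Z (br X Y))"
    unfolding eq_neg_iff_add_eq_0 using jacobi[of X Y Z] by (simp only: add.assoc)
  also have "\<dots> = br (br X Y) Z + br Y (br X Z)"
    unfolding br_anti[of "br X Y" Z] br_anti[of X Z] br_minus by simp
  finally show ?thesis .
qed

lemma br_sum_left: "br (sum f A) X = (\<Sum>i\<in>A. br (f i) X)"
  by (rule complex_linear_sum[OF complex_linear_ad(2)])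
lemma br_sum_right: "br X (sum f A) = (\<Sum>i\<in>A. br X (f i))"
  by (rule complex_linear_sum[OF complex_linear_ad(1)])

end

locale metric_lie_algebra = complex_lie_algebra br + hermitian_inner h
  for br h :: "complex ^ 'n \<Rightarrow> complex ^ 'n \<Rightarrow> _"

context hermitian_inner
begin

text \<open>
  The adjoint of \<open>D\<close> with respect to \<open>h\<close>; the frame only serves to write it down.
\<close>

definition adjoint_map :: "('n \<Rightarrow> complex ^ 'n) \<Rightarrow> (complex ^ 'n \<Rightarrow> complex ^ 'n) \<Rightarrow> complex ^ 'n \<Rightarrow> complex ^ 'n"
  where "adjoint_map v D Y = (\<Sum>k\<in>UNIV. h Y (D (v k)) *s v k)"

lemma complex_linear_adjoint_map: "complex_linear (adjoint_map v D)"
  unfolding complex_linear_def adjoint_map_def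
  by (auto simp: add_left scale_left vec_eq_iff sum.distrib sum_distrib_left algebra_simps)

lemma adjoint_map:
  assumes v: "unitary_frame h v" and D: "complex_linear D"
  shows "h X (adjoint_map v D Y) = h (D X) Y"
proof -
  have "h (D X) Y = h (\<Sum>k\<in>UNIV. h X (v k) *s D (v k)) Y"
    using complex_linear_sum[OF D, of "\<lambda>k. h X (v k) *s v k" UNIV] D unitary_frameD(2)[OF v, of X]
    unfolding complex_linear_def by simp
  also have "\<dots> = h X (adjoint_map v D Y)"
    unfolding adjoint_map_def by (simp add: sum_left sum_right scale_left scale_right cnj_sym mult.commute)
  finally show ?thesis ..
qed

lemma adjoint_map':
  assumes v: "unitary_frame h v" and D: "complex_linear D"
  shows "h (adjoint_map v D X) Y = h X (D Y)"
  using adjoint_map[OF assms, of Y X] cnj_sym by metis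

lemma sum_frame_adjoint:
  assumes v: "unitary_frame h v" and D: "complex_linear D" and s: "sesquilinear s"
  shows "(\<Sum>i\<in>UNIV. s (D (v i)) (v i)) = (\<Sum>i\<in>UNIV. s (v i) (adjoint_map v D (v i)))"
proof -
  interpret s: sesquilinear s by fact
  have "s (D (v i)) (v i) = (\<Sum>k\<in>UNIV. h (D (v i)) (v k) * s (v k) (v i))" for i
    by (subst unitary_frameD(2)[OF v, of "D (v i)"]) (simp add: s.sum_left s.scale_left)
  moreover have "s (v k) (adjoint_map v D (v k)) = (\<Sum>i\<in>UNIV. h (D (v i)) (v k) * s (v k) (v i))" for k
    unfolding adjoint_map_def by (simp add: s.sum_right s.scale_right cnj_sym)
  ultimately show ?thesis by (simp, subst sum.swap) simp
qed

end

context metric_lie_algebra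
begin

text \<open>
  The Hermitian form whose real part is the tensor \<open>K\<close> (theorem \<open>K_tensor_eq_kform\<close>).  It is the moment
  map for the action of the general linear group on brackets, which is expressed by \<open>trace_kform\<close>.
\<close>

definition kform :: "('n \<Rightarrow> complex ^ 'n) \<Rightarrow> complex ^ 'n \<Rightarrow> complex ^ 'n \<Rightarrow> complex"
  where "kform v X Y = (1/2) * (\<Sum>p\<in>UNIV. \<Sum>q\<in>UNIV. h X (br (v p) (v q)) * h (br (v p) (v q)) Y)
     - (\<Sum>p\<in>UNIV. h (br X (v p)) (br Y (v p)))"

lemma hermitian_kform: "hermitian (kform v)"
proof
  fix X Y Z c
  show "kform v (X + Y) Z = kform v X Z + kform v Y Z"
    unfolding kform_def by (simp add: br_add_left add_left sum.distrib algebra_simps)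
  show "kform v (c *s X) Z = c * kform v X Z"
    unfolding kform_def by (simp add: br_scale_left scale_left sum_distrib_left algebra_simps)
  show "cnj (kform v X Y) = kform v Y X"
    unfolding kform_def by (simp add: cnj_sym mult.commute)
qed

definition sc :: "('n \<Rightarrow> complex ^ 'n) \<Rightarrow> 'n \<Rightarrow> 'n \<Rightarrow> 'n \<Rightarrow> complex"
  where "sc v i j k = h (br (v i) (v j)) (v k)"

lemma sc_anti: "cmod (sc v j i k) = cmod (sc v i j k)"
  unfolding sc_def by (subst br_anti) (simp add: minus_left)

lemma kform_diagonal:
  assumes v: "unitary_frame h v"
  shows "Re (kform v (v i) (v i)) = (1/2) * (\<Sum>p\<in>UNIV. \<Sum>q\<in>UNIV. (cmod (sc v p q i))\<^sup>2) - (\<Sum>p\<in>UNIV. \<Sum>q\<in>UNIV. (cmod (sc v i p q))\<^sup>2)"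
proof -
  have "h (v i) (br (v p) (v q)) * h (br (v p) (v q)) (v i) = complex_of_real ((cmod (sc v p q i))\<^sup>2)" for p q
    unfolding complex_norm_square sc_def cnj_sym by (rule mult.commute)
  then show ?thesis
    unfolding kform_def
    by (simp add: frame_parseval_norm[OF v] sc_def flip: of_real_sum)
qed

text \<open>
  An endomorphism with eigenvalues \<open>a i\<close> in the frame \<open>v\<close> acts on the structure constant with indices
  \<open>i\<close>, \<open>j\<close>, \<open>k\<close> with weight \<open>a k - a i - a j\<close>.
\<close>

lemma sum_kform_diagonal:
  assumes v: "unitary_frame h v"
  shows "(\<Sum>i\<in>UNIV. a i * Re (kform v (v i) (v i)))
    = (1/2) * (\<Sum>i\<in>UNIV. \<Sum>j\<in>UNIV. \<Sum>k\<in>UNIV. (a k - a i - a j) * (cmod (sc v i j k))\<^sup>2)"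
proof -
  let ?C = "\<lambda>i j k. (cmod (sc v i j k))\<^sup>2"
  have 1: "(\<Sum>i\<in>UNIV. a i * (\<Sum>p\<in>UNIV. \<Sum>q\<in>UNIV. ?C p q i)) = (\<Sum>i\<in>UNIV. \<Sum>j\<in>UNIV. \<Sum>k\<in>UNIV. a k * ?C i j k)"
    unfolding sum_distrib_left by (subst sum.swap, rule sum.cong[OF refl], rule sum.swap)
  have 2: "(\<Sum>i\<in>UNIV. a i * (\<Sum>p\<in>UNIV. \<Sum>q\<in>UNIV. ?C i p q)) = (\<Sum>i\<in>UNIV. \<Sum>j\<in>UNIV. \<Sum>k\<in>UNIV. a i * ?C i j k)"
    unfolding sum_distrib_left by simp
  have 3: "(\<Sum>i\<in>UNIV. \<Sum>j\<in>UNIV. \<Sum>k\<in>UNIV. a j * ?C i j k) = (\<Sum>i\<in>UNIV. \<Sum>j\<in>UNIV. \<Sum>k\<in>UNIV. a i * ?C i j k)"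
    by (subst sum.swap) (simp add: sc_anti)
  have 4: "(\<Sum>i\<in>UNIV. a i * ((1/2) * x i - y i)) = (1/2) * (\<Sum>i\<in>UNIV. a i * x i) - (\<Sum>i\<in>UNIV. a i * y i)"
    for x y :: "'n \<Rightarrow> real" by (simp add: right_diff_distrib sum_subtractf sum_distrib_left)
  show ?thesis
    unfolding kform_diagonal[OF v] 4 1 2 left_diff_distrib sum_subtractf 3 by simp
qed

definition bracket_norm :: "('n \<Rightarrow> complex ^ 'n) \<Rightarrow> real"
  where "bracket_norm v = (\<Sum>i\<in>UNIV. \<Sum>j\<in>UNIV. \<Sum>k\<in>UNIV. (cmod (sc v i j k))\<^sup>2)"

text \<open>
  The moment map property: the pairing of \<open>kform\<close> with \<open>E\<close> is half the inner product of the bracket with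
  its image under the infinitesimal action of \<open>E\<close>.  In particular it vanishes if \<open>E\<close> or its adjoint is a
  derivation.
\<close>

lemma trace_kform:
  assumes v: "unitary_frame h v" and E: "complex_linear E"
  shows "(\<Sum>i\<in>UNIV. kform v (E (v i)) (v i)) = (1/2) * (\<Sum>i\<in>UNIV. \<Sum>j\<in>UNIV.
     h (E (br (v i) (v j)) - br (E (v i)) (v j) - br (v i) (E (v j))) (br (v i) (v j)))"
proof -
  have 1: "(\<Sum>i\<in>UNIV. h (E (v i)) Z * h Z (v i)) = h (E Z) Z" for Z
  proof -
    have "h (E Z) Z = h (\<Sum>k\<in>UNIV. h Z (v k) *s E (v k)) Z"
      using complex_linear_sum[OF E, of "\<lambda>k. h Z (v k) *s v k" UNIV] E unitary_frameD(2)[OF v, of Z]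
      unfolding complex_linear_def by simp
    then show ?thesis by (simp add: sum_left scale_left mult.commute)
  qed
  have "(\<Sum>i\<in>UNIV. \<Sum>p\<in>UNIV. \<Sum>q\<in>UNIV. h (E (v i)) (br (v p) (v q)) * h (br (v p) (v q)) (v i))
     = (\<Sum>p\<in>UNIV. \<Sum>q\<in>UNIV. \<Sum>i\<in>UNIV. h (E (v i)) (br (v p) (v q)) * h (br (v p) (v q)) (v i))"
    by (subst sum.swap, rule sum.cong[OF refl], rule sum.swap)
  also have "\<dots> = (\<Sum>p\<in>UNIV. \<Sum>q\<in>UNIV. h (E (br (v p) (v q))) (br (v p) (v q)))" by (simp add: 1)
  finally have A: "(\<Sum>i\<in>UNIV. \<Sum>p\<in>UNIV. \<Sum>q\<in>UNIV. h (E (v i)) (br (v p) (v q)) * h (br (v p) (v q)) (v i))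
     = (\<Sum>p\<in>UNIV. \<Sum>q\<in>UNIV. h (E (br (v p) (v q))) (br (v p) (v q)))" .
  have B: "(\<Sum>i\<in>UNIV. \<Sum>j\<in>UNIV. h (br (v i) (E (v j))) (br (v i) (v j)))
     = (\<Sum>i\<in>UNIV. \<Sum>j\<in>UNIV. h (br (E (v i)) (v j)) (br (v i) (v j)))"
  proof (subst sum.swap, intro sum.cong refl)
    fix i j
    show "h (br (v j) (E (v i))) (br (v j) (v i)) = h (br (E (v i)) (v j)) (br (v i) (v j))"
      by (subst br_anti, subst (2) br_anti) (simp add: minus_left minus_right)
  qed
  show ?thesis
    unfolding kform_def sum_subtractf sum_distrib_left[symmetric] A diff_left B by (simp add: algebra_simps)
qed

text \<open>
  Write \<open>\<pi>\<close> for the infinitesimal action on brackets and \<open>\<mu>\<close> for the bracket.  As \<open>\<pi> D\<close> kills \<open>\<mu>\<close>,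
  \<open>\<pi> [D, D'] \<mu> = \<pi> D (\<pi> D' \<mu>)\<close>, and since \<open>\<pi> D'\<close> is the adjoint of \<open>\<pi> D\<close>, pairing with \<open>\<mu>\<close> gives the
  squared norm of \<open>nu = \<pi> D' \<mu>\<close>.
\<close>

lemma moment_commutator:
  assumes v: "unitary_frame h v" and D: "complex_linear D" "\<And>X Y. D (br X Y) = br (D X) Y + br X (D Y)"
  defines "D' \<equiv> adjoint_map v D"
  defines "nu \<equiv> \<lambda>X Y. D' (br X Y) - br (D' X) Y - br X (D' Y)"
  shows "(\<Sum>i\<in>UNIV. kform v (D (D' (v i)) - D' (D (v i))) (v i)) = (1/2) * (\<Sum>i\<in>UNIV. \<Sum>j\<in>UNIV. h (nu (v i) (v j)) (nu (v i) (v j)))"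
proof -
  have D': "complex_linear D'" unfolding D'_def by (rule complex_linear_adjoint_map)
  note lin = D(1)[unfolded complex_linear_def] D'[unfolded complex_linear_def]
  have Ddiff: "D (X - Y) = D X - D Y" for X Y
  proof -
    have "D X = D (X - Y) + D Y" using lin by (metis diff_add_cancel)
    then show ?thesis by simp
  qed
  have nu_right: "h Z (nu X Y) = h Z (D' (br X Y)) - h Z (br (D' X) Y) - h Z (br X (D' Y))" for X Y Z
    by (simp add: nu_def diff_right)
  let ?E = "\<lambda>X. D (D' X) - D' (D X)"
  have E: "complex_linear ?E" unfolding complex_linear_def by (auto simp: lin vector_ssub_ldistrib)
  have piE: "?E (br X Y) - br (?E X) Y - br X (?E Y) = D (nu X Y) - nu (D X) Y - nu X (D Y)" for X Y
    unfolding nu_def Ddiff D(2) br_diff using lin by (simp add: algebra_simps)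
  have snu: "sesquilinear (\<lambda>X Y. h (nu X w) (br Y w))" "sesquilinear (\<lambda>X Y. h (nu w X) (br w Y))" for w
    unfolding sesquilinear_def nu_def using lin
    by (auto simp: br_add_left br_add_right br_scale_left br_scale_right add_left add_right scale_left scale_right
          diff_left diff_right algebra_simps)
  have a: "h (D (nu X Y)) Z = h (nu X Y) (D' Z)" for X Y Z
    unfolding D'_def by (rule adjoint_map[OF v D(1), symmetric])
  have b: "(\<Sum>i\<in>UNIV. h (nu (D (v i)) w) (br (v i) w)) = (\<Sum>i\<in>UNIV. h (nu (v i) w) (br (D' (v i)) w))" for w
    unfolding D'_def by (rule sum_frame_adjoint[OF v D(1) snu(1)])
  have c: "(\<Sum>i\<in>UNIV. h (nu w (D (v i))) (br w (v i))) = (\<Sum>i\<in>UNIV. h (nu w (v i)) (br w (D' (v i))))" for w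
    unfolding D'_def by (rule sum_frame_adjoint[OF v D(1) snu(2)])
  have "(\<Sum>i\<in>UNIV. \<Sum>j\<in>UNIV. h (D (nu (v i) (v j)) - nu (D (v i)) (v j) - nu (v i) (D (v j))) (br (v i) (v j)))
     = (\<Sum>i\<in>UNIV. \<Sum>j\<in>UNIV. h (nu (v i) (v j)) (D' (br (v i) (v j))))
       - (\<Sum>j\<in>UNIV. \<Sum>i\<in>UNIV. h (nu (D (v i)) (v j)) (br (v i) (v j)))
       - (\<Sum>i\<in>UNIV. \<Sum>j\<in>UNIV. h (nu (v i) (D (v j))) (br (v i) (v j)))"
    unfolding diff_left sum_subtractf a by (subst (2) sum.swap) simp
  also have "\<dots> = (\<Sum>i\<in>UNIV. \<Sum>j\<in>UNIV. h (nu (v i) (v j)) (D' (br (v i) (v j))))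
       - (\<Sum>i\<in>UNIV. \<Sum>j\<in>UNIV. h (nu (v i) (v j)) (br (D' (v i)) (v j)))
       - (\<Sum>i\<in>UNIV. \<Sum>j\<in>UNIV. h (nu (v i) (v j)) (br (v i) (D' (v j))))"
    unfolding b c by (subst (2) sum.swap) simp
  also have "\<dots> = (\<Sum>i\<in>UNIV. \<Sum>j\<in>UNIV. h (nu (v i) (v j)) (nu (v i) (v j)))"
    by (simp add: nu_right sum_subtractf)
  finally show ?thesis unfolding trace_kform[OF v E] piE by simp
qed

text \<open>
  The squared norm in \<open>moment_commutator\<close> is nonnegative, and in a frame diagonalizing \<open>kform\<close> the other
  side is the displayed sum over the entries of \<open>D\<close>.
\<close>

lemma moment_derivation_inequality:
  assumes v: "unitary_frame h v" and D: "complex_linear D" "\<And>X Y. D (br X Y) = br (D X) Y + br X (D Y)"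
    and diag: "\<And>i j. kform v (v i) (v j) = (if i = j then complex_of_real (\<kappa> i) else 0)"
  shows "0 \<le> (\<Sum>i\<in>UNIV. \<Sum>k\<in>UNIV. (\<kappa> i - \<kappa> k) * (cmod (h (D (v k)) (v i)))\<^sup>2)"
proof -
  let ?D' = "adjoint_map v D"
  interpret k: hermitian "kform v" by (rule hermitian_kform)
  have kX: "kform v X (v i) = \<kappa> i * h X (v i)" for X i
    by (subst (1) unitary_frameD(2)[OF v, of X])
       (simp add: k.sum_left k.scale_left diag if_distrib[of "\<lambda>x. _ * x"] cong: if_cong)
  let ?d = "\<lambda>i k. (cmod (h (D (v k)) (v i)))\<^sup>2"
  have "kform v (D (?D' (v i)) - ?D' (D (v i))) (v i)
      = complex_of_real (\<kappa> i * ((\<Sum>k\<in>UNIV. ?d i k) - (\<Sum>k\<in>UNIV. ?d k i)))" for i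
  proof -
    have "cmod (h (?D' (v i)) (v k)) = cmod (h (D (v k)) (v i))" for k
      by (metis adjoint_map'[OF v D(1)] cnj_sym complex_mod_cnj)
    then have "h (?D' (v i)) (?D' (v i)) = complex_of_real (\<Sum>k\<in>UNIV. ?d i k)"
      by (subst self_real) (simp add: frame_parseval_norm[OF v])
    moreover have "h (D (v i)) (D (v i)) = complex_of_real (\<Sum>k\<in>UNIV. ?d k i)"
      by (subst self_real) (simp add: frame_parseval_norm[OF v])
    ultimately show ?thesis
      by (simp add: kX diff_left adjoint_map[OF v D(1), symmetric] adjoint_map'[OF v D(1)])
  qed
  then have "(\<Sum>i\<in>UNIV. kform v (D (?D' (v i)) - ?D' (D (v i))) (v i))
     = complex_of_real (\<Sum>i\<in>UNIV. \<kappa> i * ((\<Sum>k\<in>UNIV. ?d i k) - (\<Sum>k\<in>UNIV. ?d k i)))" by simp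
  also have "(\<Sum>i\<in>UNIV. \<kappa> i * ((\<Sum>k\<in>UNIV. ?d i k) - (\<Sum>k\<in>UNIV. ?d k i)))
     = (\<Sum>i\<in>UNIV. \<Sum>k\<in>UNIV. (\<kappa> i - \<kappa> k) * ?d i k)"
  proof -
    have "(\<Sum>i\<in>UNIV. \<Sum>k\<in>UNIV. \<kappa> i * ?d k i) = (\<Sum>i\<in>UNIV. \<Sum>k\<in>UNIV. \<kappa> k * ?d i k)" by (rule sum.swap)
    then show ?thesis by (simp add: right_diff_distrib left_diff_distrib sum_subtractf sum_distrib_left)
  qed
  finally have "complex_of_real (\<Sum>i\<in>UNIV. \<Sum>k\<in>UNIV. (\<kappa> i - \<kappa> k) * ?d i k)
     = (\<Sum>i\<in>UNIV. kform v (D (?D' (v i)) - ?D' (D (v i))) (v i))" ..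
  also note moment_commutator[OF v D]
  finally have "(\<Sum>i\<in>UNIV. \<Sum>k\<in>UNIV. (\<kappa> i - \<kappa> k) * ?d i k) = Re ((1/2) * (\<Sum>i\<in>UNIV. \<Sum>j\<in>UNIV.
      h (?D' (br (v i) (v j)) - br (?D' (v i)) (v j) - br (v i) (?D' (v j)))
        (?D' (br (v i) (v j)) - br (?D' (v i)) (v j) - br (v i) (?D' (v j)))))"
    by (metis Re_complex_of_real)
  also have "\<dots> \<ge> 0" by (auto intro!: sum_nonneg nonneg simp: Re_divide_numeral)
  finally show ?thesis .
qed

end

section \<open>The tensor K of a left-invariant Hermitian metric\<close>

text \<open>
  The Hermitian form with real part \<open>g\<close> that is linear in its first argument.
\<close>

definition herm_of :: "(complex ^ 'n) metric \<Rightarrow> complex ^ 'n \<Rightarrow> complex ^ 'n \<Rightarrow> complex"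
  where "herm_of g X Y = Complex (g X Y) (g X (cplx_J Y))"

lemma J_J [simp]: "cplx_J (cplx_J X) = - (X :: complex ^ 'n)"
  by (simp add: vec_eq_iff)

lemma J_scaleR: "cplx_J (r *\<^sub>R X) = r *\<^sub>R cplx_J (X :: complex ^ 'n)"
  by (simp add: vec_eq_iff)

context
  fixes g :: "(complex ^ 'n) metric"
  assumes g: "hermitian_metric g"
begin

lemma metric_simps:
  "g (X + Y) Z = g X Z + g Y Z" "g Z (X + Y) = g Z X + g Z Y"
  "g (r *\<^sub>R X) Z = r * g X Z" "g Z (r *\<^sub>R X) = r * g Z X"
  "g (- X) Z = - g X Z" "g Z (- X) = - g Z X" "g 0 Z = 0" "g Z 0 = 0"
proof -
  have b: "bilinear g" using g unfolding hermitian_metric_def by blast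
  show "g (X + Y) Z = g X Z + g Y Z" "g Z (X + Y) = g Z X + g Z Y"
    "g (r *\<^sub>R X) Z = r * g X Z" "g Z (r *\<^sub>R X) = r * g Z X"
    "g (- X) Z = - g X Z" "g Z (- X) = - g Z X" "g 0 Z = 0" "g Z 0 = 0"
    using bilinear_ladd[OF b] bilinear_radd[OF b] bilinear_lmul[OF b] bilinear_rmul[OF b]
      bilinear_lneg[OF b] bilinear_rneg[OF b] bilinear_lzero[OF b] bilinear_rzero[OF b] by simp_all
qed

lemma metric_sym: "g X Y = g Y X" using g unfolding hermitian_metric_def by blast
lemma metric_J: "g (cplx_J X) (cplx_J Y) = g X Y" using g unfolding hermitian_metric_def by blast
lemma metric_J_left: "g (cplx_J X) Y = - g X (cplx_J Y)"
  using metric_J[of X "cplx_J Y"] by (simp add: metric_simps)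

lemma herm_of_hermitian_inner: "hermitian_inner (herm_of g)"
proof
  fix X Y Z c
  show "herm_of g (X + Y) Z = herm_of g X Z + herm_of g Y Z"
    by (simp add: herm_of_def metric_simps complex_eq_iff)
  show "herm_of g (c *s X) Z = c * herm_of g X Z"
    unfolding smult_split[of c]
    by (simp add: herm_of_def metric_simps metric_J metric_J_left complex_eq_iff)
  show "cnj (herm_of g X Y) = herm_of g Y X"
    using metric_sym[of X Y] metric_sym[of "cplx_J Y" X] metric_J_left[of Y X]
    by (simp add: herm_of_def complex_eq_iff)
  show "0 < Re (herm_of g X X)" if "X \<noteq> 0"
    using g that unfolding hermitian_metric_def herm_of_def by simp
qed

end

lemma metric_of_hermitian:
  assumes "hermitian_inner h"
  shows "hermitian_metric (\<lambda>X Y. Re (h X Y))" "herm_of (\<lambda>X Y. Re (h X Y)) = h"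
proof -
  interpret hermitian_inner h by fact
  have "Re (h X Y) = Re (h Y X)" for X Y using arg_cong[OF cnj_sym[of X Y], of Re] by simp
  moreover have "bilinear (\<lambda>X Y. Re (h X Y))"
    unfolding bilinear_def by (auto intro!: linearI simp: add_left add_right scaleR_left scaleR_right)
  ultimately show "hermitian_metric (\<lambda>X Y. Re (h X Y))"
    unfolding hermitian_metric_def using pos by (auto simp: scale_left scale_right)
  show "herm_of (\<lambda>X Y. Re (h X Y)) = h"
    by (intro ext) (simp add: herm_of_def scale_right complex_eq_iff)
qed

lemma part10_bracket:
  assumes "complex_lie_algebra br"
  shows "cext br (part10 X) (part10 Y) = part10 (br X Y)"
proof -
  interpret complex_lie_algebra br by fact
  have e: "(1/4) *\<^sub>R Z + (1/4) *\<^sub>R Z = (1/2) *\<^sub>R (Z :: complex ^ 'n)" for Z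
    by (simp flip: scaleR_left_distrib)
  show ?thesis
    unfolding cext_def part10_def
    by (simp add: br_scaleR br_minus br_scale_left br_scale_right e)
       (simp add: vec_eq_iff)
qed

lemma cext_form_10_01:
  assumes g: "hermitian_metric g"
  shows "cext_form g (part10 X) (part01 Y) = herm_of g X Y / 2"
  unfolding cext_form_def part10_def part01_def herm_of_def
  by (simp add: metric_simps[OF g] metric_J[OF g] metric_J_left[OF g] complex_eq_iff)

text \<open>
  On a complex Lie group a left-invariant field of type \<open>(1,0)\<close> commutes with one of type \<open>(0,1)\<close>, so the
  zero connection on left-invariant fields has all defining properties.  Conversely, for a Chern
  connection \<open>N\<close> the part \<open>A\<close> of \<open>N X Y\<close> antilinear in \<open>X\<close> is symmetric by the torsion condition but linear
  in \<open>Y\<close>, hence zero; replacing \<open>X\<close> by \<open>\<i> X\<close> in \<open>\<nabla>g = 0\<close> then shows that \<open>N X\<close> is skew and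
  self-adjoint at once.
\<close>

lemma chern_connection_zero:
  assumes br: "complex_lie_algebra br" and g: "hermitian_metric g"
  shows "chern_connection br g = (\<lambda>X Y. 0)"
  unfolding chern_connection_def
proof (rule the_equality)
  interpret complex_lie_algebra br by fact
  show "is_chern_connection br g (\<lambda>X Y. 0)"
    unfolding is_chern_connection_def
    by (auto simp: bilinear_def linear_zero metric_simps[OF g] torsion_def cext_def part10_def part01_def
         br_scaleR br_minus br_scale_left br_scale_right zero_prod_def J_scaleR)
  fix N assume N: "is_chern_connection br g N"
  have bil: "bilinear N" and NJ: "\<And>X Y. N X (cplx_J Y) = cplx_J (N X Y)"
    and met: "\<And>X Y Z. g (N X Y) Z + g Y (N X Z) = 0"
    and tor: "\<And>X Y. cext (torsion br N) (part10 X) (part01 Y) = 0"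
    using N unfolding is_chern_connection_def by blast+
  have Nneg: "N (- X) Y = - N X Y" for X Y using bil by (rule bilinear_lneg)
  define A where "A X Y = N X Y + cplx_J (N (cplx_J X) Y)" for X Y
  have A_sym: "A X Y = A Y X" for X Y
  proof -
    let ?T = "torsion br N"
    have T_scale: "?T (r *\<^sub>R X) Y = r *\<^sub>R ?T X Y" "?T X (r *\<^sub>R Y) = r *\<^sub>R ?T X Y" for r X Y
      using bil by (simp_all add: torsion_def br_scaleR bilinear_lmul bilinear_rmul scaleR_diff_right)
    have T_neg: "?T (- X) Y = - ?T X Y" for X Y using T_scale(1)[of "-1" X Y] by simp
    have "fst (cext ?T (part10 X) (part01 Y)) = (1/4) *\<^sub>R (?T X Y + ?T (cplx_J X) (cplx_J Y))"
      unfolding cext_def part10_def part01_def by (simp add: T_scale T_neg scaleR_add_right)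
    then have "?T X Y + ?T (cplx_J X) (cplx_J Y) = 0" using tor[of X Y] by simp
    then show ?thesis
      unfolding torsion_def A_def by (simp add: NJ br_scale_left br_scale_right algebra_simps)
  qed
  have A_J1: "A (cplx_J X) Y = - cplx_J (A X Y)" for X Y
    unfolding A_def by (simp add: Nneg)
  have A_J2: "A X (cplx_J Y) = cplx_J (A X Y)" for X Y
    unfolding A_def by (simp add: NJ)
  have A0: "A X Y = 0" for X Y
  proof -
    have "- cplx_J (A X Y) = cplx_J (A X Y)"
      using A_J1[of X Y] A_J2[of Y X] A_sym[of "cplx_J X" Y] A_sym[of X Y] by metis
    then show ?thesis by (simp add: vec_eq_iff)
  qed
  have NJ1: "N (cplx_J X) Y = cplx_J (N X Y)" for X Y
  proof -
    have "cplx_J (A X Y) = 0" using A0 by simp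
    then show ?thesis unfolding A_def by (simp add: vec_eq_iff algebra_simps)
  qed
  have "N X Z = 0" for X Z
  proof -
    have z: "g Y (cplx_J (N X Z)) = 0" for Y
      using met[of "cplx_J X" Y Z] met[of X Y "cplx_J Z"]
      by (simp add: NJ1 NJ metric_J_left[OF g])
    have "g (cplx_J (N X Z)) (cplx_J (N X Z)) = 0" by (rule z)
    then have "g (N X Z) (N X Z) = 0" by (simp add: metric_J[OF g])
    then show ?thesis using g unfolding hermitian_metric_def by (metis less_irrefl)
  qed
  then show "N = (\<lambda>X Y. 0)" by (intro ext)
qed

lemma real_trace_complex_linear:
  assumes f: "complex_linear (f :: complex ^ 'n \<Rightarrow> complex ^ 'n)"
  shows "real_trace f = 2 * Re (\<Sum>i\<in>UNIV. f (axis i 1) $ i)"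
proof -
  have fi: "f (axis i \<i>) = \<i> *s f (axis i 1)" for i
  proof -
    have "axis i \<i> = \<i> *s (axis i 1 :: complex ^ 'n)" by (simp add: vec_eq_iff axis_def)
    then show ?thesis using f unfolding complex_linear_def by metis
  qed
  have B: "(Basis :: (complex ^ 'n) set) = (\<lambda>(i, u). axis i u) ` (UNIV \<times> {1, \<i>})"
    unfolding Basis_vec_def by (auto simp: Basis_complex_def)
  have inj: "inj_on (\<lambda>(i, u). axis i u :: complex ^ 'n) (UNIV \<times> {1, \<i>})"
    by (auto simp: inj_on_def axis_eq_axis)
  have "real_trace f = (\<Sum>(i, u)\<in>UNIV \<times> {1, \<i>}. f (axis i u) \<bullet> axis i u)"
    unfolding real_trace_def B by (subst sum.reindex[OF inj]) (simp add: split_beta o_def)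
  also have "\<dots> = (\<Sum>i\<in>UNIV. \<Sum>u\<in>{1, \<i>}. f (axis i u) \<bullet> axis i u)"
    by (rule sum.cartesian_product[symmetric])
  also have "\<dots> = (\<Sum>i\<in>UNIV. 2 * Re (f (axis i 1) $ i))"
    by (simp add: inner_axis fi inner_complex_def)
  finally show ?thesis by (simp add: sum_distrib_left)
qed

context hermitian_inner
begin

lemma trace_frame:
  assumes v: "unitary_frame h v" and f: "complex_linear f"
  shows "(\<Sum>p\<in>UNIV. h (f (v p)) (v p)) = (\<Sum>i\<in>UNIV. f (axis i 1) $ i)"
proof -
  have "f (v p) = (\<Sum>i\<in>UNIV. v p $ i *s f (axis i 1))" for p
    using complex_linear_sum[OF f, of "\<lambda>i. v p $ i *s axis i 1" UNIV] f
    unfolding complex_linear_def by (simp add: basis_expansion)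
  then have "(\<Sum>p\<in>UNIV. h (f (v p)) (v p)) = (\<Sum>p\<in>UNIV. \<Sum>i\<in>UNIV. v p $ i * h (f (axis i 1)) (v p))"
    by (simp add: sum_left scale_left)
  also have "\<dots> = (\<Sum>i\<in>UNIV. \<Sum>p\<in>UNIV. h (f (axis i 1)) (v p) * v p $ i)"
    by (subst sum.swap) (simp add: mult.commute)
  also have "\<dots> = (\<Sum>i\<in>UNIV. f (axis i 1) $ i)"
    by (subst (2) unitary_frameD(2)[OF v]) simp
  finally show ?thesis .
qed

lemma real_trace_frame:
  assumes v: "unitary_frame h v" and f: "complex_linear f"
  shows "real_trace f = 2 * Re (\<Sum>p\<in>UNIV. h (f (v p)) (v p))"
  unfolding trace_frame[OF assms] by (rule real_trace_complex_linear[OF f])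

end

text \<open>
  In terms of a unitary frame the inverse metric is \<open>2 \<Sum>\<^sub>p v\<^sub>p v\<^sub>p\<^sup>*\<close>; the factor arises because
  \<open>g (Z\<^sub>i, Zbar j)\<close> is half the entry of \<open>herm_of g\<close>.  Contractions thus become sums over the frame.
\<close>

lemma raise_indices:
  assumes g: "hermitian_metric g" and v: "unitary_frame (herm_of g) v" and s: "sesquilinear s"
  shows "(\<Sum>k\<in>UNIV. \<Sum>l\<in>UNIV. g_inv g k l * s (axis k 1) (axis l 1)) = 2 * (\<Sum>p\<in>UNIV. s (v p) (v p))"
proof -
  interpret s: sesquilinear s by fact
  interpret h: hermitian_inner "herm_of g" by (rule herm_of_hermitian_inner[OF g])
  let ?h = "herm_of g"
  let ?G = "transpose (\<chi> i j. cext_form g (Zf i) (Zbar j)) :: complex ^ 'a ^ 'a"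
  define N :: "complex ^ 'a ^ 'a" where "N = (\<chi> k l. 2 * (\<Sum>p\<in>UNIV. v p $ k * cnj (v p $ l)))"
  have G: "?G $ i $ k = ?h (axis k 1) (axis i 1) / 2" for i k
    by (simp add: transpose_def Zf_def Zbar_def cext_form_10_01[OF g])
  have "?G ** N = mat 1"
  proof (simp add: vec_eq_iff, intro allI)
    fix i l
    have "(?G ** N) $ i $ l = (\<Sum>k\<in>UNIV. \<Sum>p\<in>UNIV. (v p $ k * ?h (axis k 1) (axis i 1)) * cnj (v p $ l))"
      unfolding matrix_matrix_mult_def by (simp add: G N_def sum_distrib_left mult_ac)
    also have "\<dots> = (\<Sum>p\<in>UNIV. ?h (v p) (axis i 1) * cnj (v p $ l))"
    proof (subst sum.swap, rule sum.cong[OF refl])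
      fix p
      have "?h (v p) (axis i 1) = ?h (\<Sum>k\<in>UNIV. v p $ k *s axis k 1) (axis i 1)" by (simp add: basis_expansion)
      then show "(\<Sum>k\<in>UNIV. v p $ k * ?h (axis k 1) (axis i 1) * cnj (v p $ l)) = ?h (v p) (axis i 1) * cnj (v p $ l)"
        by (simp add: h.sum_left h.scale_left sum_distrib_right)
    qed
    also have "\<dots> = cnj ((\<Sum>p\<in>UNIV. ?h (axis i 1) (v p) *s v p) $ l)"
      by (simp add: h.cnj_sym)
    also have "\<dots> = cnj ((axis i 1 :: complex ^ 'a) $ l)"
      by (subst unitary_frameD(2)[OF v, of "axis i 1", symmetric]) (rule refl)
    finally show "(?G ** N) $ i $ l = mat 1 $ i $ l" by (simp add: axis_def mat_def)
  qed
  then have GN: "?G ** N = mat 1" and NG: "N ** ?G = mat 1"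
    using matrix_left_right_inverse[of ?G N] by blast+
  have inv: "?G ** matrix_inv ?G = mat 1"
    unfolding matrix_inv_def by (rule someI2[of _ N]) (use GN NG in blast)+
  have "matrix_inv ?G = (N ** ?G) ** matrix_inv ?G" unfolding NG by (rule matrix_mul_lid[symmetric])
  also have "\<dots> = N" unfolding matrix_mul_assoc[symmetric] inv by (rule matrix_mul_rid)
  finally have "matrix_inv ?G = N" .
  then have gi: "g_inv g k l = 2 * (\<Sum>p\<in>UNIV. v p $ k * cnj (v p $ l))" for k l
    by (simp add: g_inv_def N_def)
  have "(\<Sum>k\<in>UNIV. \<Sum>l\<in>UNIV. g_inv g k l * s (axis k 1) (axis l 1))
     = (\<Sum>k\<in>UNIV. \<Sum>l\<in>UNIV. \<Sum>p\<in>UNIV. 2 * (v p $ k * cnj (v p $ l) * s (axis k 1) (axis l 1)))"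
    by (simp add: gi sum_distrib_left sum_distrib_right mult_ac)
  also have "\<dots> = (\<Sum>k\<in>UNIV. \<Sum>p\<in>UNIV. \<Sum>l\<in>UNIV. 2 * (v p $ k * cnj (v p $ l) * s (axis k 1) (axis l 1)))"
    by (intro sum.cong refl sum.swap)
  also have "\<dots> = (\<Sum>p\<in>UNIV. \<Sum>k\<in>UNIV. \<Sum>l\<in>UNIV. 2 * (v p $ k * cnj (v p $ l) * s (axis k 1) (axis l 1)))"
    by (rule sum.swap)
  also have "\<dots> = (\<Sum>p\<in>UNIV. 2 * s (v p) (v p))"
  proof (rule sum.cong[OF refl])
    fix p
    show "(\<Sum>k\<in>UNIV. \<Sum>l\<in>UNIV. 2 * (v p $ k * cnj (v p $ l) * s (axis k 1) (axis l 1))) = 2 * s (v p) (v p)"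
      unfolding s.components[of "v p" "v p"] sum_distrib_left by (rule refl)
  qed
  also have "\<dots> = 2 * (\<Sum>p\<in>UNIV. s (v p) (v p))" by (rule sum_distrib_left[symmetric])
  finally show ?thesis .
qed

text \<open>
  Since the Chern connection vanishes, the curvature is zero and the torsion is the negative of the
  bracket.  \<open>Q\<^sup>3\<close> and \<open>Q\<^sup>4\<close> contain a contraction of the torsion, that is a trace of some \<open>ad\<close>, which
  vanishes by unimodularity; \<open>Q\<^sup>1\<close> and \<open>Q\<^sup>2\<close> give the two sums of \<open>kform\<close>.
\<close>

theorem K_tensor_eq_kform:
  assumes br: "complex_lie_algebra br" and uni: "unimodular br"
    and g: "hermitian_metric g" and v: "unitary_frame (herm_of g) v"
  shows "K_tensor br g X Y = Re (metric_lie_algebra.kform br (herm_of g) v X Y)"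
proof -
  interpret complex_lie_algebra br by fact
  interpret h: hermitian_inner "herm_of g" by (rule herm_of_hermitian_inner[OF g])
  interpret ml: metric_lie_algebra br "herm_of g" ..
  let ?h = "herm_of g" and ?e = "\<lambda>i. axis i 1 :: complex ^ 'a"
  have T: "T_comp br g i j k = - ?h (br (?e i) (?e j)) (?e k) / 2" for i j k
  proof -
    have "torsion br (chern_connection br g) = (\<lambda>X Y. - br X Y)"
      by (intro ext) (simp add: torsion_def chern_connection_zero[OF br g])
    moreover have "cext (\<lambda>X Y. - br X Y) Z W = - cext br Z W" for Z W by (simp add: cext_def)
    moreover have "- part10 Z = part10 (- Z)" for Z :: "complex ^ 'a" by (simp add: part10_def vec_eq_iff)
    ultimately show ?thesis
      by (simp add: T_comp_def Zf_def Zbar_def part10_bracket[OF br] cext_form_10_01[OF g] h.minus_left)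
  qed
  have S: "S_comp br g i j = 0" for i j
  proof -
    have c: "cext (\<lambda>X Y. 0) Z W = 0" for Z W :: "(complex ^ 'a) \<times> (complex ^ 'a)"
      by (simp add: cext_def zero_prod_def)
    have f: "cext_form g 0 Z = 0" for Z by (simp add: cext_form_def metric_simps[OF g] complex_eq_iff)
    have "Omega_comp br g k l i j = 0" for k l
      unfolding Omega_comp_def chern_connection_zero[OF br g] Let_def c diff_0_right by (rule f)
    then show ?thesis unfolding S_comp_def by simp
  qed
  have parseval: "(\<Sum>p\<in>UNIV. ?h A (v p) * ?h (v p) B) = ?h A B" for A B
    using h.frame_parseval[OF v, of A B] by (simp add: h.cnj_sym)
  note raise = raise_indices[OF g v]
  have c2: "(\<Sum>m\<in>UNIV. \<Sum>n\<in>UNIV. c * f m n) = c * (\<Sum>m\<in>UNIV. \<Sum>n\<in>UNIV. f m n)"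
    for c and f :: "'a \<Rightarrow> 'a \<Rightarrow> complex" by (simp add: sum_distrib_left)
  have tr0: "(\<Sum>p\<in>UNIV. ?h (br Z (v p)) (v p)) = 0" for Z
  proof -
    have R: "Re (\<Sum>p\<in>UNIV. ?h (br Z (v p)) (v p)) = 0" for Z
      using uni h.real_trace_frame[OF v complex_linear_ad(1)[of Z]] unfolding unimodular_def by simp
    have "Re (\<Sum>p\<in>UNIV. ?h (br (cplx_J Z) (v p)) (v p)) = - Im (\<Sum>p\<in>UNIV. ?h (br Z (v p)) (v p))"
      by (simp add: br_scale_left h.scale_left sum_negf)
    then show ?thesis using R[of Z] R[of "cplx_J Z"] by (simp add: complex_eq_iff)
  qed
  have raiseT: "(\<Sum>k\<in>UNIV. \<Sum>l\<in>UNIV. g_inv g k l * T_comp br g i k l) = 0" for i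
  proof -
    have "sesquilinear (\<lambda>A B. ?h (br (?e i) A) B)"
      unfolding sesquilinear_def by (simp add: br_add_right br_scale_right h.add_left h.add_right h.scale_left h.scale_right)
    from raise[OF this] tr0[of "?e i"] show ?thesis
      by (simp add: T sum_negf flip: sum_divide_distrib)
  qed
  have raiseTc: "(\<Sum>k\<in>UNIV. \<Sum>l\<in>UNIV. g_inv g k l * cnj (T_comp br g i l k)) = 0" for i
  proof -
    have "sesquilinear (\<lambda>A B. ?h A (br (?e i) B))"
      unfolding sesquilinear_def by (simp add: br_add_right br_scale_right h.add_left h.add_right h.scale_left h.scale_right)
    moreover have "(\<Sum>p\<in>UNIV. ?h (v p) (br (?e i) (v p))) = cnj (\<Sum>p\<in>UNIV. ?h (br (?e i) (v p)) (v p))"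
      by (simp add: h.cnj_sym)
    ultimately show ?thesis using raise[of "\<lambda>A B. ?h A (br (?e i) B)"] tr0[of "?e i"]
      by (simp add: T h.cnj_sym sum_negf flip: sum_divide_distrib)
  qed
  have Q1: "Q1_comp br g i j = (\<Sum>p\<in>UNIV. ?h (br (?e i) (v p)) (br (?e j) (v p)))" for i j
  proof -
    have inner: "(\<Sum>m\<in>UNIV. \<Sum>n\<in>UNIV. g_inv g k l * g_inv g m n * T_comp br g i k n * cnj (T_comp br g j l m))
       = g_inv g k l * (?h (br (?e i) (?e k)) (br (?e j) (?e l)) / 2)" for k l
    proof -
      let ?s = "\<lambda>A B. ?h (br (?e i) (?e k)) B * ?h A (br (?e j) (?e l))"
      have "sesquilinear ?s"
        unfolding sesquilinear_def by (simp add: h.add_left h.add_right h.scale_left h.scale_right algebra_simps)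
      from raise[OF this]
      have E: "(\<Sum>m\<in>UNIV. \<Sum>n\<in>UNIV. g_inv g m n * ?s (?e m) (?e n)) = 2 * ?h (br (?e i) (?e k)) (br (?e j) (?e l))"
        by (simp add: parseval)
      have eq: "(\<Sum>m\<in>UNIV. \<Sum>n\<in>UNIV. g_inv g k l * g_inv g m n * T_comp br g i k n * cnj (T_comp br g j l m))
         = (\<Sum>m\<in>UNIV. \<Sum>n\<in>UNIV. (g_inv g k l / 4) * (g_inv g m n * ?s (?e m) (?e n)))"
        by (intro sum.cong refl) (simp add: T h.cnj_sym)
      show ?thesis unfolding eq c2 E by simp
    qed
    have "sesquilinear (\<lambda>A B. ?h (br (?e i) A) (br (?e j) B))"
      unfolding sesquilinear_def by (simp add: br_add_right br_scale_right h.add_left h.add_right h.scale_left h.scale_right)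
    from raise[OF this] show ?thesis unfolding Q1_comp_def inner by (simp flip: sum_divide_distrib)
  qed
  have Q2: "Q2_comp br g i j = (\<Sum>p\<in>UNIV. \<Sum>q\<in>UNIV. ?h (?e i) (br (v p) (v q)) * ?h (br (v p) (v q)) (?e j))" for i j
  proof -
    have inner: "(\<Sum>m\<in>UNIV. \<Sum>n\<in>UNIV. g_inv g k l * g_inv g m n * cnj (T_comp br g l n i) * T_comp br g k m j)
       = g_inv g k l * ((\<Sum>q\<in>UNIV. ?h (?e i) (br (?e l) (v q)) * ?h (br (?e k) (v q)) (?e j)) / 2)" for k l
    proof -
      let ?s = "\<lambda>A B. ?h (?e i) (br (?e l) B) * ?h (br (?e k) A) (?e j)"
      have "sesquilinear ?s"
        unfolding sesquilinear_def
        by (simp add: br_add_right br_scale_right h.add_left h.add_right h.scale_left h.scale_right algebra_simps)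
      from raise[OF this]
      have E: "(\<Sum>m\<in>UNIV. \<Sum>n\<in>UNIV. g_inv g m n * ?s (?e m) (?e n)) = 2 * (\<Sum>q\<in>UNIV. ?s (v q) (v q))" .
      have eq: "(\<Sum>m\<in>UNIV. \<Sum>n\<in>UNIV. g_inv g k l * g_inv g m n * cnj (T_comp br g l n i) * T_comp br g k m j)
         = (\<Sum>m\<in>UNIV. \<Sum>n\<in>UNIV. (g_inv g k l / 4) * (g_inv g m n * ?s (?e m) (?e n)))"
        by (intro sum.cong refl) (simp add: T h.cnj_sym)
      show ?thesis unfolding eq c2 E by simp
    qed
    have "sesquilinear (\<lambda>A B. \<Sum>q\<in>UNIV. ?h (?e i) (br B (v q)) * ?h (br A (v q)) (?e j))"
      unfolding sesquilinear_def
      by (simp add: br_add_left br_scale_left h.add_left h.add_right h.scale_left h.scale_right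
          sum.distrib sum_distrib_left algebra_simps)
    from raise[OF this] show ?thesis unfolding Q2_comp_def inner by (simp flip: sum_divide_distrib)
  qed
  have Q3: "Q3_comp br g i j = 0" for i j
  proof -
    have "Q3_comp br g i j = (\<Sum>k\<in>UNIV. \<Sum>l\<in>UNIV. (g_inv g k l * T_comp br g i k l) *
        (\<Sum>m\<in>UNIV. \<Sum>n\<in>UNIV. g_inv g m n * cnj (T_comp br g j n m)))"
      unfolding Q3_comp_def by (simp add: sum_distrib_left mult_ac)
    then show ?thesis by (simp add: raiseTc)
  qed
  have Q4: "Q4_comp br g i j = 0" for i j
  proof -
    let ?g = "g_inv g" and ?T = "T_comp br g"
    have "(\<Sum>k\<in>UNIV. \<Sum>l\<in>UNIV. \<Sum>m\<in>UNIV. \<Sum>n\<in>UNIV. ?g k l * ?g m n * (?T m k l * cnj (?T n j i) + cnj (?T n l k) * ?T m i j))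
       = (\<Sum>k\<in>UNIV. \<Sum>l\<in>UNIV. \<Sum>m\<in>UNIV. \<Sum>n\<in>UNIV. (?g m n * cnj (?T n j i)) * (?g k l * ?T m k l)
            + (?g m n * ?T m i j) * (?g k l * cnj (?T n l k)))"
      by (intro sum.cong refl) (simp add: algebra_simps)
    also have "\<dots> = (\<Sum>m\<in>UNIV. \<Sum>n\<in>UNIV. \<Sum>k\<in>UNIV. \<Sum>l\<in>UNIV. (?g m n * cnj (?T n j i)) * (?g k l * ?T m k l)
            + (?g m n * ?T m i j) * (?g k l * cnj (?T n l k)))"
    proof -
      have sw: "(\<Sum>k\<in>UNIV. \<Sum>l\<in>UNIV. \<Sum>m\<in>UNIV. \<Sum>n\<in>UNIV. f k l m n) = (\<Sum>m\<in>UNIV. \<Sum>n\<in>UNIV. \<Sum>k\<in>UNIV. \<Sum>l\<in>UNIV. f k l m n)"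
        for f :: "'a \<Rightarrow> 'a \<Rightarrow> 'a \<Rightarrow> 'a \<Rightarrow> complex"
      proof -
        have "(\<Sum>k\<in>UNIV. \<Sum>l\<in>UNIV. \<Sum>m\<in>UNIV. \<Sum>n\<in>UNIV. f k l m n) = (\<Sum>k\<in>UNIV. \<Sum>m\<in>UNIV. \<Sum>l\<in>UNIV. \<Sum>n\<in>UNIV. f k l m n)"
          by (rule sum.cong[OF refl], rule sum.swap)
        also have "\<dots> = (\<Sum>m\<in>UNIV. \<Sum>k\<in>UNIV. \<Sum>l\<in>UNIV. \<Sum>n\<in>UNIV. f k l m n)" by (rule sum.swap)
        also have "\<dots> = (\<Sum>m\<in>UNIV. \<Sum>k\<in>UNIV. \<Sum>n\<in>UNIV. \<Sum>l\<in>UNIV. f k l m n)"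
          by (rule sum.cong[OF refl], rule sum.cong[OF refl], rule sum.swap)
        also have "\<dots> = (\<Sum>m\<in>UNIV. \<Sum>n\<in>UNIV. \<Sum>k\<in>UNIV. \<Sum>l\<in>UNIV. f k l m n)"
          by (rule sum.cong[OF refl], rule sum.swap)
        finally show ?thesis .
      qed
      show ?thesis by (rule sw)
    qed
    also have "\<dots> = 0"
      by (simp only: sum.distrib c2 raiseT raiseTc mult_zero_right sum.neutral_const add_0)
    finally show ?thesis unfolding Q4_comp_def by simp
  qed
  have K: "K_comp br g i j = ml.kform v (?e i) (?e j) / 2" for i j
    unfolding K_comp_def S Q1 Q2 Q3 Q4 ml.kform_def by (simp add: field_simps)
  interpret k: hermitian "ml.kform v" by (rule ml.hermitian_kform)
  have "(\<Sum>i\<in>UNIV. \<Sum>j\<in>UNIV. X $ i * cnj (Y $ j) * K_comp br g i j) = ml.kform v X Y / 2"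
    by (subst k.components[of X Y]) (simp add: K flip: sum_divide_distrib)
  then show ?thesis unfolding K_tensor_def by (simp only: Re_divide_numeral)
qed

section \<open>Static metrics force semisimplicity\<close>

text \<open>
  For a basis of \<open>C\<close> consider the Hermitian form \<open>\<Sum>\<^sub>b h X b * h b Y\<close>: its kernel is the orthogonal
  complement of \<open>C\<close>, and its eigenvectors for nonzero eigenvalues lie in \<open>C\<close>.
\<close>

lemma (in hermitian_inner) adapted_frame:
  assumes C: "vec.subspace C"
  shows "\<exists>v I. unitary_frame h v \<and> (\<forall>i\<in>I. v i \<in> C) \<and> (\<forall>X\<in>C. \<forall>i. i \<notin> I \<longrightarrow> h X (v i) = 0)"
proof -
  obtain B where B: "B \<subseteq> C" "vec.independent B" "C \<subseteq> vec.span B"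
    using vec.basis_exists[of C] by metis
  have fin: "finite B" using B(2) by (rule vec.finiteI_independent)
  let ?k = "\<lambda>X Y. \<Sum>b\<in>B. h X b * h b Y"
  have k: "hermitian ?k"
  proof
    fix X Y Z c
    show "?k (X + Y) Z = ?k X Z + ?k Y Z" by (simp add: add_left sum.distrib algebra_simps)
    show "?k (c *s X) Z = c * ?k X Z" by (simp add: scale_left sum_distrib_left algebra_simps)
    show "cnj (?k X Y) = ?k Y X" by (simp add: cnj_sym mult.commute)
  qed
  obtain v d where v: "unitary_frame h v" and d: "\<And>i X. ?k (v i) X = complex_of_real (d i) * h (v i) X"
    using spectral[OF k] by metis
  let ?I = "{i. d i \<noteq> 0}"
  have "v i \<in> C" if "d i \<noteq> 0" for i
  proof -
    let ?w = "\<Sum>b\<in>B. h (v i) b *s b"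
    have "complex_of_real (d i) *s v i = ?w"
    proof (rule frame_ext[OF v])
      fix j
      show "h (complex_of_real (d i) *s v i) (v j) = h ?w (v j)"
        using d[of i "v j"] by (simp add: scale_left sum_left)
    qed
    moreover have "?w \<in> C"
      using B(1) C by (intro vec.subspace_sum vec.subspace_scale) auto
    ultimately have "complex_of_real (1 / d i) *s (complex_of_real (d i) *s v i) \<in> C"
      using C by (simp only: vec.subspace_scale)
    then show ?thesis using that by (simp add: vector_smult_assoc)
  qed
  moreover have "h X (v i) = 0" if X: "X \<in> C" and i: "d i = 0" for X i
  proof -
    have "?k (v i) (v i) = complex_of_real (\<Sum>b\<in>B. (cmod (h b (v i)))\<^sup>2)"
      unfolding of_real_sum by (intro sum.cong refl) (simp only: complex_norm_square cnj_sym mult.commute)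
    then have "complex_of_real (\<Sum>b\<in>B. (cmod (h b (v i)))\<^sup>2) = 0"
      using d[of i "v i"] i by (simp del: of_real_sum of_real_power)
    then have "(\<Sum>b\<in>B. (cmod (h b (v i)))\<^sup>2) = 0" by (simp only: of_real_eq_0_iff)
    then have hb: "h b (v i) = 0" if "b \<in> B" for b
      using that fin by (simp add: sum_nonneg_eq_0_iff)
    have "X \<in> vec.span B" using X B(3) by blast
    then show ?thesis
      by (induction rule: vec.span_induct_alt) (auto simp: add_left scale_left hb)
  qed
  ultimately show ?thesis using v by (intro exI[of _ v] exI[of _ ?I]) auto
qed

context metric_lie_algebra
begin

lemma bracket_norm_eq_0:
  assumes v: "unitary_frame h v" shows "bracket_norm v = 0 \<longleftrightarrow> abelian br"
proof
  assume "bracket_norm v = 0"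
  then have "sc v i j k = 0" for i j k
    unfolding bracket_norm_def by (auto simp: sum_nonneg_eq_0_iff sum_nonneg)
  then have z: "br (v i) (v j) = 0" for i j
    by (intro frame_ext[OF v]) (simp add: sc_def)
  show "abelian br"
    unfolding abelian_def
  proof (intro allI)
    fix X Y
    show "br X Y = 0"
      by (subst unitary_frameD(2)[OF v, of X], subst unitary_frameD(2)[OF v, of Y])
         (simp add: br_sum_left br_sum_right br_scale_left br_scale_right z)
  qed
qed (simp add: bracket_norm_def abelian_def sc_def)

lemma sum_kform_bracket_norm:
  assumes v: "unitary_frame h v"
  shows "(\<Sum>i\<in>UNIV. Re (kform v (v i) (v i))) = - bracket_norm v / 2"
  using sum_kform_diagonal[OF v, of "\<lambda>i. 1"] by (simp add: bracket_norm_def sum_negf)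

lemma bracket_norm_nonneg: "bracket_norm v \<ge> 0"
  unfolding bracket_norm_def by (intro sum_nonneg) auto

text \<open>
  Pair \<open>kform\<close> with the orthogonal projection onto \<open>C\<close>.  If \<open>K = c g\<close> this is \<open>c\<close> times the dimension,
  negative unless \<open>C\<close> is zero.  On the other hand no structure constant has negative weight: a bracket of
  two elements of \<open>C\<close> is zero, and a bracket with one factor in \<open>C\<close> lies in \<open>C\<close>.
\<close>

lemma no_abelian_ideal:
  assumes K: "\<And>v X. unitary_frame h v \<Longrightarrow> Re (kform v X X) = c * Re (h X X)" and c: "c < 0"
    and C: "vec.subspace C" and ideal: "\<And>X Y. Y \<in> C \<Longrightarrow> br X Y \<in> C"
    and ab: "\<And>X Y. X \<in> C \<Longrightarrow> Y \<in> C \<Longrightarrow> br X Y = 0"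
  shows "C = {0}"
proof (rule ccontr)
  assume "C \<noteq> {0}"
  then obtain X where X: "X \<in> C" "X \<noteq> 0" using vec.subspace_0[OF C] by blast
  obtain v I where v: "unitary_frame h v" and I: "\<And>i. i \<in> I \<Longrightarrow> v i \<in> C"
    and nI: "\<And>X i. X \<in> C \<Longrightarrow> i \<notin> I \<Longrightarrow> h X (v i) = 0"
    using adapted_frame[OF C] by metis
  have "I \<noteq> {}"
  proof
    assume "I = {}"
    then have "X = 0" using nI X(1) by (intro frame_ext[OF v]) auto
    then show False using X by simp
  qed
  then have "card I > 0" by (simp add: card_gt_0_iff)
  let ?a = "\<lambda>i. if i \<in> I then 1 else 0 :: real"
  have "(\<Sum>i\<in>UNIV. ?a i * Re (kform v (v i) (v i))) = (\<Sum>i\<in>UNIV. if i \<in> I then c else 0)"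
    by (intro sum.cong refl) (simp add: K[OF v] unitary_frameD(1)[OF v])
  also have "\<dots> = c * card I" by (simp add: sum.If_cases)
  also have "\<dots> < 0" using c \<open>card I > 0\<close> by (simp add: mult_neg_pos)
  finally have "(\<Sum>i\<in>UNIV. \<Sum>j\<in>UNIV. \<Sum>k\<in>UNIV. (?a k - ?a i - ?a j) * (cmod (sc v i j k))\<^sup>2) < 0"
    unfolding sum_kform_diagonal[OF v] by simp
  moreover have "(?a k - ?a i - ?a j) * (cmod (sc v i j k))\<^sup>2 \<ge> 0" for i j k
  proof -
    have "sc v i j k = 0" if "i \<in> I" "j \<in> I"
      using ab[OF I[OF that(1)] I[OF that(2)]] by (simp add: sc_def)
    moreover have "sc v i j k = 0" if "j \<in> I" "k \<notin> I"
      using nI[OF ideal[OF I[OF that(1)]] that(2)] by (simp add: sc_def)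
    moreover have "sc v i j k = 0" if "i \<in> I" "k \<notin> I"
      using nI[OF ideal[OF I[OF that(1)]] that(2), of "v j"] sc_anti[of v i j k] by (simp add: sc_def)
    ultimately show ?thesis by auto
  qed
  ultimately show False by (meson sum_nonneg not_less)
qed

end

context complex_lie_algebra
begin

lemma derived_ideal:
  assumes I: "lie_ideal br I" shows "lie_ideal br (derived_algebra br I)"
  unfolding lie_ideal_def derived_algebra_def
proof (intro conjI allI ballI)
  let ?S = "{br X Y |X Y. X \<in> I \<and> Y \<in> I}"
  show "subspace (span ?S)" by simp
  fix X Y assume "Y \<in> span ?S"
  then show "br X Y \<in> span ?S"
  proof (induction rule: span_induct_alt)
    case base show ?case by (simp add: span_zero)
  next
    case (step r Z W)
    then obtain A B where Z: "Z = br A B" "A \<in> I" "B \<in> I" by blast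
    have "br X A \<in> I" "br X B \<in> I" using I Z unfolding lie_ideal_def by auto
    then have "br (br X A) B + br A (br X B) \<in> span ?S"
      using Z by (intro span_add span_base) blast+
    then have "br X Z \<in> span ?S" unfolding Z ad_derivation[of X A B] .
    then show ?case using step unfolding br_add_right br_scaleR by (intro span_add span_scale)
  qed
qed

lemma abelian_ideal_exists:
  assumes I: "lie_ideal br I" "solvable br I" "I \<noteq> {0}"
  shows "\<exists>A. lie_ideal br A \<and> A \<noteq> {0} \<and> (\<forall>X\<in>A. \<forall>Y\<in>A. br X Y = 0)"
proof -
  let ?D = "\<lambda>n. (derived_algebra br ^^ n) I"
  obtain n where n: "?D n = {0}" using I(2) unfolding solvable_def by blast
  define N where "N = (LEAST n. ?D n = {0})"
  have N: "?D N = {0}" unfolding N_def by (rule LeastI, rule n)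
  have "N \<noteq> 0" using N I(3) by (metis funpow_0)
  then obtain M where M: "N = Suc M" by (cases N) auto
  have ne: "?D M \<noteq> {0}" using not_less_Least[of M "\<lambda>n. ?D n = {0}"] M N_def by simp
  have ideal: "lie_ideal br (?D k)" for k
    by (induction k) (auto simp: I(1) derived_ideal)
  have "br X Y = 0" if "X \<in> ?D M" "Y \<in> ?D M" for X Y
  proof -
    have "br X Y \<in> derived_algebra br (?D M)"
      unfolding derived_algebra_def[of br "?D M"] using that by (intro span_base) blast
    also have "derived_algebra br (?D M) = {0}" using N M by simp
    finally show ?thesis by simp
  qed
  with ideal[of M] ne show ?thesis by blast
qed

text \<open>
  Ideals are real subspaces, whereas \<open>no_abelian_ideal\<close> requires a complex one.
\<close>

lemma complexify_ideal:
  assumes A: "lie_ideal br A" and ab: "\<forall>X\<in>A. \<forall>Y\<in>A. br X Y = 0"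
  shows "\<exists>C. A \<subseteq> C \<and> vec.subspace C \<and> (\<forall>X. \<forall>Y\<in>C. br X Y \<in> C) \<and> (\<forall>X\<in>C. \<forall>Y\<in>C. br X Y = 0)"
proof -
  have sub: "subspace A" and id: "\<And>X Y. Y \<in> A \<Longrightarrow> br X Y \<in> A" using A unfolding lie_ideal_def by auto
  let ?C = "{Y + cplx_J Z |Y Z. Y \<in> A \<and> Z \<in> A}"
  have "Y \<in> ?C" if "Y \<in> A" for Y
  proof -
    have "Y = Y + cplx_J 0" "0 \<in> A" using sub by (auto simp: subspace_0)
    then show ?thesis using that by blast
  qed
  then have "A \<subseteq> ?C" by blast
  moreover have "vec.subspace ?C"
    unfolding vec.subspace_def
  proof (intro conjI ballI allI)
    show "0 \<in> ?C" using \<open>A \<subseteq> ?C\<close> subspace_0[OF sub] by blast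
  next
    fix X Y assume "X \<in> ?C" "Y \<in> ?C"
    then obtain X1 X2 Y1 Y2 where *: "X = X1 + cplx_J X2" "Y = Y1 + cplx_J Y2" "X1 \<in> A" "X2 \<in> A" "Y1 \<in> A" "Y2 \<in> A" by blast
    have "X + Y = (X1 + Y1) + cplx_J (X2 + Y2)" unfolding * by (simp add: vector_add_ldistrib)
    moreover have "X1 + Y1 \<in> A" "X2 + Y2 \<in> A" using * sub by (auto intro: subspace_add)
    ultimately show "X + Y \<in> ?C" by blast
  next
    fix c X assume "X \<in> ?C"
    then obtain X1 X2 where *: "X = X1 + cplx_J X2" "X1 \<in> A" "X2 \<in> A" by blast
    have "c *s X = (Re c *\<^sub>R X1 - Im c *\<^sub>R X2) + cplx_J (Im c *\<^sub>R X1 + Re c *\<^sub>R X2)"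
      unfolding * smult_split[of c] by (simp add: vec_eq_iff scaleR_conv_of_real[where 'a=complex] algebra_simps)
    moreover have "Re c *\<^sub>R X1 - Im c *\<^sub>R X2 \<in> A" "Im c *\<^sub>R X1 + Re c *\<^sub>R X2 \<in> A"
      using * sub by (auto intro!: subspace_add subspace_diff subspace_scale)
    ultimately show "c *s X \<in> ?C" by blast
  qed
  moreover have "br X Y \<in> ?C" if Y: "Y \<in> ?C" for X Y
  proof -
    obtain Y1 Y2 where *: "Y = Y1 + cplx_J Y2" "Y1 \<in> A" "Y2 \<in> A" using Y by blast
    have "br X Y = br X Y1 + cplx_J (br X Y2)" unfolding * by (simp add: br_add_right br_scale_right)
    then show ?thesis using id * by blast
  qed
  moreover have "br X Y = 0" if "X \<in> ?C" "Y \<in> ?C" for X Y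
    using that ab by (auto simp: br_add_right br_add_left br_scale_right br_scale_left)
  ultimately show ?thesis by blast
qed

text \<open>
  The trace of \<open>K = c g\<close> is a negative multiple of the squared norm of the bracket, so \<open>c < 0\<close>; the last
  nonzero derived algebra of a solvable ideal would be an abelian ideal.
\<close>

theorem static_imp_semisimple:
  assumes uni: "unimodular br" and st: "static_with br g c" and na: "\<not> abelian br"
  shows "semisimple br"
proof -
  have g: "hermitian_metric g" and K: "\<And>X Y. K_tensor br g X Y = c * g X Y"
    using st unfolding static_with_def by auto
  interpret h: hermitian_inner "herm_of g" by (rule herm_of_hermitian_inner[OF g])
  interpret ml: metric_lie_algebra br "herm_of g" ..
  have K': "Re (ml.kform v X X) = c * Re (herm_of g X X)" if v: "unitary_frame (herm_of g) v" for v X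
    using K_tensor_eq_kform[OF complex_lie_algebra_axioms uni g v, of X X] K[of X X]
    by (simp add: herm_of_def)
  obtain v where v: "unitary_frame (herm_of g) v" using h.frame_exists by blast
  have "c * CARD('n) = (\<Sum>i\<in>UNIV. Re (ml.kform v (v i) (v i)))"
    by (simp add: K'[OF v] unitary_frameD(1)[OF v])
  also have "\<dots> < 0"
    using ml.sum_kform_bracket_norm[OF v] ml.bracket_norm_nonneg[of v] ml.bracket_norm_eq_0[OF v] na by linarith
  finally have c: "c < 0" by (simp add: mult_less_0_iff)
  show ?thesis
    unfolding semisimple_def
  proof (intro allI impI, rule ccontr)
    fix I assume I: "lie_ideal br I \<and> solvable br I" "I \<noteq> {0}"
    obtain A where A: "lie_ideal br A" "A \<noteq> {0}" "\<forall>X\<in>A. \<forall>Y\<in>A. br X Y = 0"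
      using abelian_ideal_exists I by blast
    obtain C where C: "A \<subseteq> C" "vec.subspace C" "\<forall>X. \<forall>Y\<in>C. br X Y \<in> C" "\<forall>X\<in>C. \<forall>Y\<in>C. br X Y = 0"
      using complexify_ideal[OF A(1,3)] by blast
    have "C = {0}" by (rule ml.no_abelian_ideal[OF K' c C(2)]) (use C in auto)
    moreover have "0 \<in> A" using A(1) unfolding lie_ideal_def by (auto simp: subspace_0)
    ultimately show False using A(2) C(1) by blast
  qed
qed

end

section \<open>Canonical metrics of semisimple Lie algebras are static\<close>

definition complex_trace :: "(complex ^ 'n \<Rightarrow> complex ^ 'n) \<Rightarrow> complex"
  where "complex_trace f = (\<Sum>i\<in>UNIV. f (axis i 1) $ i)"

lemma complex_trace_cyclic:
  assumes "complex_linear f" "complex_linear g"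
  shows "complex_trace (\<lambda>X. f (g X)) = complex_trace (\<lambda>X. g (f X))"
proof -
  have e: "f (g (axis i 1)) $ i = (\<Sum>j\<in>UNIV. g (axis i 1) $ j * f (axis j 1) $ i)"
    if "complex_linear f" for f g :: "complex ^ 'a \<Rightarrow> complex ^ 'a" and i
  proof -
    have "f (g (axis i 1)) = (\<Sum>j\<in>UNIV. g (axis i 1) $ j *s f (axis j 1))"
      using complex_linear_sum[OF that, of "\<lambda>j. g (axis i 1) $ j *s axis j 1" UNIV] that
      unfolding complex_linear_def by (simp add: basis_expansion)
    then show ?thesis by simp
  qed
  show ?thesis
    unfolding complex_trace_def e[OF assms(1)] e[OF assms(2)]
    by (subst sum.swap) (simp add: mult.commute)
qed

context complex_lie_algebra
begin

definition complex_killing :: "complex ^ 'n \<Rightarrow> complex ^ 'n \<Rightarrow> complex"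
  where "complex_killing X Y = complex_trace (\<lambda>Z. br X (br Y Z))"

lemma complex_linear_ad_ad: "complex_linear (\<lambda>Z. br X (br Y Z))"
  unfolding complex_linear_def by (auto simp: br_add_right br_scale_right)

lemma killing_form_complex: "killing_form br X Y = 2 * Re (complex_killing X Y)"
  unfolding killing_form_def complex_killing_def complex_trace_def
  by (rule real_trace_complex_linear[OF complex_linear_ad_ad])

lemma complex_killing_add: "complex_killing (X + X') Y = complex_killing X Y + complex_killing X' Y"
  unfolding complex_killing_def complex_trace_def by (simp add: br_add_left sum.distrib)

lemma complex_killing_scale: "complex_killing (c *s X) Y = c * complex_killing X Y"
  unfolding complex_killing_def complex_trace_def by (simp add: br_scale_left sum_distrib_left)

lemma complex_killing_sym: "complex_killing X Y = complex_killing Y X"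
  unfolding complex_killing_def by (rule complex_trace_cyclic[OF complex_linear_ad(1) complex_linear_ad(1)])

lemma complex_killing_invariant: "complex_killing (br X Y) Z = complex_killing X (br Y Z)"
proof -
  have 1: "br (br X Y) W = br X (br Y W) - br Y (br X W)" for X Y W
    using ad_derivation[of X Y W] by simp
  have cyc: "complex_trace (\<lambda>W. br Y (br X (br Z W))) = complex_trace (\<lambda>W. br X (br Z (br Y W)))"
    using complex_trace_cyclic[OF complex_linear_ad(1)[of Y] complex_linear_ad_ad[of X Z]] .
  have "complex_killing (br X Y) Z = complex_trace (\<lambda>W. br X (br Y (br Z W))) - complex_trace (\<lambda>W. br Y (br X (br Z W)))"
    unfolding complex_killing_def complex_trace_def 1 by (simp add: sum_subtractf)
  also have "\<dots> = complex_killing X (br Y Z)"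
    unfolding cyc unfolding complex_killing_def complex_trace_def 1 by (simp add: br_diff sum_subtractf)
  finally show ?thesis .
qed

abbreviation B where "B \<equiv> killing_form br"

lemma killing_simps:
  "B (X + Y) Z = B X Z + B Y Z" "B Z (X + Y) = B Z X + B Z Y"
  "B (X - Y) Z = B X Z - B Y Z" "B Z (X - Y) = B Z X - B Z Y"
  "B (- X) Z = - B X Z" "B Z (- X) = - B Z X" "B 0 Z = 0" "B Z 0 = 0"
proof -
  have m: "complex_killing (- X) Y = - complex_killing X Y" for X Y
    using complex_killing_scale[of "-1" X Y] by (simp add: vector_sneg_minus1[symmetric])
  have z: "complex_killing 0 Y = 0" for Y using complex_killing_scale[of 0 0 Y] by simp
  have a: "complex_killing (X - Y) Z = complex_killing X Z - complex_killing Y Z" for X Y Z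
    using complex_killing_add[of X "- Y" Z] by (simp add: m)
  show "B (X + Y) Z = B X Z + B Y Z" "B (X - Y) Z = B X Z - B Y Z" "B (- X) Z = - B X Z" "B 0 Z = 0"
    by (simp_all add: killing_form_complex complex_killing_add m z a)
  show "B Z (X + Y) = B Z X + B Z Y" "B Z (X - Y) = B Z X - B Z Y" "B Z (- X) = - B Z X" "B Z 0 = 0"
    unfolding killing_form_complex complex_killing_sym[of Z] by (simp_all add: complex_killing_add m z a)
qed

lemma killing_sym: "B X Y = B Y X"
  unfolding killing_form_complex using complex_killing_sym by simp

lemma killing_invariant: "B (br X Y) Z = - B Y (br X Z)"
  unfolding killing_form_complex
  using complex_killing_invariant[of Y X Z] br_anti[of X Y] complex_killing_scale[of "-1" "br Y X" Z]
  by (simp add: vector_sneg_minus1[symmetric])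

lemma killing_J: "B (cplx_J X) Y = B X (cplx_J Y)"
  unfolding killing_form_complex complex_killing_sym[of X] by (simp add: complex_killing_scale complex_killing_sym[of X])

end

text \<open>
  A Cartan decomposition \<open>\<gg> = k \<oplus> p\<close> of the real Lie algebra underlying \<open>\<gg>\<close> together with its canonical
  metric; the identity \<open>p = \<i> k\<close> is the content of \<open>J'_eq\<close>.
\<close>

locale canonical_lie_algebra = complex_lie_algebra br
  for br :: "complex ^ 'n \<Rightarrow> complex ^ 'n \<Rightarrow> complex ^ 'n" +
  fixes k p :: "(complex ^ 'n) set" and g :: "(complex ^ 'n) metric"
  assumes cartan: "cartan_decomposition br k p"
    and g_bilinear: "bilinear g"
    and g_k: "\<And>X Y. X \<in> k \<Longrightarrow> Y \<in> k \<Longrightarrow> g X Y = - killing_form br X Y"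
    and g_p: "\<And>X Y. X \<in> p \<Longrightarrow> Y \<in> p \<Longrightarrow> g X Y = killing_form br X Y"
    and g_kp: "\<And>X Y. X \<in> k \<Longrightarrow> Y \<in> p \<Longrightarrow> g X Y = 0 \<and> g Y X = 0"
begin

lemma sub_k: "subspace k" and sub_p: "subspace p" and kp0: "k \<inter> p = {0}"
  and br_kk: "X \<in> k \<Longrightarrow> Y \<in> k \<Longrightarrow> br X Y \<in> k"
  and br_kp: "X \<in> k \<Longrightarrow> Y \<in> p \<Longrightarrow> br X Y \<in> p"
  and br_pp: "X \<in> p \<Longrightarrow> Y \<in> p \<Longrightarrow> br X Y \<in> k"
  and B_k: "X \<in> k \<Longrightarrow> X \<noteq> 0 \<Longrightarrow> B X X < 0"
  and B_p: "X \<in> p \<Longrightarrow> X \<noteq> 0 \<Longrightarrow> B X X > 0"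
  and B_kp: "X \<in> k \<Longrightarrow> Y \<in> p \<Longrightarrow> B X Y = 0"
  using cartan unfolding cartan_decomposition_def by simp_all

lemma br_pk: "X \<in> p \<Longrightarrow> Y \<in> k \<Longrightarrow> br X Y \<in> p"
  using br_kp[of Y X] subspace_neg[OF sub_p, of "br Y X"] br_anti[of X Y] by simp

lemma decompose: "\<exists>Y\<in>k. \<exists>Z\<in>p. X = Y + Z"
proof -
  have "X \<in> {X + Y |X Y. X \<in> k \<and> Y \<in> p}" using cartan unfolding cartan_decomposition_def by simp
  then show ?thesis by blast
qed

lemma decompose_unique:
  assumes "Y \<in> k" "Z \<in> p" "Y' \<in> k" "Z' \<in> p" "Y + Z = Y' + Z'" shows "Y = Y'" "Z = Z'"
proof -
  have "Y - Y' = Z' - Z" using assms(5) by (simp add: algebra_simps)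
  moreover have "Y - Y' \<in> k" "Z' - Z \<in> p" using assms sub_k sub_p by (auto intro: subspace_diff)
  ultimately have "Y - Y' \<in> k \<inter> p" by simp
  then show "Y = Y'" using kp0 by simp
  then show "Z = Z'" using assms(5) by simp
qed

text \<open>
  The Cartan involution.
\<close>

definition \<theta> :: "complex ^ 'n \<Rightarrow> complex ^ 'n"
  where "\<theta> X = (THE W. \<exists>Y\<in>k. \<exists>Z\<in>p. X = Y + Z \<and> W = Y - Z)"

lemma theta: assumes "Y \<in> k" "Z \<in> p" shows "\<theta> (Y + Z) = Y - Z"
  unfolding \<theta>_def using assms decompose_unique by (intro the_equality) blast+

lemma theta_add: "\<theta> (X + X') = \<theta> X + \<theta> X'"
proof -
  obtain Y Z where X: "Y \<in> k" "Z \<in> p" "X = Y + Z" using decompose by blast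
  obtain Y' Z' where X': "Y' \<in> k" "Z' \<in> p" "X' = Y' + Z'" using decompose by blast
  have "\<theta> (X + X') = \<theta> ((Y + Y') + (Z + Z'))" using X X' by (simp add: algebra_simps)
  also have "\<dots> = (Y + Y') - (Z + Z')"
    using X X' sub_k sub_p by (intro theta) (auto intro: subspace_add)
  finally show ?thesis using X X' by (simp add: theta)
qed

lemma theta_minus: "\<theta> (- X) = - \<theta> X"
proof -
  obtain Y Z where X: "Y \<in> k" "Z \<in> p" "X = Y + Z" using decompose by blast
  have "\<theta> (- X) = \<theta> ((- Y) + (- Z))" using X by simp
  also have "\<dots> = (- Y) - (- Z)" using X sub_k sub_p by (intro theta) (auto intro: subspace_neg)
  finally show ?thesis using X by (simp add: theta)
qed

lemma theta_theta: "\<theta> (\<theta> X) = X"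
proof -
  obtain Y Z where X: "Y \<in> k" "Z \<in> p" "X = Y + Z" using decompose by blast
  have "\<theta> (Y + (- Z)) = Y - (- Z)" using X sub_p by (intro theta) (auto intro: subspace_neg)
  then show ?thesis using X by (simp add: theta)
qed

lemma theta_br: "\<theta> (br X X') = br (\<theta> X) (\<theta> X')"
proof -
  obtain Y Z where X: "Y \<in> k" "Z \<in> p" "X = Y + Z" using decompose by blast
  obtain Y' Z' where X': "Y' \<in> k" "Z' \<in> p" "X' = Y' + Z'" using decompose by blast
  have "br X X' = (br Y Y' + br Z Z') + (br Y Z' + br Z Y')"
    using X X' by (simp add: br_add_left br_add_right algebra_simps)
  also have "\<theta> \<dots> = (br Y Y' + br Z Z') - (br Y Z' + br Z Y')"
    using X X' sub_k sub_p by (intro theta) (auto intro: subspace_add br_kk br_kp br_pp br_pk)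
  also have "\<dots> = br (\<theta> X) (\<theta> X')"
    using X X' by (simp add: theta br_diff algebra_simps)
  finally show ?thesis .
qed

lemma B_theta: "B (\<theta> X) (\<theta> X') = B X X'"
proof -
  obtain Y Z where X: "Y \<in> k" "Z \<in> p" "X = Y + Z" using decompose by blast
  obtain Y' Z' where X': "Y' \<in> k" "Z' \<in> p" "X' = Y' + Z'" using decompose by blast
  show ?thesis
    using X X' B_kp[of Y Z'] B_kp[of Y' Z] killing_sym[of Z Y'] by (simp add: theta killing_simps)
qed

lemma g_eq: "g X X' = - B X (\<theta> X')"
proof -
  obtain Y Z where X: "Y \<in> k" "Z \<in> p" "X = Y + Z" using decompose by blast
  obtain Y' Z' where X': "Y' \<in> k" "Z' \<in> p" "X' = Y' + Z'" using decompose by blast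
  have "g X X' = g Y Y' + g Y Z' + (g Z Y' + g Z Z')"
    unfolding X(3) X'(3) bilinear_ladd[OF g_bilinear] bilinear_radd[OF g_bilinear] by simp
  then show ?thesis
    using X X' B_kp[of Y Z'] B_kp[of Y' Z] killing_sym[of Z Y'] g_kp[of Y Z'] g_kp[of Y' Z]
    by (simp add: theta killing_simps g_k g_p)
qed

lemma g_pos: assumes "X \<noteq> 0" shows "g X X > 0"
proof -
  obtain Y Z where X: "Y \<in> k" "Z \<in> p" "X = Y + Z" using decompose by blast
  have "g X X = - B Y Y + B Z Z"
    unfolding g_eq using X B_kp[of Y Z] killing_sym[of Z Y] by (simp add: theta killing_simps)
  moreover have "B Y Y \<le> 0" "B Z Z \<ge> 0" using B_k[OF X(1)] B_p[OF X(2)] by (cases "Y = 0"; cases "Z = 0"; simp add: killing_simps)+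
  moreover have "Y \<noteq> 0 \<or> Z \<noteq> 0" using X assms by auto
  ultimately show ?thesis using B_k[OF X(1)] B_p[OF X(2)] by fastforce
qed

lemma g_sym: "g X Y = g Y X"
  using B_theta[of X "\<theta> Y"] killing_sym[of "\<theta> X" Y] by (simp add: g_eq theta_theta)

lemma centre_zero: assumes "\<And>Y. br Z Y = 0" shows "Z = 0"
proof (rule ccontr)
  assume "Z \<noteq> 0"
  then have "g Z Z > 0" by (rule g_pos)
  moreover have "B Z W = 0" for W
    unfolding killing_form_complex complex_killing_def complex_trace_def assms by simp
  ultimately show False by (simp add: g_eq)
qed

text \<open>
  A second complex structure compatible with the bracket, because \<open>\<theta>\<close> is an automorphism.
  It is also the adjoint of the first one (\<open>g_J\<close>).
\<close>

definition J' where "J' X = \<theta> (cplx_J (\<theta> X))"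

lemma J'_br_left: "br (J' X) Y = J' (br X Y)"
  unfolding J'_def by (simp add: theta_br br_scale_left) (metis theta_br theta_theta br_scale_left)

lemma J'_br_right: "br X (J' Y) = J' (br X Y)"
  unfolding J'_def by (metis theta_br theta_theta br_scale_right)

lemma J'_J': "J' (J' X) = - X"
  unfolding J'_def by (simp add: theta_theta theta_minus)

lemma J'_add: "J' (X + Y) = J' X + J' Y" unfolding J'_def by (simp add: theta_add vector_add_ldistrib)
lemma J'_minus: "J' (- X) = - J' X"
proof -
  have "cplx_J (- Z) = - cplx_J Z" for Z :: "complex ^ 'n" by (simp add: vec_eq_iff)
  then show ?thesis unfolding J'_def by (simp add: theta_minus)
qed

text \<open>
  Both structures commute with the adjoint representation, so on brackets they commute with each
  other; thus their commutator maps into the centre, which is zero.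
\<close>

lemma J'_commutes: "cplx_J (J' X) = J' (cplx_J X)"
proof -
  have "cplx_J (J' X) - J' (cplx_J X) = 0"
  proof (rule centre_zero)
    fix Y
    have "br (cplx_J (J' X)) Y = cplx_J (J' (br X Y))" by (simp add: br_scale_left J'_br_left)
    also have "\<dots> = br (cplx_J X) (J' Y)" by (subst br_scale_left, subst J'_br_right) (rule refl)
    also have "\<dots> = br (J' (cplx_J X)) Y" unfolding J'_br_right J'_br_left ..
    finally show "br (cplx_J (J' X) - J' (cplx_J X)) Y = 0" by (simp add: br_diff)
  qed
  then show ?thesis by simp
qed

lemma g_J: "g (cplx_J X) Y = g X (J' Y)"
  unfolding g_eq J'_def theta_theta by (simp add: killing_J)

text \<open>
  \<open>J J'\<close> is an involution because \<open>J\<close> and \<open>J'\<close> commute, and it is positive because \<open>J'\<close> is the adjoint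
  of \<open>J\<close>.  Hence it is the identity.
\<close>

lemma J'_eq: "J' X = - cplx_J X"
proof -
  let ?C = "\<lambda>X. cplx_J (J' X)"
  \<comment> \<open>\<open>?C\<close> is the positive involution; \<open>Z\<close> below lies in its eigenspace for \<open>-1\<close>.\<close>
  have C2: "?C (?C X) = X" by (simp add: J'_commutes[symmetric] J'_J')
  define Z where "Z = ?C X - X"
  have "?C Z = ?C (?C X) - ?C X"
    unfolding Z_def using J'_add[of "?C X" "- X"] by (simp add: J'_minus vector_add_ldistrib)
  then have "?C Z = - Z" using C2 by (simp add: Z_def)
  then have "g (J' Z) (J' Z) = g (- Z) Z" using g_J[of "J' Z" Z] by simp
  then have "g (J' Z) (J' Z) = - g Z Z" by (simp add: bilinear_lneg[OF g_bilinear])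
  then have "Z = 0" using g_pos[of Z] g_pos[of "J' Z"] bilinear_lzero[OF g_bilinear, of 0] by fastforce
  then have "cplx_J (cplx_J (J' X)) = cplx_J X" by (simp add: Z_def)
  then have "- J' X = cplx_J X" by (simp only: J_J)
  then show ?thesis by (metis minus_minus)
qed

lemma theta_J: "\<theta> (cplx_J X) = - cplx_J (\<theta> X)"
  using J'_eq[of "\<theta> X"] by (simp add: J'_def theta_theta)

lemma g_hermitian: "hermitian_metric g"
proof -
  have "g (cplx_J X) (cplx_J Y) = g X Y" for X Y
    unfolding g_J by (simp add: J'_eq)
  then show ?thesis unfolding hermitian_metric_def using g_bilinear g_sym g_pos by blast
qed

sublocale h: hermitian_inner "herm_of g"
  by (rule herm_of_hermitian_inner[OF g_hermitian])

sublocale ml: metric_lie_algebra br "herm_of g" ..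

lemma g_ad: "g (br X A) Y = - g A (br (\<theta> X) Y)"
  unfolding g_eq killing_invariant by (simp add: theta_br theta_theta)

lemma herm_ad: "herm_of g (br X A) Y = - herm_of g A (br (\<theta> X) Y)"
  by (simp add: herm_of_def g_ad complex_eq_iff flip: br_scale_right)

lemma herm_ad_right: "herm_of g A (br Y C) = - herm_of g (br (\<theta> Y) A) C"
  using herm_ad[of "\<theta> Y" A C] by (simp add: theta_theta)

text \<open>
  The adjoint of \<open>ad X\<close> is \<open>- ad (\<theta> X)\<close>, so the inner product of \<open>ad X\<close> and \<open>ad Y\<close> is a value of the
  Killing form.
\<close>

lemma sum_ad:
  assumes v: "unitary_frame (herm_of g) v"
  shows "Re (\<Sum>p\<in>UNIV. herm_of g (br X (v p)) (br Y (v p))) = g X Y / 2"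
proof -
  have "(\<Sum>p\<in>UNIV. herm_of g (br X (v p)) (br Y (v p)))
      = - (\<Sum>p\<in>UNIV. herm_of g (br (\<theta> Y) (br X (v p))) (v p))"
    by (simp add: herm_ad_right sum_negf)
  moreover have "real_trace (\<lambda>Z. br (\<theta> Y) (br X Z)) = 2 * Re (\<Sum>p\<in>UNIV. herm_of g (br (\<theta> Y) (br X (v p))) (v p))"
    by (rule h.real_trace_frame[OF v complex_linear_ad_ad])
  ultimately show ?thesis
    using killing_sym[of "\<theta> Y" X] by (simp add: g_eq killing_form_def)
qed

text \<open>
  By skewness of the structure constants both sums in \<open>kform\<close> reduce to \<open>sum_ad\<close>, for the frame \<open>v\<close> and
  its image under \<open>\<theta>\<close>: the result is \<open>(1/4 - 1/2) g\<close>.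
\<close>

theorem canonical_static:
  assumes uni: "unimodular br" shows "static_with br g (- 1 / 4)"
  unfolding static_with_def
proof (intro conjI allI)
  show "hermitian_metric g" by (rule g_hermitian)
  fix X Y
  obtain v where v: "unitary_frame (herm_of g) v" using h.frame_exists by blast
  have theta_herm: "herm_of g (\<theta> A) (\<theta> C) = herm_of g C A" for A C
  proof -
    have 1: "g (\<theta> A) (\<theta> C) = g A C" for A C by (simp add: g_eq B_theta)
    have "g (\<theta> A) (cplx_J (\<theta> C)) = - g A (cplx_J C)"
      using 1[of A "cplx_J C"] unfolding theta_J by (simp add: bilinear_rneg[OF g_bilinear])
    then show ?thesis
      using h.cnj_sym[of A C] by (simp add: herm_of_def 1 complex_eq_iff)
  qed
  have w: "unitary_frame (herm_of g) (\<lambda>i. \<theta> (v i))"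
    by (rule h.orthonormal_is_frame) (simp add: theta_herm unitary_frameD(1)[OF v])
  have "(\<Sum>p\<in>UNIV. \<Sum>q\<in>UNIV. herm_of g X (br (v p) (v q)) * herm_of g (br (v p) (v q)) Y)
      = (\<Sum>p\<in>UNIV. herm_of g (br (\<theta> (v p)) X) (br (\<theta> (v p)) Y))"
  proof (rule sum.cong[OF refl])
    fix p
    show "(\<Sum>q\<in>UNIV. herm_of g X (br (v p) (v q)) * herm_of g (br (v p) (v q)) Y)
      = herm_of g (br (\<theta> (v p)) X) (br (\<theta> (v p)) Y)"
      unfolding herm_ad[of "v p" _ Y] herm_ad_right[of X "v p"]
      using h.frame_parseval[OF v, of "br (\<theta> (v p)) X" "br (\<theta> (v p)) Y"] by (simp add: h.cnj_sym)
  qed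
  also have "\<dots> = (\<Sum>p\<in>UNIV. herm_of g (br X (\<theta> (v p))) (br Y (\<theta> (v p))))"
    by (intro sum.cong refl) (simp add: br_anti[of "\<theta> _"] h.minus_left h.minus_right)
  finally have "Re (ml.kform v X Y) = g X Y / 4 - g X Y / 2"
    unfolding ml.kform_def using sum_ad[OF v, of X Y] sum_ad[OF w, of X Y]
    by (simp only: minus_complex.simps Re_divide_numeral mult_1 times_divide_eq_left)
  then show "K_tensor br g X Y = - 1 / 4 * g X Y"
    unfolding K_tensor_eq_kform[OF complex_lie_algebra_axioms uni g_hermitian v] by simp
qed

end

theorem (in complex_lie_algebra) canonical_metric_static:
  assumes "unimodular br" "canonical_metric br g"
  shows "static_with br g (- 1 / 4)"
proof -
  obtain k p where "cartan_decomposition br k p" "bilinear g"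
    "\<forall>X\<in>k. \<forall>Y\<in>k. g X Y = - killing_form br X Y" "\<forall>X\<in>p. \<forall>Y\<in>p. g X Y = killing_form br X Y"
    "\<forall>X\<in>k. \<forall>Y\<in>p. g X Y = 0 \<and> g Y X = 0"
    using assms(2) unfolding canonical_metric_def by blast
  then interpret canonical_lie_algebra br k p g by unfold_locales auto
  show ?thesis by (rule canonical_static[OF assms(1)])
qed

section \<open>Metrics minimizing the norm of the bracket\<close>

context hermitian_inner
begin

text \<open>
  \<open>exp (t D)\<close> for the endomorphism \<open>D\<close> with eigenvalues \<open>d\<close> in the frame \<open>w\<close>.
\<close>

definition flow :: "('n \<Rightarrow> complex ^ 'n) \<Rightarrow> ('n \<Rightarrow> real) \<Rightarrow> real \<Rightarrow> complex ^ 'n \<Rightarrow> complex ^ 'n"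
  where "flow w d t X = (\<Sum>j\<in>UNIV. (complex_of_real (exp (t * d j)) * h X (w j)) *s w j)"

definition diagonal_map :: "('n \<Rightarrow> complex ^ 'n) \<Rightarrow> ('n \<Rightarrow> real) \<Rightarrow> complex ^ 'n \<Rightarrow> complex ^ 'n"
  where "diagonal_map w d X = (\<Sum>j\<in>UNIV. (complex_of_real (d j) * h X (w j)) *s w j)"

lemma flow_add: "flow w d t (X + Y) = flow w d t X + flow w d t Y"
  unfolding flow_def by (simp add: add_left vec_eq_iff sum.distrib algebra_simps)

lemma flow_scale: "flow w d t (c *s X) = c *s flow w d t X"
  unfolding flow_def by (simp add: scale_left vec_eq_iff sum_distrib_left algebra_simps)

lemma complex_linear_flow: "complex_linear (flow w d t)"
  unfolding complex_linear_def by (simp add: flow_add flow_scale)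

lemma complex_linear_diagonal_map: "complex_linear (diagonal_map w d)"
  unfolding complex_linear_def diagonal_map_def
  by (auto simp: add_left scale_left vec_eq_iff sum.distrib sum_distrib_left algebra_simps)

lemma h_flow:
  assumes w: "unitary_frame h w"
  shows "h (flow w d t X) (w k) = complex_of_real (exp (t * d k)) * h X (w k)"
  unfolding flow_def
  by (simp add: sum_left scale_left unitary_frameD(1)[OF w] if_distrib[of "\<lambda>x. _ * x"] cong: if_cong)

lemma h_diagonal_map:
  assumes w: "unitary_frame h w"
  shows "h (diagonal_map w d X) (w k) = complex_of_real (d k) * h X (w k)"
  unfolding diagonal_map_def
  by (simp add: sum_left scale_left unitary_frameD(1)[OF w] if_distrib[of "\<lambda>x. _ * x"] cong: if_cong)

lemma flow_frame:
  assumes w: "unitary_frame h w" shows "flow w d t (w i) = complex_of_real (exp (t * d i)) *s w i"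
  by (rule frame_ext[OF w]) (simp add: h_flow[OF w] scale_left unitary_frameD(1)[OF w])

lemma flow_inverse:
  assumes w: "unitary_frame h w" shows "flow w d t (flow w d (- t) X) = X"
proof (rule frame_ext[OF w])
  fix i
  have "complex_of_real (exp (t * d i)) * complex_of_real (exp (- t * d i)) = 1"
    by (simp flip: of_real_mult exp_add)
  then show "h (flow w d t (flow w d (- t) X)) (w i) = h X (w i)"
    by (simp add: h_flow[OF w] mult.assoc[symmetric])
qed

lemma flow_zero:
  assumes w: "unitary_frame h w" shows "flow w d 0 X = X"
  by (rule frame_ext[OF w]) (simp add: h_flow[OF w])

lemma flow_derivative: "((\<lambda>t. flow w d t X) has_vector_derivative diagonal_map w d X) (at 0)"
proof -
  have "((\<lambda>t. \<Sum>j\<in>UNIV. exp (t * d j) *\<^sub>R (h X (w j) *s w j)) has_vector_derivative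
      (\<Sum>j\<in>UNIV. d j *\<^sub>R (h X (w j) *s w j))) (at 0)"
  proof (rule has_vector_derivative_sum)
    fix j
    have "((\<lambda>t. exp (t * d j)) has_real_derivative d j) (at 0)"
      by (auto intro!: derivative_eq_intros)
    from has_vector_derivative_scaleR[OF this has_vector_derivative_const, of "h X (w j) *s w j"]
    show "((\<lambda>t. exp (t * d j) *\<^sub>R (h X (w j) *s w j)) has_vector_derivative d j *\<^sub>R (h X (w j) *s w j)) (at 0)"
      by simp
  qed
  then show ?thesis
    unfolding flow_def[abs_def] diagonal_map_def by (simp add: scaleR_eq_smult vector_smult_assoc)
qed

definition diag_metric :: "('n \<Rightarrow> complex ^ 'n) \<Rightarrow> ('n \<Rightarrow> real) \<Rightarrow> complex ^ 'n \<Rightarrow> complex ^ 'n \<Rightarrow> complex"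
  where "diag_metric e a X Y = (\<Sum>k\<in>UNIV. complex_of_real (exp (2 * a k)) * (h X (e k) * h (e k) Y))"

lemma hermitian_weighted: "hermitian (\<lambda>X Y. \<Sum>k\<in>UNIV. complex_of_real (c k) * (h X (e k) * h (e k) Y))"
proof
  fix X Y Z s
  let ?f = "\<lambda>X Y. \<Sum>k\<in>UNIV. complex_of_real (c k) * (h X (e k) * h (e k) Y)"
  show "?f (X + Y) Z = ?f X Z + ?f Y Z" by (simp add: add_left sum.distrib algebra_simps)
  show "?f (s *s X) Z = s * ?f X Z" by (simp add: scale_left sum_distrib_left algebra_simps)
  show "cnj (?f X Y) = ?f Y X" by (simp add: cnj_sym mult.commute)
qed

lemma diag_metric_hermitian_inner:
  assumes e: "unitary_frame h e" shows "hermitian_inner (diag_metric e a)"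
proof -
  interpret d: hermitian "diag_metric e a"
    using hermitian_weighted[of "\<lambda>k. exp (2 * a k)" e] unfolding diag_metric_def[abs_def] by simp
  show ?thesis
  proof
    fix X :: "complex ^ 'n" assume "X \<noteq> 0"
    have eq: "diag_metric e a X X = complex_of_real (\<Sum>k\<in>UNIV. exp (2 * a k) * (cmod (h X (e k)))\<^sup>2)"
    proof -
      have "h X (e k) * h (e k) X = complex_of_real ((cmod (h X (e k)))\<^sup>2)" for k
        unfolding complex_norm_square cnj_sym ..
      then show ?thesis unfolding diag_metric_def by simp
    qed
    have "\<exists>k. h X (e k) \<noteq> 0" using frame_ext[OF e, of X 0] \<open>X \<noteq> 0\<close> by auto
    then obtain k where "h X (e k) \<noteq> 0" by blast
    then have "(\<Sum>k\<in>UNIV. exp (2 * a k) * (cmod (h X (e k)))\<^sup>2) > 0"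
      by (intro sum_pos2[of _ k]) auto
    then show "0 < Re (diag_metric e a X X)" unfolding eq by simp
  qed
qed

lemma diag_metric_eigen:
  assumes e: "unitary_frame h e" shows "diag_metric e a (e i) X = complex_of_real (exp (2 * a i)) * h (e i) X"
  unfolding diag_metric_def
  by (simp add: unitary_frameD(1)[OF e] if_distrib[of "\<lambda>x. x * _"] if_distrib[of "\<lambda>x. _ * x"] cong: if_cong)

end

context metric_lie_algebra
begin

lemma bracket_norm_alt:
  assumes v: "unitary_frame h v"
  shows "bracket_norm v = Re (\<Sum>p\<in>UNIV. \<Sum>q\<in>UNIV. h (br (v p) (v q)) (br (v p) (v q)))"
  unfolding bracket_norm_def sc_def by (simp add: frame_parseval_norm[OF v])

lemma double_sum_frame:
  assumes v: "unitary_frame h v" and w: "unitary_frame h w"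
    and s: "\<And>q q'. sesquilinear (\<lambda>A B. s A B q q')" "\<And>p p'. sesquilinear (\<lambda>A B. s p p' A B)"
  shows "(\<Sum>p\<in>UNIV. \<Sum>q\<in>UNIV. s (v p) (v p) (v q) (v q)) = (\<Sum>p\<in>UNIV. \<Sum>q\<in>UNIV. s (w p) (w p) (w q) (w q))"
proof -
  have "(\<Sum>p\<in>UNIV. \<Sum>q\<in>UNIV. s (v p) (v p) (v q) (v q)) = (\<Sum>p\<in>UNIV. \<Sum>q\<in>UNIV. s (v p) (v p) (w q) (w q))"
    by (rule sum.cong[OF refl], rule sum_frame[OF s(2) v w])
  also have "\<dots> = (\<Sum>q\<in>UNIV. \<Sum>p\<in>UNIV. s (v p) (v p) (w q) (w q))" by (rule sum.swap)
  also have "\<dots> = (\<Sum>q\<in>UNIV. \<Sum>p\<in>UNIV. s (w p) (w p) (w q) (w q))"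
    by (rule sum.cong[OF refl], rule sum_frame[OF s(1) v w])
  also have "\<dots> = (\<Sum>p\<in>UNIV. \<Sum>q\<in>UNIV. s (w p) (w p) (w q) (w q))" by (rule sum.swap)
  finally show ?thesis .
qed

lemma bracket_norm_frame:
  assumes v: "unitary_frame h v" and w: "unitary_frame h w"
  shows "bracket_norm v = bracket_norm w"
proof -
  have "(\<Sum>p\<in>UNIV. \<Sum>q\<in>UNIV. h (br (v p) (v q)) (br (v p) (v q))) = (\<Sum>p\<in>UNIV. \<Sum>q\<in>UNIV. h (br (w p) (w q)) (br (w p) (w q)))"
    by (rule double_sum_frame[OF v w, of "\<lambda>A B C D. h (br A C) (br B D)"])
       (simp_all add: sesquilinear_def br_add_left br_add_right br_scale_left br_scale_right add_left add_right scale_left scale_right)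
  then show ?thesis unfolding bracket_norm_alt[OF v] bracket_norm_alt[OF w] by simp
qed

lemma kform_frame:
  assumes v: "unitary_frame h v" and w: "unitary_frame h w"
  shows "kform v X Y = kform w X Y"
proof -
  have "(\<Sum>p\<in>UNIV. \<Sum>q\<in>UNIV. h X (br (v p) (v q)) * h (br (v p) (v q)) Y) = (\<Sum>p\<in>UNIV. \<Sum>q\<in>UNIV. h X (br (w p) (w q)) * h (br (w p) (w q)) Y)"
    by (rule double_sum_frame[OF v w, of "\<lambda>A B C D. h X (br B D) * h (br A C) Y"])
       (simp_all add: sesquilinear_def br_add_left br_add_right br_scale_left br_scale_right add_left add_right scale_left scale_right algebra_simps)
  moreover have "(\<Sum>p\<in>UNIV. h (br X (v p)) (br Y (v p))) = (\<Sum>p\<in>UNIV. h (br X (w p)) (br Y (w p)))"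
    by (rule sum_frame[OF _ v w])
       (simp add: sesquilinear_def br_add_right br_scale_right add_left add_right scale_left scale_right)
  ultimately show ?thesis unfolding kform_def by simp
qed

text \<open>
  The squared norm of the bracket in the metric with eigenvalues \<open>exp (2 * a i)\<close> relative to \<open>h\<close> in the
  frame \<open>e\<close>; see \<open>bracket_norm_rescale\<close>.
\<close>

definition energy :: "('n \<Rightarrow> complex ^ 'n) \<Rightarrow> ('n \<Rightarrow> real) \<Rightarrow> real"
  where "energy e a = (\<Sum>i\<in>UNIV. \<Sum>j\<in>UNIV. \<Sum>k\<in>UNIV. exp (2 * (a k - a i - a j)) * (cmod (sc e i j k))\<^sup>2)"

lemma sc_rescale:
  assumes h': "hermitian_inner h'" and e: "unitary_frame h e"
    and diag: "\<And>i X. h' (e i) X = complex_of_real (exp (2 * a i)) * h (e i) X"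
  shows "metric_lie_algebra.sc br h' (\<lambda>i. complex_of_real (exp (- a i)) *s e i) i j k
    = complex_of_real (exp (a k - a i - a j)) * sc e i j k"
proof -
  interpret h': hermitian_inner h' by fact
  interpret m': metric_lie_algebra br h' ..
  have "h' X (e k) = complex_of_real (exp (2 * a k)) * h X (e k)" for X k
    using arg_cong[OF diag[of k X], of cnj] by (simp add: h'.cnj_sym cnj_sym)
  then have "m'.sc (\<lambda>i. complex_of_real (exp (- a i)) *s e i) i j k
     = complex_of_real (exp (- a i) * exp (- a j) * exp (- a k) * exp (2 * a k)) * sc e i j k"
    unfolding m'.sc_def sc_def
    by (simp add: br_scale_left br_scale_right h'.scale_left h'.scale_right scale_left scale_right mult_ac)
  also have "exp (- a i) * exp (- a j) * exp (- a k) * exp (2 * a k) = exp (a k - a i - a j)"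
    by (simp flip: exp_add)
  finally show ?thesis .
qed

lemma bracket_norm_rescale:
  assumes h': "hermitian_inner h'" and e: "unitary_frame h e"
    and diag: "\<And>i X. h' (e i) X = complex_of_real (exp (2 * a i)) * h (e i) X"
  shows "metric_lie_algebra.bracket_norm br h' (\<lambda>i. complex_of_real (exp (- a i)) *s e i) = energy e a"
proof -
  interpret h': hermitian_inner h' by fact
  interpret m': metric_lie_algebra br h' ..
  have "(exp x)\<^sup>2 = exp (2 * x)" for x :: real by (simp add: exp_double)
  then show ?thesis
    unfolding m'.bracket_norm_def sc_rescale[OF assms] energy_def
    by (simp add: norm_mult power_mult_distrib)
qed

definition cost :: "real \<Rightarrow> real \<Rightarrow> ('n \<Rightarrow> real) \<Rightarrow> real"
  where "cost \<epsilon> \<beta> a = (\<Sum>i\<in>UNIV. 4 * \<epsilon> * (a i)\<^sup>2 + 2 * \<beta> * a i)"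

lemma pullback_hermitian_inner:
  assumes E: "complex_linear E" and inj: "\<And>X. E X = 0 \<Longrightarrow> X = 0"
  shows "hermitian_inner (\<lambda>X Y. h (E X) (E Y))"
proof
  fix X Y Z c
  show "h (E (X + Y)) (E Z) = h (E X) (E Z) + h (E Y) (E Z)" using E by (simp add: complex_linear_def add_left)
  show "h (E (c *s X)) (E Z) = c * h (E X) (E Z)" using E by (simp add: complex_linear_def scale_left)
  show "cnj (h (E X) (E Y)) = h (E Y) (E X)" by (rule cnj_sym)
  show "0 < Re (h (E X) (E X))" if "X \<noteq> 0" using that inj by (intro pos) blast
qed

lemma flow_injective:
  assumes w: "unitary_frame h w" and "flow w d t X = 0" shows "X = 0"
proof -
  have "flow w d (- t) (flow w d t X) = X" using flow_inverse[OF w, of d "- t" X] by simp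
  moreover have "flow w d (- t) 0 = 0" using flow_scale[of w d "- t" 0 0] by simp
  ultimately show ?thesis using assms(2) by simp
qed

lemma bracket_norm_flow:
  assumes w: "unitary_frame h w"
  shows "unitary_frame (\<lambda>X Y. h (flow w d t X) (flow w d t Y)) (\<lambda>i. flow w d (- t) (w i))"
    and "metric_lie_algebra.bracket_norm br (\<lambda>X Y. h (flow w d t X) (flow w d t Y)) (\<lambda>i. flow w d (- t) (w i))
      = energy w (\<lambda>i. t * d i)"
proof -
  interpret ht: hermitian_inner "\<lambda>X Y. h (flow w d t X) (flow w d t Y)"
    by (rule pullback_hermitian_inner[OF complex_linear_flow flow_injective[OF w]])
  interpret mt: metric_lie_algebra br "\<lambda>X Y. h (flow w d t X) (flow w d t Y)" ..
  show fr: "unitary_frame (\<lambda>X Y. h (flow w d t X) (flow w d t Y)) (\<lambda>i. flow w d (- t) (w i))"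
    by (rule ht.orthonormal_is_frame) (simp add: flow_inverse[OF w] unitary_frameD(1)[OF w])
  have "mt.sc (\<lambda>i. flow w d (- t) (w i)) i j k = complex_of_real (exp (t * d k - t * d i - t * d j)) * sc w i j k" for i j k
  proof -
    have "mt.sc (\<lambda>i. flow w d (- t) (w i)) i j k = complex_of_real (exp (- (t * d i)) * exp (- (t * d j)) * exp (t * d k)) * sc w i j k"
      unfolding mt.sc_def sc_def unfolding flow_inverse[OF w] unfolding flow_frame[OF w]
      by (simp add: br_scale_left br_scale_right flow_scale scale_left h_flow[OF w] mult_ac)
    also have "exp (- (t * d i)) * exp (- (t * d j)) * exp (t * d k) = exp (t * d k - t * d i - t * d j)"
      by (simp flip: exp_add)
    finally show ?thesis .
  qed
  moreover have "(exp x)\<^sup>2 = exp (2 * x)" for x :: real by (simp add: exp_double)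
  ultimately show "mt.bracket_norm (\<lambda>i. flow w d (- t) (w i)) = energy w (\<lambda>i. t * d i)"
    unfolding mt.bracket_norm_def energy_def by (simp add: norm_mult power_mult_distrib)
qed

text \<open>
  The Euler equation of \<open>energy + cost\<close> reads \<open>4 K + 8 \<epsilon> A + 2 \<beta> = 0\<close>, where \<open>A\<close> has eigenvalues \<open>a\<close> in the
  frame \<open>e\<close>.  To derive it from \<open>first_variation\<close>, deform the metric by the flow of the endomorphism
  representing the left side \<open>q\<close> itself: the derivative is the sum of the squared eigenvalues of \<open>q\<close>.
\<close>

theorem minimizer_critical:
  assumes e: "unitary_frame h e" and eb: "\<epsilon> \<ge> 0" "\<beta> \<ge> 0"
    and min: "\<And>u b. unitary_frame h u \<Longrightarrow> energy e a + cost \<epsilon> \<beta> a \<le> energy u b + cost \<epsilon> \<beta> b"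
  defines "h' \<equiv> diag_metric e a"
  defines "v \<equiv> \<lambda>i. complex_of_real (exp (- a i)) *s e i"
  shows "metric_lie_algebra.kform br h' v (v i) (v j) = (if i = j then complex_of_real (- (2 * \<epsilon> * a i + \<beta> / 2)) else 0)"
proof -
  interpret h': hermitian_inner h' unfolding h'_def by (rule diag_metric_hermitian_inner[OF e])
  interpret m': metric_lie_algebra br h' ..
  have diag: "h' (e i) X = complex_of_real (exp (2 * a i)) * h (e i) X" for i X
    unfolding h'_def by (rule diag_metric_eigen[OF e])
  have v: "unitary_frame h' v"
    unfolding v_def by (rule frame_scaled[OF hermitian_inner_axioms h'.hermitian_inner_axioms e diag])
  interpret K: hermitian "m'.kform v" by (rule m'.hermitian_kform)
  define A where "A X Y = (\<Sum>k\<in>UNIV. complex_of_real (8 * \<epsilon> * a k + 2 * \<beta>) * (h' X (v k) * h' (v k) Y))" for X Y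
  interpret A: hermitian A unfolding A_def[abs_def] by (rule h'.hermitian_weighted)
  define q where "q X Y = 4 * m'.kform v X Y + A X Y" for X Y
  have "hermitian q"
  proof
    fix X Y Z c
    show "q (X + Y) Z = q X Z + q Y Z" unfolding q_def by (simp add: K.add_left A.add_left algebra_simps)
    show "q (c *s X) Z = c * q X Z" unfolding q_def by (simp add: K.scale_left A.scale_left algebra_simps)
    show "cnj (q X Y) = q Y X" unfolding q_def by (simp only: complex_cnj_add complex_cnj_mult K.cnj_sym A.cnj_sym complex_cnj_numeral)
  qed
  from h'.spectral[OF this] obtain w d where w: "unitary_frame h' w"
    and d: "\<And>i X. q (w i) X = complex_of_real (d i) * h' (w i) X" by metis
  let ?E = "h'.flow w d" and ?D = "h'.diagonal_map w d"
  define F where "F t = m'.energy w (\<lambda>i. t * d i)" for t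
  define F' where "F' = 4 * (\<Sum>i\<in>UNIV. d i * Re (m'.kform v (w i) (w i)))"
  have "(F has_real_derivative (\<Sum>i\<in>UNIV. \<Sum>j\<in>UNIV. \<Sum>k\<in>UNIV. (2 * (d k - d i - d j)) * (cmod (m'.sc w i j k))\<^sup>2)) (at 0)"
    unfolding F_def[abs_def] m'.energy_def
    by (intro DERIV_sum) (auto intro!: derivative_eq_intros)
  also have "(\<Sum>i\<in>UNIV. \<Sum>j\<in>UNIV. \<Sum>k\<in>UNIV. (2 * (d k - d i - d j)) * (cmod (m'.sc w i j k))\<^sup>2) = F'"
    unfolding F'_def m'.kform_frame[OF v w] m'.sum_kform_diagonal[OF w] by (simp add: sum_distrib_left mult.assoc[symmetric] del: right_diff_distrib_numeral)
  finally have F': "(F has_real_derivative F') (at 0)" .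
  have "F' + (\<Sum>i\<in>UNIV. (8 * \<epsilon> * a i + 2 * \<beta>) * Re (h' (?D (v i)) (v i))) = 0"
  proof (rule first_variation[OF hermitian_inner_axioms h'.hermitian_inner_axioms e diag _ eb,
      where E="?E" and D="?D" and F=F])
    show "v = (\<lambda>i. complex_of_real (exp (- a i)) *s e i)" by (simp add: v_def)
    show "?E t (X + Y) = ?E t X + ?E t Y" for t X Y by (rule h'.flow_add)
    show "?E t (c *s X) = c *s ?E t X" for t c X by (rule h'.flow_scale)
    show "?E t (?E (- t) X) = X" for t X by (rule h'.flow_inverse[OF w])
    show "?E 0 X = X" for X by (rule h'.flow_zero[OF w])
    show "((\<lambda>t. ?E t X) has_vector_derivative ?D X) (at 0)" for X by (rule h'.flow_derivative)
    show "(F has_real_derivative F') (at 0)" by (rule F')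
    fix t u b assume u: "unitary_frame h u"
      and ub: "\<And>i X. h' (?E t (u i)) (?E t X) = complex_of_real (exp (2 * b i)) * h (u i) X"
    let ?h = "\<lambda>X Y. h' (?E t X) (?E t Y)"
    interpret ht: hermitian_inner ?h
      by (rule m'.pullback_hermitian_inner[OF h'.complex_linear_flow m'.flow_injective[OF w]])
    interpret mt: metric_lie_algebra br ?h ..
    have "energy u b = mt.bracket_norm (\<lambda>i. complex_of_real (exp (- b i)) *s u i)"
      by (rule bracket_norm_rescale[OF ht.hermitian_inner_axioms u ub, symmetric])
    also have "\<dots> = mt.bracket_norm (\<lambda>i. ?E (- t) (w i))"
      by (rule mt.bracket_norm_frame[OF frame_scaled[OF hermitian_inner_axioms ht.hermitian_inner_axioms u ub] m'.bracket_norm_flow(1)[OF w]])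
    also have "\<dots> = F t" unfolding F_def by (rule m'.bracket_norm_flow(2)[OF w])
    finally have Ft: "energy u b = F t" .
    have "energy e a = m'.bracket_norm v"
      unfolding v_def by (rule bracket_norm_rescale[OF h'.hermitian_inner_axioms e diag, symmetric])
    also have "\<dots> = m'.bracket_norm w" by (rule m'.bracket_norm_frame[OF v w])
    also have "\<dots> = F 0" by (simp add: F_def m'.energy_def m'.bracket_norm_def)
    finally show "F 0 + (\<Sum>i\<in>UNIV. 4 * \<epsilon> * (a i)\<^sup>2 + 2 * \<beta> * a i) \<le> F t + (\<Sum>i\<in>UNIV. 4 * \<epsilon> * (b i)\<^sup>2 + 2 * \<beta> * b i)"
      using min[OF u, of b] Ft by (simp add: cost_def)
  qed
  moreover have "(\<Sum>i\<in>UNIV. (8 * \<epsilon> * a i + 2 * \<beta>) * Re (h' (?D (v i)) (v i))) = (\<Sum>j\<in>UNIV. d j * Re (A (w j) (w j)))"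
  proof -
    have "h' (?D (v i)) (v i) = (\<Sum>j\<in>UNIV. complex_of_real (d j) * (h' (v i) (w j) * h' (w j) (v i)))" for i
      unfolding h'.diagonal_map_def by (simp add: h'.sum_left h'.scale_left mult.assoc)
    then have "(\<Sum>i\<in>UNIV. (8 * \<epsilon> * a i + 2 * \<beta>) * Re (h' (?D (v i)) (v i)))
      = Re (\<Sum>i\<in>UNIV. \<Sum>j\<in>UNIV. complex_of_real (d j) * (complex_of_real (8 * \<epsilon> * a i + 2 * \<beta>) * (h' (w j) (v i) * h' (v i) (w j))))"
      by (simp add: sum_distrib_left algebra_simps)
    also have "\<dots> = (\<Sum>j\<in>UNIV. d j * Re (A (w j) (w j)))"
      unfolding A_def by (subst sum.swap) (simp add: sum_distrib_left)
    finally show ?thesis .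
  qed
  ultimately have "4 * (\<Sum>i\<in>UNIV. d i * Re (m'.kform v (w i) (w i))) + (\<Sum>j\<in>UNIV. d j * Re (A (w j) (w j))) = 0"
    unfolding F'_def by simp
  then have "(\<Sum>i\<in>UNIV. d i * Re (q (w i) (w i))) = 0"
    unfolding q_def by (simp add: sum_distrib_left sum.distrib algebra_simps)
  then have "(\<Sum>i\<in>UNIV. (d i)\<^sup>2) = 0"
    by (simp add: d unitary_frameD(1)[OF w] power2_eq_square)
  then have d0: "d i = 0" for i by (simp add: sum_nonneg_eq_0_iff)
  have "q X Y = 0" for X Y
  proof -
    interpret q: hermitian q by fact
    show ?thesis
      by (subst unitary_frameD(2)[OF w, of X]) (simp add: q.sum_left q.scale_left d d0)
  qed
  then have "4 * m'.kform v (v i) (v j) = - A (v i) (v j)" unfolding q_def by (simp add: eq_neg_iff_add_eq_0)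
  also have "A (v i) (v j) = (if i = j then complex_of_real (8 * \<epsilon> * a i + 2 * \<beta>) else 0)"
    unfolding A_def
    by (simp add: unitary_frameD(1)[OF v] if_distrib[of "\<lambda>x. x * _"] if_distrib[of "\<lambda>x. _ * x"] cong: if_cong)
  finally have f: "4 * m'.kform v (v i) (v j) = - (if i = j then complex_of_real (8 * \<epsilon> * a i + 2 * \<beta>) else 0)" .
  have "- (if i = j then complex_of_real (8 * \<epsilon> * a i + 2 * \<beta>) else 0)
      = 4 * (if i = j then complex_of_real (- (2 * \<epsilon> * a i + \<beta> / 2)) else 0)"
    by (simp add: complex_eq_iff)
  with f have "4 * m'.kform v (v i) (v j) = 4 * (if i = j then complex_of_real (- (2 * \<epsilon> * a i + \<beta> / 2)) else 0)"
    by (rule trans)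
  then show ?thesis by (simp only: mult_cancel_left) simp
qed

end

section \<open>Semisimple Lie algebras admit static metrics\<close>

lemma vec_nth_vec_lambda [simp]: "($) (vec_lambda f) = f"
  by (simp add: fun_eq_iff)

text \<open>
  For a quantity that grows at most linearly in \<open>N\<close>, a coefficient with exponential weight of positive
  limiting rate must vanish in the limit.
\<close>

lemma exponential_decay_limit:
  fixes x :: "nat \<Rightarrow> complex" and w N :: "nat \<Rightarrow> real"
  assumes x: "x \<longlonglongrightarrow> l" and w: "w \<longlonglongrightarrow> w0" "w0 > 0" and N: "filterlim N at_top sequentially"
    and bound: "\<And>n. (cmod (x n))\<^sup>2 * exp (2 * (N n * w n)) \<le> C0 + C1 * N n" and C: "C0 \<ge> 0" "C1 \<ge> 0"
  shows "l = 0"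
proof (rule ccontr)
  assume "l \<noteq> 0"
  define s where "s = (cmod l)\<^sup>2"
  have s: "s > 0" using \<open>l \<noteq> 0\<close> by (simp add: s_def)
  have "(\<lambda>n. (cmod (x n))\<^sup>2) \<longlonglongrightarrow> s" unfolding s_def by (intro tendsto_intros x)
  then have "\<forall>\<^sub>F n in sequentially. s / 2 < (cmod (x n))\<^sup>2" using s by (intro order_tendstoD) auto
  moreover have "\<forall>\<^sub>F n in sequentially. w0 / 2 < w n" using w by (intro order_tendstoD) auto
  moreover have "\<forall>\<^sub>F n in sequentially. max 1 (4 * (C0 + C1) / (s * w0\<^sup>2) + 1) \<le> N n"
    using N unfolding filterlim_at_top by blast
  ultimately have "\<forall>\<^sub>F n in sequentially. False"
  proof eventually_elim
    case (elim n)
    have N1: "N n \<ge> 1" and N2: "N n > 4 * (C0 + C1) / (s * w0\<^sup>2)" using elim(3) by auto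
    have "(N n * w0)\<^sup>2 / 2 \<le> exp (N n * w0)"
      using exp_lower_Taylor_quadratic[of "N n * w0"] N1 w(2) by (smt (verit) mult_nonneg_nonneg)
    also have "\<dots> \<le> exp (2 * (N n * w n))" using elim(2) N1 by simp
    finally have "s / 2 * ((N n * w0)\<^sup>2 / 2) \<le> (cmod (x n))\<^sup>2 * exp (2 * (N n * w n))"
      using elim(1) s by (intro mult_mono) auto
    also have "\<dots> \<le> C0 + C1 * N n" by (rule bound)
    also have "\<dots> \<le> (C0 + C1) * N n"
      using mult_left_mono[OF N1 C(1)] by (simp add: algebra_simps)
    finally have "N n * (N n * (s * w0\<^sup>2)) \<le> N n * (4 * (C0 + C1))" by (simp add: power2_eq_square algebra_simps)
    then have "N n * (s * w0\<^sup>2) \<le> 4 * (C0 + C1)" using N1 by (simp only: mult_le_cancel_left)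
    moreover have "4 * (C0 + C1) < N n * (s * w0\<^sup>2)"
      using N2 s w(2) by (simp add: divide_less_eq)
    ultimately show False by simp
  qed
  then show False by simp
qed

context hermitian_inner
begin

lemma compact_frames: "compact {E :: complex ^ 'n ^ 'n. unitary_frame h (\<lambda>i. E $ i)}" (is "compact ?F")
proof -
  have "unitary_frame h v \<longleftrightarrow> (\<forall>i j. h (v i) (v j) = (if i = j then 1 else 0))" for v
    using orthonormal_is_frame[of v] unitary_frameD(1)[of h v] by blast
  then have eq: "?F = (\<Inter>i. \<Inter>j. {E. h (E $ i) (E $ j) = (if i = j then 1 else 0)})"
    by (simp add: set_eq_iff)
  have "closed ?F"
    unfolding eq by (intro closed_INT ballI closed_Collect_eq continuous_intros)
  moreover have "bounded ?F"
  proof -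
    obtain m where m: "m > 0" "\<And>X. Re (h X X) \<ge> m * (norm X)\<^sup>2" using norm_lower_bound by metis
    have "norm E \<le> CARD('n) * sqrt (1 / m)" if "E \<in> ?F" for E
    proof -
      have "norm (E $ i) \<le> sqrt (1 / m)" for i
      proof (rule real_le_rsqrt)
        have "m * (norm (E $ i))\<^sup>2 \<le> 1"
          using m(2)[of "E $ i"] that unitary_frameD(1)[of h "\<lambda>i. E $ i" i i] by simp
        then show "(norm (E $ i))\<^sup>2 \<le> 1 / m" using m(1) by (simp add: field_simps)
      qed
      then have "(\<Sum>i\<in>UNIV. norm (E $ i)) \<le> (\<Sum>i\<in>(UNIV :: 'n set). sqrt (1 / m))" by (intro sum_mono)
      moreover have "norm E = L2_set (\<lambda>i. norm (E $ i)) UNIV" by (rule norm_vec_def)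
      moreover have "L2_set (\<lambda>i. norm (E $ i)) UNIV \<le> (\<Sum>i\<in>UNIV. norm (E $ i))" by (rule L2_set_le_sum) simp
      ultimately show ?thesis by simp
    qed
    then show ?thesis unfolding bounded_iff by blast
  qed
  ultimately show ?thesis by (simp add: compact_eq_bounded_closed)
qed

end

context metric_lie_algebra
begin

lemma continuous_on_br [continuous_intros]:
  assumes "continuous_on A f" "continuous_on A g" shows "continuous_on A (\<lambda>x. br (f x) (g x))"
proof -
  have "bilinear br"
    unfolding bilinear_def by (auto intro!: linearI simp: br_add_left br_add_right br_scaleR)
  then have "bounded_bilinear br" by (rule bilinear_conv_bounded_bilinear[THEN iffD1])
  from bounded_bilinear.continuous_on[OF this assms] show ?thesis .
qed

lemma continuous_on_sc: "continuous_on UNIV (\<lambda>E. sc (\<lambda>i. E $ i) i j k)"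
  unfolding sc_def by (intro continuous_intros)

lemma continuous_on_energy: "continuous_on UNIV (\<lambda>p. energy (\<lambda>i. fst p $ i) (\<lambda>i. snd p $ i))"
  unfolding energy_def sc_def by (intro continuous_intros)

lemma energy_nonneg: "energy e a \<ge> 0"
  unfolding energy_def by (intro sum_nonneg) auto

text \<open>
  The penalty makes the functional coercive in \<open>b\<close>: each summand of the cost is at least
  \<open>2 \<epsilon> x\<^sup>2 - 1 / (2 \<epsilon>)\<close>.
\<close>

lemma energy_minimizer:
  assumes eps: "\<epsilon> > 0"
  shows "\<exists>E :: complex ^ 'n ^ 'n. \<exists>a :: real ^ 'n. unitary_frame h (\<lambda>i. E $ i) \<and>
    (\<forall>u b. unitary_frame h u \<longrightarrow> energy (\<lambda>i. E $ i) (\<lambda>i. a $ i) + cost \<epsilon> 1 (\<lambda>i. a $ i) \<le> energy u b + cost \<epsilon> 1 b)"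
proof -
  let ?F = "{E :: complex ^ 'n ^ 'n. unitary_frame h (\<lambda>i. E $ i)}"
  let ?V = "\<lambda>p :: (complex ^ 'n ^ 'n) \<times> (real ^ 'n). energy (\<lambda>i. fst p $ i) (\<lambda>i. snd p $ i) + cost \<epsilon> 1 (\<lambda>i. snd p $ i)"
  obtain e0 where e0: "unitary_frame h e0" using frame_exists by blast
  define V0 where "V0 = energy e0 (\<lambda>i. 0)"
  have V0: "V0 \<ge> 0" unfolding V0_def by (rule energy_nonneg)
  \<comment> \<open>Beyond this radius the lower bound of the cost exceeds the value at \<open>a = 0\<close>.\<close>
  define R where "R = sqrt ((V0 + CARD('n) / (2 * \<epsilon>)) / (2 * \<epsilon>))"
  have R0: "R \<ge> 0" unfolding R_def using eps V0 by simp
  have coercive: "V0 < cost \<epsilon> 1 (\<lambda>i. b $ i)" if "norm b > R" for b :: "real ^ 'n"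
  proof -
    have "2 * \<epsilon> * x\<^sup>2 - 1 / (2 * \<epsilon>) \<le> 4 * \<epsilon> * x\<^sup>2 + 2 * x" for x :: real
    proof -
      have "0 \<le> 2 * \<epsilon> * (x + 1 / (2 * \<epsilon>))\<^sup>2" using eps by simp
      also have "\<dots> = 2 * \<epsilon> * x\<^sup>2 + 2 * x + 1 / (2 * \<epsilon>)" using eps by (simp add: power2_eq_square field_simps)
      finally show ?thesis by linarith
    qed
    then have "(\<Sum>i\<in>UNIV. 2 * \<epsilon> * (b $ i)\<^sup>2 - 1 / (2 * \<epsilon>)) \<le> cost \<epsilon> 1 (\<lambda>i. b $ i)"
      unfolding cost_def by (intro sum_mono) simp
    moreover have "(norm b)\<^sup>2 = (\<Sum>i\<in>UNIV. (b $ i)\<^sup>2)"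
      unfolding norm_vec_def L2_set_def by (simp add: sum_nonneg)
    ultimately have 1: "2 * \<epsilon> * (norm b)\<^sup>2 - CARD('n) / (2 * \<epsilon>) \<le> cost \<epsilon> 1 (\<lambda>i. b $ i)"
      by (simp add: sum_subtractf sum_distrib_left)
    have "R\<^sup>2 < (norm b)\<^sup>2" using that R0 by (intro power_strict_mono) auto
    then have 2: "2 * \<epsilon> * R\<^sup>2 < 2 * \<epsilon> * (norm b)\<^sup>2" using eps by simp
    have "R\<^sup>2 = (V0 + CARD('n) / (2 * \<epsilon>)) / (2 * \<epsilon>)" unfolding R_def using eps V0 by simp
    then have 3: "2 * \<epsilon> * R\<^sup>2 = V0 + CARD('n) / (2 * \<epsilon>)" using eps by simp
    show ?thesis using 1 2 3 by linarith
  qed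
  have c: "compact (?F \<times> cball (0 :: real ^ 'n) R)" by (intro compact_Times compact_frames compact_cball)
  have e0F: "(\<chi> i. e0 i, 0) \<in> ?F \<times> cball (0 :: real ^ 'n) R" using e0 R0 by simp
  then have ne: "?F \<times> cball (0 :: real ^ 'n) R \<noteq> {}" by blast
  have "continuous_on UNIV ?V"
    unfolding cost_def by (intro continuous_on_add continuous_on_energy continuous_intros)
  then have "continuous_on (?F \<times> cball 0 R) ?V" by (rule continuous_on_subset) simp
  from continuous_attains_inf[OF c ne this]
  obtain p where p: "p \<in> ?F \<times> cball 0 R" "\<And>q. q \<in> ?F \<times> cball 0 R \<Longrightarrow> ?V p \<le> ?V q" by blast
  have "?V p \<le> energy u b + cost \<epsilon> 1 b" if u: "unitary_frame h u" for u b
  proof (cases "norm (\<chi> i. b i) \<le> R")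
    case True
    then have "(\<chi> i. u i, \<chi> i. b i) \<in> ?F \<times> cball 0 R" using u by simp
    from p(2)[OF this] show ?thesis by simp
  next
    case False
    have "?V p \<le> V0" using p(2)[OF e0F] by (simp add: V0_def cost_def)
    also have "\<dots> < cost \<epsilon> 1 b" using coercive[of "\<chi> i. b i"] False by simp
    finally show ?thesis using energy_nonneg[of u b] by simp
  qed
  then show ?thesis using p(1) by (intro exI[of _ "fst p"] exI[of _ "snd p"]) auto
qed

text \<open>
  The norm of \<open>ad X\<close>, transported to the minimizing metric, does not exceed its norm in \<open>h\<close>: at the
  minimum \<open>K = - 2 \<epsilon> A - 1/2\<close>, and \<open>moment_derivation_inequality\<close> for the derivation \<open>ad X\<close> says that the
  sum of \<open>s e\<^sup>s \<bar>D\<^sub>i\<^sub>k\<bar>\<^sup>2\<close> with \<open>s = 2 (a\<^sub>i - a\<^sub>k)\<close> is at most zero, while \<open>e\<^sup>s - 1 \<le> s e\<^sup>s\<close>.  Geometrically, the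
  nearest point projection onto a sublevel set of a convex function is a contraction.
\<close>

lemma minimizer_ad_bound:
  assumes e: "unitary_frame h e" and eps: "\<epsilon> > 0"
    and min: "\<And>u b. unitary_frame h u \<Longrightarrow> energy e a + cost \<epsilon> 1 a \<le> energy u b + cost \<epsilon> 1 b"
  shows "(\<Sum>i\<in>UNIV. \<Sum>k\<in>UNIV. exp (2 * (a i - a k)) * (cmod (h (br X (e k)) (e i)))\<^sup>2)
    \<le> (\<Sum>i\<in>UNIV. \<Sum>k\<in>UNIV. (cmod (h (br X (e k)) (e i)))\<^sup>2)"
proof -
  let ?h' = "diag_metric e a"
  interpret h': hermitian_inner ?h' by (rule diag_metric_hermitian_inner[OF e])
  interpret m': metric_lie_algebra br ?h' ..
  let ?v = "\<lambda>i. complex_of_real (exp (- a i)) *s e i"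
  have diag: "?h' (e i) X = complex_of_real (exp (2 * a i)) * h (e i) X" for i X
    by (rule diag_metric_eigen[OF e])
  have v: "unitary_frame ?h' ?v"
    by (rule frame_scaled[OF hermitian_inner_axioms h'.hermitian_inner_axioms e diag])
  have crit: "m'.kform ?v (?v i) (?v j) = (if i = j then complex_of_real (- (2 * \<epsilon> * a i + 1 / 2)) else 0)" for i j
    by (rule minimizer_critical[OF e]) (use eps min in auto)
  let ?x = "\<lambda>i k. (cmod (h (br X (e k)) (e i)))\<^sup>2" and ?s = "\<lambda>i k. 2 * (a i - a k)"
  have entry: "(cmod (?h' (br X (?v k)) (?v i)))\<^sup>2 = exp (?s i k) * ?x i k" for i k
  proof -
    have "?h' Y (e i) = complex_of_real (exp (2 * a i)) * h Y (e i)" for Y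
      using arg_cong[OF diag[of i Y], of cnj] by (simp add: h'.cnj_sym cnj_sym)
    then have "?h' (br X (?v k)) (?v i) = complex_of_real (exp (- a k) * exp (- a i) * exp (2 * a i)) * h (br X (e k)) (e i)"
      by (simp add: br_scale_right h'.scale_left h'.scale_right scale_left mult_ac)
    also have "exp (- a k) * exp (- a i) * exp (2 * a i) = exp (a i - a k)" by (simp flip: exp_add)
    finally have "cmod (?h' (br X (?v k)) (?v i)) = exp (a i - a k) * cmod (h (br X (e k)) (e i))"
      by (simp add: norm_mult)
    moreover have "(exp (a i - a k))\<^sup>2 = exp (?s i k)" by (simp only: exp_double)
    ultimately show ?thesis by (simp add: power_mult_distrib)
  qed
  have "0 \<le> (\<Sum>i\<in>UNIV. \<Sum>k\<in>UNIV. (- (2 * \<epsilon> * a i + 1 / 2) - - (2 * \<epsilon> * a k + 1 / 2)) * (cmod (?h' (br X (?v k)) (?v i)))\<^sup>2)"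
    by (rule m'.moment_derivation_inequality[OF v complex_linear_ad(1) ad_derivation crit])
  also have "\<dots> = (\<Sum>i\<in>UNIV. \<Sum>k\<in>UNIV. (- \<epsilon>) * (?s i k * exp (?s i k) * ?x i k))"
    unfolding entry by (intro sum.cong refl) (simp add: algebra_simps)
  also have "\<dots> = (- \<epsilon>) * (\<Sum>i\<in>UNIV. \<Sum>k\<in>UNIV. ?s i k * exp (?s i k) * ?x i k)"
    by (simp only: sum_distrib_left)
  finally have neg: "(\<Sum>i\<in>UNIV. \<Sum>k\<in>UNIV. ?s i k * exp (?s i k) * ?x i k) \<le> 0"
    using eps by (simp add: mult_le_0_iff)
  have "exp (?s i k) * ?x i k - ?x i k \<le> ?s i k * exp (?s i k) * ?x i k" for i k
  proof -
    have "1 + (- ?s i k) \<le> exp (- ?s i k)" by (rule exp_ge_add_one_self)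
    then have "exp (?s i k) * (1 + (- ?s i k)) \<le> exp (?s i k) * exp (- ?s i k)" by (intro mult_left_mono) auto
    then have "exp (?s i k) - 1 \<le> ?s i k * exp (?s i k)" by (simp add: algebra_simps flip: exp_add)
    then have "(exp (?s i k) - 1) * ?x i k \<le> (?s i k * exp (?s i k)) * ?x i k" by (rule mult_right_mono) simp
    then show ?thesis by (simp add: algebra_simps)
  qed
  then have "(\<Sum>i\<in>UNIV. \<Sum>k\<in>UNIV. exp (?s i k) * ?x i k - ?x i k) \<le> (\<Sum>i\<in>UNIV. \<Sum>k\<in>UNIV. ?s i k * exp (?s i k) * ?x i k)"
    by (intro sum_mono)
  then show ?thesis using neg by (simp add: sum_subtractf)
qed

text \<open>
  The vectors with components in negative degrees only form an ideal by \<open>flag\<close>.  By \<open>weight\<close> the bracket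
  adds degrees, and the degrees are bounded, so the ideal is nilpotent.
\<close>

lemma filtration_not_semisimple:
  fixes a :: "'n \<Rightarrow> real"
  assumes e: "unitary_frame h e" and i0: "a i0 < 0"
    and flag: "\<And>X i k. h (br X (e k)) (e i) \<noteq> 0 \<Longrightarrow> a i \<le> a k"
    and weight: "\<And>i j k. sc e i j k \<noteq> 0 \<Longrightarrow> a k \<le> a i + a j"
  shows "\<not> semisimple br"
proof
  assume ss: "semisimple br"
  define V where "V r = {X. \<forall>i. a i > r \<longrightarrow> h X (e i) = 0}" for r
  define \<delta> where "\<delta> = Min ((\<lambda>i. - a i) ` {i. a i < 0})"
  have fin: "finite ((\<lambda>i. - a i) ` {i. a i < 0})" "(\<lambda>i. - a i) ` {i. a i < 0} \<noteq> {}" using i0 by auto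
  have \<delta>: "\<delta> > 0" unfolding \<delta>_def using fin by (subst Min_gr_iff) auto
  have \<delta>_le: "a i \<le> - \<delta>" if "a i < 0" for i
  proof -
    have "\<delta> \<le> - a i" unfolding \<delta>_def by (rule Min_le[OF fin(1)]) (use that in blast)
    then show ?thesis by simp
  qed
  have sub: "subspace (V r)" for r
    unfolding V_def subspace_def by (auto simp: add_left scaleR_left)
  have expand0: "h (br X Y) Z = (\<Sum>i\<in>UNIV. h X (e i) * h (br (e i) Y) Z)" for X Y Z
    by (subst unitary_frameD(2)[OF e, of X]) (simp add: br_sum_left br_scale_left sum_left scale_left)
  have expand1: "h (br X Y) Z = (\<Sum>j\<in>UNIV. h Y (e j) * h (br X (e j)) Z)" for X Y Z
    by (subst unitary_frameD(2)[OF e, of Y]) (simp add: br_sum_right br_scale_right sum_left scale_left)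
  have expand: "h (br X Y) Z = (\<Sum>i\<in>UNIV. \<Sum>j\<in>UNIV. h X (e i) * (h Y (e j) * h (br (e i) (e j)) Z))" for X Y Z
    unfolding expand0[of X Y Z] unfolding expand1[of "e i" Y Z for i] sum_distrib_left ..
  let ?I = "V (- \<delta>)"
  have ideal: "lie_ideal br ?I"
    unfolding lie_ideal_def
  proof (intro conjI sub allI ballI)
    fix X Y assume Y: "Y \<in> ?I"
    have z: "h Y (e j) * h (br X (e j)) (e k) = 0" if "a k > - \<delta>" for j k
      using Y flag[of X j k] that unfolding V_def by force
    have "h (br X Y) (e k) = 0" if "a k > - \<delta>" for k
      by (subst expand1) (simp add: z[OF that])
    then show "br X Y \<in> ?I" unfolding V_def by blast
  qed
  have step: "derived_algebra br (V r) \<subseteq> V (2 * r)" for r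
    unfolding derived_algebra_def
  proof (rule span_minimal[OF _ sub], clarify)
    fix X Y assume X: "X \<in> V r" and Y: "Y \<in> V r"
    have z: "h X (e i) * (h Y (e j) * h (br (e i) (e j)) (e k)) = 0" if "a k > 2 * r" for i j k
      using X Y weight[of i j k] that unfolding V_def sc_def by force
    have "h (br X Y) (e k) = 0" if "a k > 2 * r" for k
      unfolding expand[of X Y] by (simp only: z[OF that] sum.neutral_const)
    then show "br X Y \<in> V (2 * r)" unfolding V_def by blast
  qed
  have mono: "derived_algebra br A \<subseteq> derived_algebra br C" if "A \<subseteq> C" for A C
    unfolding derived_algebra_def by (rule span_mono) (use that in blast)
  have iter: "(derived_algebra br ^^ n) ?I \<subseteq> V (- (2 ^ n * \<delta>))" for n
  proof (induction n)
    case (Suc n)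
    have "(derived_algebra br ^^ Suc n) ?I \<subseteq> derived_algebra br (V (- (2 ^ n * \<delta>)))"
      using mono[OF Suc] by simp
    also have "\<dots> \<subseteq> V (- (2 ^ Suc n * \<delta>))" using step[of "- (2 ^ n * \<delta>)"] by (simp add: mult.assoc)
    finally show ?case .
  qed simp
  define M where "M = Max (range (\<lambda>i. - a i))"
  obtain n where "M / \<delta> < 2 ^ n" using real_arch_pow[of 2 "M / \<delta>"] by auto
  then have "M < 2 ^ n * \<delta>" using \<delta> by (simp add: field_simps)
  moreover have "- a i \<le> M" for i unfolding M_def by (intro Max_ge) auto
  ultimately have "a i > - (2 ^ n * \<delta>)" for i by (smt (verit))
  then have V0: "V (- (2 ^ n * \<delta>)) = {0}"
    unfolding V_def using frame_ext[OF e, of _ 0] by auto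
  have "0 \<in> (derived_algebra br ^^ n) ?I"
    using sub[of "- \<delta>"] by (cases n) (auto simp: subspace_0 derived_algebra_def span_zero)
  then have "solvable br ?I" unfolding solvable_def using iter[of n] V0 by blast
  then have "?I = {0}" using ss ideal unfolding semisimple_def by blast
  moreover have "e i0 \<in> ?I"
    unfolding V_def using \<delta>_le[OF i0] by (auto simp: unitary_frameD(1)[OF e])
  moreover have "e i0 \<noteq> 0" using unitary_frameD(1)[OF e, of i0 i0] by auto
  ultimately show False by blast
qed

text \<open>
  Minimizers for \<open>\<epsilon> > 0\<close> exist; let \<open>\<epsilon>\<close> tend to zero.  If the exponents \<open>a\<close> of the minimizers stay bounded
  along a subsequence, a limit point is a minimizer for \<open>\<epsilon> = 0\<close>.  Otherwise they degenerate in a limiting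
  direction \<open>a / norm a\<close>.  The energy is at most linear in the norm of \<open>a\<close>, which leaves only structure
  constants with \<open>a k \<le> a i + a j\<close> in the limit; by \<open>minimizer_ad_bound\<close> the filtration by eigenvalues
  consists of ideals; and the term \<open>\<beta> \<Sum> a\<close> of the cost keeps the trace of the direction from being
  positive, so that it has a negative eigenvalue.  By \<open>filtration_not_semisimple\<close> this is impossible.
\<close>

theorem semisimple_energy_minimizer:
  assumes ss: "semisimple br"
  shows "\<exists>e a. unitary_frame h e \<and>
    (\<forall>u b. unitary_frame h u \<longrightarrow> energy e a + cost 0 1 a \<le> energy u b + cost 0 1 b)"
proof -
  let ?F = "{E :: complex ^ 'n ^ 'n. unitary_frame h (\<lambda>i. E $ i)}"
  define \<epsilon> where "\<epsilon> n = inverse (real (Suc n))" for n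
  have eps: "\<epsilon> n > 0" for n by (simp add: \<epsilon>_def)
  have eps0: "\<epsilon> \<longlonglongrightarrow> 0" unfolding \<epsilon>_def[abs_def] by (rule LIMSEQ_inverse_real_of_nat)
  have "\<forall>n. \<exists>p :: (complex ^ 'n ^ 'n) \<times> (real ^ 'n). unitary_frame h (\<lambda>i. fst p $ i) \<and>
    (\<forall>u b. unitary_frame h u \<longrightarrow> energy (\<lambda>i. fst p $ i) (\<lambda>i. snd p $ i) + cost (\<epsilon> n) 1 (\<lambda>i. snd p $ i) \<le> energy u b + cost (\<epsilon> n) 1 b)"
    using energy_minimizer[OF eps] by auto
  from choice[OF this] obtain p :: "nat \<Rightarrow> (complex ^ 'n ^ 'n) \<times> (real ^ 'n)"
    where p: "\<And>n. unitary_frame h (\<lambda>i. fst (p n) $ i)"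
      and pmin: "\<And>n u b. unitary_frame h u \<Longrightarrow>
        energy (\<lambda>i. fst (p n) $ i) (\<lambda>i. snd (p n) $ i) + cost (\<epsilon> n) 1 (\<lambda>i. snd (p n) $ i) \<le> energy u b + cost (\<epsilon> n) 1 b"
    by auto
  show ?thesis
  proof (cases "filterlim (\<lambda>n. norm (snd (p n))) at_top sequentially")
    case False
    then obtain Z where "\<not> (\<forall>\<^sub>F n in sequentially. Z \<le> norm (snd (p n)))"
      unfolding filterlim_at_top by blast
    then have inf: "infinite {n. norm (snd (p n)) < Z}"
      unfolding infinite_nat_iff_unbounded_le eventually_sequentially by (auto simp: not_le)
    from infinite_enumerate[OF this] obtain r :: "nat \<Rightarrow> nat" where r: "strict_mono r" "\<And>n. norm (snd (p (r n))) < Z" by auto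
    have c: "compact (?F \<times> cball (0 :: real ^ 'n) Z)" by (intro compact_Times compact_frames compact_cball)
    have "p (r n) \<in> ?F \<times> cball 0 Z" for n using p[of "r n"] r(2)[of n] by (cases "p (r n)") auto
    then have "\<forall>n. p (r n) \<in> ?F \<times> cball 0 Z" by blast
    from seq_compactE[OF compact_imp_seq_compact[OF c] this]
    obtain l r' where l: "l \<in> ?F \<times> cball 0 Z" and r': "strict_mono r'" "((\<lambda>n. p (r n)) \<circ> r') \<longlonglongrightarrow> l"
      by blast
    define s where "s = r \<circ> r'"
    have s: "strict_mono s" unfolding s_def using r(1) r'(1) by (rule strict_mono_o)
    have lim: "(\<lambda>n. p (s n)) \<longlonglongrightarrow> l" using r'(2) by (simp add: s_def o_def)
    have epss: "(\<lambda>n. \<epsilon> (s n)) \<longlonglongrightarrow> 0" using LIMSEQ_subseq_LIMSEQ[OF eps0 s] by (simp add: o_def)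
    have "energy (\<lambda>i. fst l $ i) (\<lambda>i. snd l $ i) + cost 0 1 (\<lambda>i. snd l $ i) \<le> energy u b + cost 0 1 b"
      if u: "unitary_frame h u" for u b
    proof (rule LIMSEQ_le)
      have "(\<lambda>n. energy (\<lambda>i. fst (p (s n)) $ i) (\<lambda>i. snd (p (s n)) $ i)) \<longlonglongrightarrow> energy (\<lambda>i. fst l $ i) (\<lambda>i. snd l $ i)"
        by (rule continuous_on_tendsto_compose[OF continuous_on_energy lim]) auto
      moreover have "(\<lambda>n. cost (\<epsilon> (s n)) 1 (\<lambda>i. snd (p (s n)) $ i)) \<longlonglongrightarrow> cost 0 1 (\<lambda>i. snd l $ i)"
        unfolding cost_def by (intro tendsto_intros epss lim)
      ultimately show "(\<lambda>n. energy (\<lambda>i. fst (p (s n)) $ i) (\<lambda>i. snd (p (s n)) $ i) + cost (\<epsilon> (s n)) 1 (\<lambda>i. snd (p (s n)) $ i))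
        \<longlonglongrightarrow> energy (\<lambda>i. fst l $ i) (\<lambda>i. snd l $ i) + cost 0 1 (\<lambda>i. snd l $ i)"
        by (rule tendsto_add)
      show "(\<lambda>n. energy u b + cost (\<epsilon> (s n)) 1 b) \<longlonglongrightarrow> energy u b + cost 0 1 b"
        unfolding cost_def by (intro tendsto_intros epss)
      show "\<exists>N. \<forall>n\<ge>N. energy (\<lambda>i. fst (p (s n)) $ i) (\<lambda>i. snd (p (s n)) $ i) + cost (\<epsilon> (s n)) 1 (\<lambda>i. snd (p (s n)) $ i)
          \<le> energy u b + cost (\<epsilon> (s n)) 1 b"
        using pmin[OF u] by blast
    qed
    then show ?thesis using l
      by (intro exI[of _ "\<lambda>i. fst l $ i"] exI[of _ "\<lambda>i. snd l $ i"]) auto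
  next
    case True
    define N where "N n = norm (snd (p n))" for n
    define ah where "ah n = (1 / N n) *\<^sub>R snd (p n)" for n
    have aN: "snd (p n) $ i = N n * ah n $ i" for n i
      by (cases "N n = 0") (auto simp: ah_def N_def)
    have c: "compact (?F \<times> cball (0 :: real ^ 'n) 1)" by (intro compact_Times compact_frames compact_cball)
    have "(fst (p n), ah n) \<in> ?F \<times> cball 0 1" for n
      using p[of n] by (auto simp: ah_def N_def)
    then have "\<forall>n. (fst (p n), ah n) \<in> ?F \<times> cball 0 1" by blast
    from seq_compactE[OF compact_imp_seq_compact[OF c] this]
    obtain l s where l: "l \<in> ?F \<times> cball 0 1" and s: "strict_mono s" and lim: "((\<lambda>n. (fst (p n), ah n)) \<circ> s) \<longlonglongrightarrow> l"
      by blast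
    define e where "e i = fst l $ i" for i
    define a where "a i = snd l $ i" for i
    have e: "unitary_frame h e" unfolding e_def[abs_def] using l by auto
    have limE: "(\<lambda>n. fst (p (s n))) \<longlonglongrightarrow> fst l" using tendsto_fst[OF lim] by (simp add: o_def)
    have lima: "(\<lambda>n. ah (s n)) \<longlonglongrightarrow> snd l" using tendsto_snd[OF lim] by (simp add: o_def)
    have lima': "(\<lambda>n. ah (s n) $ i) \<longlonglongrightarrow> a i" for i unfolding a_def by (intro tendsto_intros lima)
    have Ns: "filterlim (\<lambda>n. N (s n)) at_top sequentially"
      using filterlim_compose[OF True filterlim_subseq[OF s]] by (simp add: N_def)
    obtain e0 where e0: "unitary_frame h e0" using frame_exists by blast
    define V0 where "V0 = energy e0 (\<lambda>i. 0)"
    have V0: "V0 \<ge> 0" unfolding V0_def by (rule energy_nonneg)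
    have low: "2 * (N n * (\<Sum>i\<in>UNIV. ah n $ i)) \<le> cost (\<epsilon> n) 1 (\<lambda>i. snd (p n) $ i)" for n
    proof -
      have "(\<Sum>i\<in>UNIV. 2 * snd (p n) $ i) \<le> cost (\<epsilon> n) 1 (\<lambda>i. snd (p n) $ i)"
        unfolding cost_def using eps[of n] by (intro sum_mono) simp
      then show ?thesis by (simp add: aN sum_distrib_left)
    qed
    have total: "energy (\<lambda>i. fst (p n) $ i) (\<lambda>i. snd (p n) $ i) + 2 * (N n * (\<Sum>i\<in>UNIV. ah n $ i)) \<le> V0" for n
      using pmin[OF e0, of n "\<lambda>i. 0"] low[of n] by (simp add: V0_def cost_def)
    have ah1: "\<bar>ah n $ i\<bar> \<le> 1" for n i
    proof -
      have "norm (ah n) \<le> 1" by (simp add: ah_def N_def)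
      then show ?thesis using component_le_norm_cart[of "ah n" i] by linarith
    qed
    have energy_bound: "energy (\<lambda>i. fst (p n) $ i) (\<lambda>i. snd (p n) $ i) \<le> V0 + 2 * CARD('n) * N n" for n
    proof -
      have "- 1 \<le> ah n $ i" for i using ah1[of n i] by linarith
      then have "(\<Sum>i\<in>(UNIV :: 'n set). - 1) \<le> (\<Sum>i\<in>UNIV. ah n $ i)" by (intro sum_mono)
      then have "N n * (- CARD('n)) \<le> N n * (\<Sum>i\<in>UNIV. ah n $ i)"
        by (intro mult_left_mono) (auto simp: N_def)
      then show ?thesis using total[of n] by (simp add: algebra_simps)
    qed
    have weight: "a k \<le> a i + a j" if "sc e i j k \<noteq> 0" for i j k
    proof (rule ccontr)
      assume "\<not> ?thesis"
      then have w: "a k - a i - a j > 0" by simp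
      have bnd: "(cmod (sc (\<lambda>i. fst (p (s n)) $ i) i j k))\<^sup>2 * exp (2 * (N (s n) * (ah (s n) $ k - ah (s n) $ i - ah (s n) $ j)))
          \<le> V0 + 2 * CARD('n) * N (s n)" for n
      proof -
        let ?f = "\<lambda>i j k. exp (2 * (snd (p (s n)) $ k - snd (p (s n)) $ i - snd (p (s n)) $ j)) * (cmod (sc (\<lambda>i. fst (p (s n)) $ i) i j k))\<^sup>2"
        have "?f i j k \<le> (\<Sum>k\<in>UNIV. ?f i j k)" by (rule member_le_sum) auto
        also have "\<dots> \<le> (\<Sum>j\<in>UNIV. \<Sum>k\<in>UNIV. ?f i j k)"
          by (rule member_le_sum[of j UNIV "\<lambda>j. \<Sum>k\<in>UNIV. ?f i j k"]) (auto intro: sum_nonneg)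
        also have "\<dots> \<le> (\<Sum>i\<in>UNIV. \<Sum>j\<in>UNIV. \<Sum>k\<in>UNIV. ?f i j k)"
          by (rule member_le_sum[of i UNIV "\<lambda>i. \<Sum>j\<in>UNIV. \<Sum>k\<in>UNIV. ?f i j k"]) (auto intro!: sum_nonneg)
        also have "\<dots> \<le> V0 + 2 * CARD('n) * N (s n)" using energy_bound[of "s n"] by (simp add: energy_def)
        finally show ?thesis by (simp add: aN algebra_simps)
      qed
      have sc_lim: "(\<lambda>n. sc (\<lambda>i. fst (p (s n)) $ i) i j k) \<longlonglongrightarrow> sc e i j k"
        unfolding e_def by (rule continuous_on_tendsto_compose[OF continuous_on_sc limE]) auto
      have "(\<lambda>n. ah (s n) $ k - ah (s n) $ i - ah (s n) $ j) \<longlonglongrightarrow> a k - a i - a j"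
        by (intro tendsto_intros lima')
      from exponential_decay_limit[OF sc_lim this w Ns bnd] V0 have "sc e i j k = 0" by simp
      then show False using that by simp
    qed
    have flag: "a i \<le> a k" if "h (br X (e k)) (e i) \<noteq> 0" for X i k
    proof (rule ccontr)
      assume "\<not> ?thesis"
      then have w: "a i - a k > 0" by simp
      define C where "C = Re (\<Sum>k\<in>UNIV. h (br X (e0 k)) (br X (e0 k)))"
      have C: "(\<Sum>i\<in>UNIV. \<Sum>k\<in>UNIV. (cmod (h (br X (u k)) (u i)))\<^sup>2) = C" if u: "unitary_frame h u" for u
      proof -
        have "(\<Sum>k\<in>UNIV. h (br X (u k)) (br X (u k))) = (\<Sum>k\<in>UNIV. h (br X (e0 k)) (br X (e0 k)))"
          by (rule sum_frame[OF _ u e0])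
             (simp add: sesquilinear_def br_add_right br_scale_right add_left add_right scale_left scale_right)
        then have "C = Re (\<Sum>k\<in>UNIV. h (br X (u k)) (br X (u k)))" unfolding C_def by (rule arg_cong[OF sym])
        also have "\<dots> = (\<Sum>k\<in>UNIV. Re (h (br X (u k)) (br X (u k))))" by simp
        also have "\<dots> = (\<Sum>k\<in>UNIV. \<Sum>i\<in>UNIV. (cmod (h (br X (u k)) (u i)))\<^sup>2)"
          by (simp add: frame_parseval_norm[OF u])
        finally show ?thesis by (subst sum.swap) simp
      qed
      have C0: "C \<ge> 0" using C[OF e0] by (metis (no_types, lifting) sum_nonneg zero_le_power2)
      have bnd: "(cmod (h (br X (fst (p (s n)) $ k)) (fst (p (s n)) $ i)))\<^sup>2 * exp (2 * (N (s n) * (ah (s n) $ i - ah (s n) $ k)))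
          \<le> C + 0 * N (s n)" for n
      proof -
        let ?f = "\<lambda>i k. exp (2 * (snd (p (s n)) $ i - snd (p (s n)) $ k)) * (cmod (h (br X (fst (p (s n)) $ k)) (fst (p (s n)) $ i)))\<^sup>2"
        have "?f i k \<le> (\<Sum>k\<in>UNIV. ?f i k)" by (rule member_le_sum) auto
        also have "\<dots> \<le> (\<Sum>i\<in>UNIV. \<Sum>k\<in>UNIV. ?f i k)"
          by (rule member_le_sum[of i UNIV "\<lambda>i. \<Sum>k\<in>UNIV. ?f i k"]) (auto intro: sum_nonneg)
        also have "\<dots> \<le> C"
          using minimizer_ad_bound[where e="\<lambda>i. fst (p (s n)) $ i" and a="\<lambda>i. snd (p (s n)) $ i" and \<epsilon>="\<epsilon> (s n)" and X=X,
              OF p eps pmin] C[OF p, of "s n"] by simp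
        finally show ?thesis by (simp add: aN algebra_simps)
      qed
      have h_lim: "(\<lambda>n. h (br X (fst (p (s n)) $ k)) (fst (p (s n)) $ i)) \<longlonglongrightarrow> h (br X (e k)) (e i)"
      proof -
        have "continuous_on UNIV (\<lambda>E :: complex ^ 'n ^ 'n. h (br X (E $ k)) (E $ i))" by (intro continuous_intros)
        from continuous_on_tendsto_compose[OF this limE] show ?thesis by (simp add: e_def)
      qed
      have "(\<lambda>n. ah (s n) $ i - ah (s n) $ k) \<longlonglongrightarrow> a i - a k" by (intro tendsto_intros lima')
      from exponential_decay_limit[OF h_lim this w Ns bnd] C0 have "h (br X (e k)) (e i) = 0" by simp
      then show False using that by simp
    qed
    have sum_le: "(\<Sum>i\<in>UNIV. a i) \<le> 0"
    proof (rule ccontr)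
      assume "\<not> ?thesis"
      then have pos: "(\<Sum>i\<in>UNIV. a i) / 2 < (\<Sum>i\<in>UNIV. a i)" "(\<Sum>i\<in>UNIV. a i) > 0" by auto
      have "(\<lambda>n. \<Sum>i\<in>UNIV. ah (s n) $ i) \<longlonglongrightarrow> (\<Sum>i\<in>UNIV. a i)" by (intro tendsto_intros lima')
      then have "\<forall>\<^sub>F n in sequentially. (\<Sum>i\<in>UNIV. a i) / 2 < (\<Sum>i\<in>UNIV. ah (s n) $ i)"
        using pos(1) by (rule order_tendstoD(1))
      moreover have "\<forall>\<^sub>F n in sequentially. max 1 (V0 / (\<Sum>i\<in>UNIV. a i) + 1) \<le> N (s n)"
        using Ns unfolding filterlim_at_top by blast
      ultimately have "\<forall>\<^sub>F n in sequentially. False"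
      proof eventually_elim
        case (elim n)
        have "V0 / (\<Sum>i\<in>UNIV. a i) < N (s n)" "0 < N (s n)" using elim(2) by auto
        then have "V0 < N (s n) * (\<Sum>i\<in>UNIV. a i)" using pos(2) by (simp add: divide_less_eq)
        also have "\<dots> \<le> N (s n) * (2 * (\<Sum>i\<in>UNIV. ah (s n) $ i))" using elim \<open>0 < N (s n)\<close> by simp
        also have "\<dots> \<le> V0" using total[of "s n"] energy_nonneg[of "\<lambda>i. fst (p (s n)) $ i" "\<lambda>i. snd (p (s n)) $ i"] by simp
        finally show False by simp
      qed
      then show False by simp
    qed
    have norm1: "norm (snd l) = 1"
    proof -
      have n1: "(\<lambda>n. norm (ah (s n))) \<longlonglongrightarrow> norm (snd l)" by (intro tendsto_intros lima)
      have ev:  "\<forall>\<^sub>F n in sequentially. norm (ah (s n)) = 1"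
      proof -
        have "\<forall>\<^sub>F n in sequentially. 1 \<le> N (s n)" using Ns unfolding filterlim_at_top by blast
        then show ?thesis by eventually_elim (auto simp: ah_def N_def)
      qed
      show ?thesis by (rule LIMSEQ_unique[OF n1 tendsto_eventually[OF ev]])
    qed
    have "\<exists>i0. a i0 < 0"
    proof (rule ccontr)
      assume "\<not> ?thesis"
      then have nn: "a i \<ge> 0" for i by (meson not_less)
      then have "(\<Sum>i\<in>UNIV. a i) = 0" using sum_le by (intro antisym sum_nonneg)
      then have "a i = 0" for i using nn by (simp add: sum_nonneg_eq_0_iff)
      then have "snd l = 0" by (simp add: a_def vec_eq_iff)
      then show False using norm1 by simp
    qed
    then obtain i0 where i0: "a i0 < 0" by blast
    have "\<not> semisimple br"
      by (rule filtration_not_semisimple[where e=e and a=a, OF e i0]) (erule flag, erule weight)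
    then show ?thesis using ss by blast
  qed
qed

end

definition standard_hermitian :: "complex ^ 'n \<Rightarrow> complex ^ 'n \<Rightarrow> complex"
  where "standard_hermitian X Y = (\<Sum>i\<in>UNIV. X $ i * cnj (Y $ i))"

lemma standard_hermitian_inner: "hermitian_inner standard_hermitian"
proof
  fix X Y Z :: "complex ^ 'a" and c
  show "standard_hermitian (X + Y) Z = standard_hermitian X Z + standard_hermitian Y Z"
    by (simp add: standard_hermitian_def sum.distrib algebra_simps)
  show "standard_hermitian (c *s X) Z = c * standard_hermitian X Z"
    by (simp add: standard_hermitian_def sum_distrib_left mult.assoc)
  show "cnj (standard_hermitian X Y) = standard_hermitian Y X"
    by (simp add: standard_hermitian_def mult.commute)
  show "0 < Re (standard_hermitian X X)" if nz: "X \<noteq> 0"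
  proof -
    have "standard_hermitian X X = complex_of_real (\<Sum>i\<in>UNIV. (cmod (X $ i))\<^sup>2)"
      unfolding standard_hermitian_def of_real_sum complex_norm_square ..
    moreover obtain i where "X $ i \<noteq> 0" using nz by (auto simp: vec_eq_iff)
    then have "(\<Sum>i\<in>UNIV. (cmod (X $ i))\<^sup>2) > 0" by (intro sum_pos2[of _ i]) auto
    ultimately show ?thesis by simp
  qed
qed

text \<open>
  For \<open>\<epsilon> = 0\<close> the Euler equation \<open>minimizer_critical\<close> says that \<open>K\<close> is a multiple of the metric.
\<close>

theorem (in complex_lie_algebra) semisimple_imp_static:
  assumes uni: "unimodular br" and ss: "semisimple br"
  shows "\<exists>g. static br g"
proof -
  interpret h: hermitian_inner "standard_hermitian :: complex ^ 'n \<Rightarrow> _" by (rule standard_hermitian_inner)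
  interpret m: metric_lie_algebra br "standard_hermitian" ..
  obtain e a where e: "unitary_frame standard_hermitian e"
    and min: "\<And>u b. unitary_frame standard_hermitian u \<Longrightarrow> m.energy e a + m.cost 0 1 a \<le> m.energy u b + m.cost 0 1 b"
    using m.semisimple_energy_minimizer[OF ss] by blast
  let ?h = "h.diag_metric e a"
  define v where "v i = complex_of_real (exp (- a i)) *s e i" for i
  interpret h': hermitian_inner ?h by (rule h.diag_metric_hermitian_inner[OF e])
  interpret m': metric_lie_algebra br ?h ..
  interpret K: hermitian "m'.kform v" by (rule m'.hermitian_kform)
  have v: "unitary_frame ?h v"
    unfolding v_def[abs_def] by (rule frame_scaled[OF h.hermitian_inner_axioms h'.hermitian_inner_axioms e h.diag_metric_eigen[OF e]])
  have crit: "m'.kform v (v i) (v j) = (if i = j then complex_of_real (- (2 * 0 * a i + 1 / 2)) else 0)" for i j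
    unfolding v_def[abs_def] by (rule m.minimizer_critical[OF e _ _ min]) auto
  have K: "m'.kform v X Y = - (1 / 2) * ?h X Y" for X Y
  proof -
    have right: "m'.kform v (v i) Y = - (1 / 2) * cnj (?h Y (v i))" for i
    proof -
      have "m'.kform v (v i) Y = m'.kform v (v i) (\<Sum>j\<in>UNIV. ?h Y (v j) *s v j)"
        by (rule arg_cong[OF unitary_frameD(2)[OF v, of Y]])
      also have "\<dots> = (\<Sum>j\<in>UNIV. cnj (?h Y (v j)) * (if i = j then complex_of_real (- (2 * 0 * a i + 1 / 2)) else 0))"
        by (simp only: K.sum_right K.scale_right crit)
      also have "\<dots> = - (1 / 2) * cnj (?h Y (v i))"
        by (simp add: if_distrib[of "\<lambda>x. _ * x"] cong: if_cong)
      finally show ?thesis .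
    qed
    have "m'.kform v X Y = (\<Sum>i\<in>UNIV. ?h X (v i) * m'.kform v (v i) Y)"
      by (subst unitary_frameD(2)[OF v, of X]) (simp only: K.sum_left K.scale_left)
    also have "\<dots> = - (1 / 2) * (\<Sum>i\<in>UNIV. ?h X (v i) * cnj (?h Y (v i)))"
      unfolding right by (simp add: sum_negf sum_divide_distrib)
    finally show ?thesis unfolding h'.frame_parseval[OF v, of X Y] .
  qed
  let ?g = "\<lambda>X Y. Re (?h X Y)"
  note g = metric_of_hermitian[OF h'.hermitian_inner_axioms]
  have "static_with br ?g (- 1 / 2)"
    unfolding static_with_def
  proof (intro conjI allI)
    show "hermitian_metric ?g" by (rule g(1))
    fix X Y
    have "unitary_frame (herm_of ?g) v" unfolding g(2) by (rule v)
    from K_tensor_eq_kform[OF complex_lie_algebra_axioms uni g(1) this, of X Y]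
    show "K_tensor br ?g X Y = - 1 / 2 * ?g X Y" unfolding g(2) K by simp
  qed
  then show ?thesis unfolding static_def by blast
qed

section \<open>The normal form of algebraic solitons\<close>

context metric_lie_algebra
begin

lemma flow_automorphism:
  assumes w: "unitary_frame h w" and weights: "\<And>i j k. sc w i j k \<noteq> 0 \<Longrightarrow> p k = p i + p j"
  shows "flow w p t (br X Y) = br (flow w p t X) (flow w p t Y)"
proof (rule frame_ext[OF w])
  fix k
  have expand: "h (br A C) (w k) = (\<Sum>i\<in>UNIV. \<Sum>j\<in>UNIV. h A (w i) * (h C (w j) * sc w i j k))" for A C
  proof -
    have right: "h (br Z C) (w k) = (\<Sum>j\<in>UNIV. h C (w j) * h (br Z (w j)) (w k))" for Z
      by (subst unitary_frameD(2)[OF w, of C]) (simp add: br_sum_right br_scale_right sum_left scale_left)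
    have "h (br A C) (w k) = (\<Sum>i\<in>UNIV. h A (w i) * h (br (w i) C) (w k))"
      by (subst unitary_frameD(2)[OF w, of A]) (simp add: br_sum_left br_scale_left sum_left scale_left)
    then show ?thesis unfolding right[of "w i" for i] sum_distrib_left sc_def .
  qed
  have "h (flow w p t (br X Y)) (w k) = (\<Sum>i\<in>UNIV. \<Sum>j\<in>UNIV. complex_of_real (exp (t * p k)) * (h X (w i) * (h Y (w j) * sc w i j k)))"
    unfolding h_flow[OF w] expand sum_distrib_left ..
  also have "\<dots> = (\<Sum>i\<in>UNIV. \<Sum>j\<in>UNIV. h (flow w p t X) (w i) * (h (flow w p t Y) (w j) * sc w i j k))"
  proof (intro sum.cong refl)
    fix i j
    show "complex_of_real (exp (t * p k)) * (h X (w i) * (h Y (w j) * sc w i j k))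
      = h (flow w p t X) (w i) * (h (flow w p t Y) (w j) * sc w i j k)"
    proof (cases "sc w i j k = 0")
      case False
      from weights[OF this] have "exp (t * p k) = exp (t * p i) * exp (t * p j)"
        by (simp add: distrib_left flip: exp_add)
      then show ?thesis by (simp add: h_flow[OF w])
    qed simp
  qed
  also have "\<dots> = h (br (flow w p t X) (flow w p t Y)) (w k)" unfolding expand ..
  finally show "h (flow w p t (br X Y)) (w k) = h (br (flow w p t X) (flow w p t Y)) (w k)" .
qed

lemma kform_sc:
  assumes v: "unitary_frame h v"
  shows "kform v (v i) (v j) = (1/2) * (\<Sum>p\<in>UNIV. \<Sum>q\<in>UNIV. cnj (sc v p q i) * sc v p q j)
     - (\<Sum>p\<in>UNIV. \<Sum>q\<in>UNIV. sc v i p q * cnj (sc v j p q))"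
  unfolding kform_def sc_def frame_parseval[OF v, of "br (v i) (v p)" "br (v j) (v p)" for p] by (simp add: cnj_sym)

text \<open>
  If \<open>K = c + D + D'\<close>, then the pairing of \<open>K\<close> with \<open>[D, D']\<close> is a trace of commutators, hence zero.
  By \<open>moment_commutator\<close> the adjoint \<open>D'\<close> is a derivation as well.
\<close>

lemma adjoint_derivation:
  assumes v: "unitary_frame h v" and D: "complex_linear D" "\<And>X Y. D (br X Y) = br (D X) Y + br X (D Y)"
    and K: "\<And>X Y. kform v X Y = complex_of_real c * h X Y + h (D X) Y + h X (D Y)"
  defines "D' \<equiv> adjoint_map v D"
  shows "D' (br X Y) = br (D' X) Y + br X (D' Y)"
proof -
  have D': "complex_linear D'" unfolding D'_def by (rule complex_linear_adjoint_map)
  note lin = D(1)[unfolded complex_linear_def] D'[unfolded complex_linear_def]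
  have comp: "complex_linear (\<lambda>X. f (g X))" if "complex_linear f" "complex_linear g" for f g :: "complex ^ 'n \<Rightarrow> complex ^ 'n"
    using that unfolding complex_linear_def by simp
  have tr: "(\<Sum>i\<in>UNIV. h (f (v i)) (v i)) = complex_trace f" if "complex_linear f" for f
    unfolding complex_trace_def by (rule trace_frame[OF v that])
  have D_diff: "D (A - C) = D A - D C" for A C using D(1)[unfolded complex_linear_def, THEN conjunct1, rule_format, of "A - C" C] by simp
  have D'_diff: "D' (A - C) = D' A - D' C" for A C using D'[unfolded complex_linear_def, THEN conjunct1, rule_format, of "A - C" C] by simp
  have h_D': "h (D' A) C = h A (D C)" for A C unfolding D'_def by (rule adjoint_map'[OF v D(1)])
  have c1: "complex_trace (\<lambda>X. D (D' X)) = complex_trace (\<lambda>X. D' (D X))"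
    by (rule complex_trace_cyclic[OF D(1) D'])
  have c2: "complex_trace (\<lambda>X. D (D (D' X))) = complex_trace (\<lambda>X. D (D' (D X)))"
    by (rule complex_trace_cyclic[OF D(1) comp[OF D(1) D']])
  have c3: "complex_trace (\<lambda>X. D' (D (D' X))) = complex_trace (\<lambda>X. D' (D' (D X)))"
    using complex_trace_cyclic[OF comp[OF D' D(1)] D'] .
  have "kform v (D (D' (v i)) - D' (D (v i))) (v i)
      = complex_of_real c * (h (D (D' (v i))) (v i) - h (D' (D (v i))) (v i))
        + (h (D (D (D' (v i)))) (v i) - h (D (D' (D (v i)))) (v i))
        + (h (D' (D (D' (v i)))) (v i) - h (D' (D' (D (v i)))) (v i))" for i
    unfolding K D_diff h_D'[symmetric] D'_diff diff_left by (simp add: algebra_simps)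
  then have "(\<Sum>i\<in>UNIV. kform v (D (D' (v i)) - D' (D (v i))) (v i))
      = complex_of_real c * (complex_trace (\<lambda>X. D (D' X)) - complex_trace (\<lambda>X. D' (D X)))
        + (complex_trace (\<lambda>X. D (D (D' X))) - complex_trace (\<lambda>X. D (D' (D X))))
        + (complex_trace (\<lambda>X. D' (D (D' X))) - complex_trace (\<lambda>X. D' (D' (D X))))"
    by (simp only: sum.distrib sum_distrib_left[symmetric] sum_subtractf
        tr[OF comp[OF D(1) D']] tr[OF comp[OF D' D(1)]] tr[OF comp[OF D(1) comp[OF D(1) D']]] tr[OF comp[OF D(1) comp[OF D' D(1)]]]
        tr[OF comp[OF D' comp[OF D(1) D']]] tr[OF comp[OF D' comp[OF D' D(1)]]])
  then have z: "(\<Sum>i\<in>UNIV. kform v (D (D' (v i)) - D' (D (v i))) (v i)) = 0"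
    unfolding c1 c2 c3 by simp
  define nu where "nu X Y = D' (br X Y) - br (D' X) Y - br X (D' Y)" for X Y
  have "(\<Sum>i\<in>UNIV. \<Sum>j\<in>UNIV. h (nu (v i) (v j)) (nu (v i) (v j))) = 0"
    using moment_commutator[OF v D] z unfolding D'_def[symmetric] nu_def by simp
  then have "Re (\<Sum>i\<in>UNIV. \<Sum>j\<in>UNIV. h (nu (v i) (v j)) (nu (v i) (v j))) = 0" by (simp only: zero_complex.sel)
  then have "(\<Sum>i\<in>UNIV. \<Sum>j\<in>UNIV. Re (h (nu (v i) (v j)) (nu (v i) (v j)))) = 0" by simp
  then have "Re (h (nu (v i) (v j)) (nu (v i) (v j))) = 0" for i j
    by (simp add: sum_nonneg_eq_0_iff sum_nonneg nonneg)
  then have nu0: "nu (v i) (v j) = 0" for i j using pos[of "nu (v i) (v j)"] by fastforce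
  have nu1: "complex_linear (\<lambda>X. nu X Z)" "complex_linear (nu Z)" for Z
    unfolding complex_linear_def nu_def using lin
    by (auto simp: br_add_left br_add_right br_scale_left br_scale_right vector_ssub_ldistrib)
  have ext: "f X = 0" if "complex_linear f" "\<And>i. f (v i) = 0" for f :: "complex ^ 'n \<Rightarrow> complex ^ 'n" and X
    using complex_linear_sum[OF that(1), of "\<lambda>i. h X (v i) *s v i" UNIV] that unitary_frameD(2)[OF v, of X]
    unfolding complex_linear_def by simp
  have "nu X Y = 0"
    by (rule ext[OF nu1(1)], rule ext[OF nu1(2)], rule nu0)
  then show ?thesis by (simp add: nu_def algebra_simps)
qed

text \<open>
  The derivation of a soliton may be replaced by the self-adjoint derivation \<open>P = D + D'\<close>, which is
  diagonal in a unitary frame; being a derivation then means that its eigenvalues are additive on the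
  nonzero structure constants.
\<close>

lemma soliton_diagonal:
  assumes v: "unitary_frame h v" and D: "complex_linear D" "\<And>X Y. D (br X Y) = br (D X) Y + br X (D Y)"
    and K: "\<And>X Y. kform v X Y = complex_of_real c * h X Y + h (D X) Y + h X (D Y)"
  shows "\<exists>w p. unitary_frame h w \<and> (\<forall>i j k. sc w i j k \<noteq> 0 \<longrightarrow> p k = p i + p j) \<and>
    (\<forall>i X. kform w X (w i) = complex_of_real (c + p i) * h X (w i))"
proof -
  let ?D' = "adjoint_map v D"
  define P where "P X = D X + ?D' X" for X
  have D': "complex_linear ?D'" by (rule complex_linear_adjoint_map)
  have P: "complex_linear P" using D(1) D' unfolding complex_linear_def P_def by (simp add: vector_add_ldistrib)
  have Pder: "P (br X Y) = br (P X) Y + br X (P Y)" for X Y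
    unfolding P_def adjoint_derivation[OF v D K] D(2) by (simp add: br_add_left br_add_right)
  have Psym: "h (P X) Y = h X (P Y)" for X Y
    by (simp add: P_def add_left add_right adjoint_map[OF v D(1)] adjoint_map'[OF v D(1)])
  have herm: "hermitian (\<lambda>X Y. h (P X) Y)"
  proof
    fix X Y Z a
    show "h (P (X + Y)) Z = h (P X) Z + h (P Y) Z" using P by (simp add: complex_linear_def add_left)
    show "h (P (a *s X)) Z = a * h (P X) Z" using P by (simp add: complex_linear_def scale_left)
    show "cnj (h (P X) Y) = h (P Y) X" unfolding cnj_sym by (rule Psym[symmetric])
  qed
  from spectral[OF this] obtain w p where w: "unitary_frame h w"
    and p: "\<And>i X. h (P (w i)) X = complex_of_real (p i) * h (w i) X" by metis
  have Pw: "P (w i) = complex_of_real (p i) *s w i" for i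
    by (rule frame_ext[OF w]) (simp only: p scale_left)
  have "p k = p i + p j" if "sc w i j k \<noteq> 0" for i j k
  proof -
    have "h (P (br (w i) (w j))) (w k) = complex_of_real (p i + p j) * sc w i j k"
      unfolding Pder Pw sc_def by (simp add: br_scale_left br_scale_right add_left scale_left algebra_simps)
    moreover have "h (P (br (w i) (w j))) (w k) = complex_of_real (p k) * sc w i j k"
      unfolding Psym Pw sc_def by (simp add: scale_right)
    ultimately show ?thesis using that by (simp flip: of_real_add)
  qed
  moreover have "kform w X (w i) = complex_of_real (c + p i) * h X (w i)" for i X
  proof -
    have "kform w X (w i) = complex_of_real c * h X (w i) + h X (P (w i))"
      unfolding kform_frame[OF w v] K P_def add_right adjoint_map[OF v D(1)] by simp
    then show ?thesis unfolding Pw by (simp add: scale_right algebra_simps)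
  qed
  ultimately show ?thesis using w by blast
qed

end

text \<open>
  The derivation \<open>D\<close> of a soliton is only real linear.  Since \<open>K\<close> is invariant under the complex structure, \<open>D\<close>
  may be averaged with \<open>E = - J D J\<close>.  The average is again a derivation: \<open>E - D\<close> is antilinear and
  satisfies \<open>[A X, Y] = [X, A Y]\<close>, so that these brackets vanish.
\<close>

theorem (in complex_lie_algebra) soliton_normal_form:
  assumes uni: "unimodular br" and sol: "algebraic_HCF_soliton br g"
  shows "hermitian_metric g \<and> (\<exists>w p c. unitary_frame (herm_of g) w \<and>
    (\<forall>i j k. metric_lie_algebra.sc br (herm_of g) w i j k \<noteq> 0 \<longrightarrow> p k = p i + p j) \<and>
    (\<forall>i X. metric_lie_algebra.kform br (herm_of g) w X (w i) = complex_of_real (c + p i) * herm_of g X (w i)))"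
proof -
  obtain c D where g: "hermitian_metric g" and D: "derivation br D"
    and K: "\<And>X Y. K_tensor br g X Y = c * g X Y + g (D X) Y + g X (D Y)"
    using sol unfolding algebraic_HCF_soliton_def by blast
  interpret h: hermitian_inner "herm_of g" by (rule herm_of_hermitian_inner[OF g])
  interpret m: metric_lie_algebra br "herm_of g" ..
  obtain v where v: "unitary_frame (herm_of g) v" using h.frame_exists by blast
  interpret K: hermitian "m.kform v" by (rule m.hermitian_kform)
  have D_add: "D (X + Y) = D X + D Y" and D_scaleR: "D (r *\<^sub>R X) = r *\<^sub>R D X"
    and D_br: "D (br X Y) = br (D X) Y + br X (D Y)" for X Y r
    using D unfolding derivation_def by (auto simp: linear_add linear_cmul)
  have D_minus: "D (- X) = - D X" for X using D_scaleR[of "-1" X] by simp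
  define E where "E X = - cplx_J (D (cplx_J X))" for X
  define A where "A X = E X - D X" for X
  have J_minus: "cplx_J (- X) = - cplx_J X" for X :: "complex ^ 'n" by (simp add: vec_eq_iff)
  have E1: "E (br X Y) = br (E X) Y + br X (D Y)" for X Y
  proof -
    have "E (br X Y) = - cplx_J (br (D (cplx_J X)) Y + br (cplx_J X) (D Y))"
      unfolding E_def br_scale_left[symmetric] D_br ..
    then show ?thesis by (simp add: E_def br_scale_left br_minus vector_add_ldistrib)
  qed
  have E2: "E (br X Y) = br (D X) Y + br X (E Y)" for X Y
  proof -
    have "E (br X Y) = - E (br Y X)" unfolding br_anti[of X Y] by (simp add: E_def J_minus D_minus)
    also have "\<dots> = br (D X) Y + br X (E Y)"
      unfolding E1 using br_anti[of "E Y" X] br_anti[of Y "D X"] by simp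
    finally show ?thesis .
  qed
  have A_br: "br (A X) Y = br X (A Y)" for X Y
    unfolding A_def br_diff using E1[of X Y] E2[of X Y] by (simp add: algebra_simps)
  have A_J: "A (cplx_J X) = - cplx_J (A X)" for X
    unfolding A_def E_def by (simp add: D_minus J_minus vector_ssub_ldistrib)
  have A0: "br X (A Y) = 0" for X Y
  proof -
    have "- cplx_J (br (A X) Y) = cplx_J (br X (A Y))"
      using A_br[of "cplx_J X" Y] unfolding A_J br_minus br_scale_left .
    then have "- cplx_J (br X (A Y)) = cplx_J (br X (A Y))" unfolding A_br .
    then show ?thesis by (simp add: vec_eq_iff)
  qed
  define D' where "D' X = (1/2) *\<^sub>R (D X + E X)" for X
  have E_add: "E (X + Y) = E X + E Y" for X Y by (simp add: E_def vector_add_ldistrib D_add)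
  have E_scaleR: "E (r *\<^sub>R X) = r *\<^sub>R E X" for r X by (simp add: E_def J_scaleR D_scaleR)
  have D'_J: "D' (cplx_J X) = cplx_J (D' X)" for X
    unfolding D'_def E_def J_scaleR by (simp add: D_minus J_minus vector_add_ldistrib)
  have D'_scaleR: "D' (r *\<^sub>R X) = r *\<^sub>R D' X" for r X
    unfolding D'_def E_scaleR D_scaleR by (simp add: scaleR_add_right)
  have D'_add: "D' (X + Y) = D' X + D' Y" for X Y
    unfolding D'_def E_add D_add by (simp add: scaleR_add_right algebra_simps)
  have D'lin: "complex_linear D'"
    unfolding complex_linear_def
  proof (intro conjI allI)
    show "D' (X + Y) = D' X + D' Y" for X Y by (rule D'_add)
    show "D' (a *s X) = a *s D' X" for a X
      unfolding smult_split[of a] D'_add D'_scaleR D'_J ..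
  qed
  have D'br: "D' (br X Y) = br (D' X) Y + br X (D' Y)" for X Y
  proof -
    have "br X (E Y) = br X (D Y)" using A0[of X Y] unfolding A_def br_diff by simp
    then have "D (br X Y) + E (br X Y) = br (D X + E X) Y + br X (D Y + E Y)"
      unfolding D_br E1 br_add_left br_add_right by simp
    then show ?thesis unfolding D'_def br_scaleR by (simp add: scaleR_add_right[symmetric])
  qed
  have ReK: "Re (m.kform v X Y) = c * g X Y + g (D X) Y + g X (D Y)" for X Y
    using K_tensor_eq_kform[OF complex_lie_algebra_axioms uni g v, of X Y] K by simp
  have ReK': "Re (m.kform v X Y) = c * g X Y + g (D' X) Y + g X (D' Y)" for X Y
  proof -
    have "Re (m.kform v X Y) = Re (m.kform v (cplx_J X) (cplx_J Y))" by (simp add: K.scale_left K.scale_right)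
    also have "\<dots> = c * g X Y + g (E X) Y + g X (E Y)"
      unfolding ReK metric_J[OF g] E_def
      by (simp add: metric_simps[OF g] metric_J_left[OF g])
    finally have 1: "Re (m.kform v X Y) = c * g X Y + g (E X) Y + g X (E Y)" .
    have "g (D' X) Y = (g (D X) Y + g (E X) Y) / 2" "g X (D' Y) = (g X (D Y) + g X (E Y)) / 2"
      by (simp_all add: D'_def metric_simps[OF g])
    then have "c * g X Y + g (D' X) Y + g X (D' Y)
        = ((c * g X Y + g (D X) Y + g X (D Y)) + (c * g X Y + g (E X) Y + g X (E Y))) / 2"
      by (simp add: field_simps)
    also have "\<dots> = Re (m.kform v X Y)" unfolding ReK[of X Y, symmetric] 1[symmetric] by simp
    finally show ?thesis ..
  qed
  have "m.kform v X Y = complex_of_real c * herm_of g X Y + herm_of g (D' X) Y + herm_of g X (D' Y)" for X Y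
  proof (rule complex_eqI)
    show "Re (m.kform v X Y) = Re (complex_of_real c * herm_of g X Y + herm_of g (D' X) Y + herm_of g X (D' Y))"
      by (simp add: ReK' herm_of_def)
    have "Im (m.kform v X Y) = Re (m.kform v X (cplx_J Y))" by (simp add: K.scale_right)
    also have "\<dots> = Im (complex_of_real c * herm_of g X Y + herm_of g (D' X) Y + herm_of g X (D' Y))"
      unfolding ReK' by (simp add: herm_of_def D'_J)
    finally show "Im (m.kform v X Y) = Im (complex_of_real c * herm_of g X Y + herm_of g (D' X) Y + herm_of g X (D' Y))" .
  qed
  from m.soliton_diagonal[OF v D'lin D'br this] g show ?thesis by blast
qed

section \<open>Uniqueness of algebraic solitons\<close>

context hermitian_inner
begin

lemma diag_metric_unique:
  assumes k: "hermitian k" and u: "unitary_frame h u"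
    and d: "\<And>i X. k (u i) X = complex_of_real (exp (2 * b i)) * h (u i) X"
  shows "diag_metric u b = k"
proof (intro ext)
  fix X Y
  interpret k: hermitian k by fact
  have "k X Y = (\<Sum>i\<in>UNIV. h X (u i) * k (u i) Y)"
    by (subst unitary_frameD(2)[OF u, of X]) (simp only: k.sum_left k.scale_left)
  then show "diag_metric u b X Y = k X Y"
    unfolding diag_metric_def d by (simp add: mult.left_commute)
qed

lemma diag_metric_lower:
  assumes e: "unitary_frame h e" and a: "\<And>i. - R \<le> a i"
  shows "exp (- 2 * R) * Re (h X X) \<le> Re (diag_metric e a X X)"
proof -
  have sq: "h X (e k) * h (e k) X = complex_of_real ((cmod (h X (e k)))\<^sup>2)" for k
    unfolding complex_norm_square cnj_sym ..
  have "Re (diag_metric e a X X) = (\<Sum>k\<in>UNIV. exp (2 * a k) * (cmod (h X (e k)))\<^sup>2)"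
    unfolding diag_metric_def sq by simp
  moreover have "(\<Sum>k\<in>UNIV. exp (- 2 * R) * (cmod (h X (e k)))\<^sup>2) \<le> (\<Sum>k\<in>UNIV. exp (2 * a k) * (cmod (h X (e k)))\<^sup>2)"
    using a by (intro sum_mono mult_right_mono) (auto simp: minus_le_iff)
  ultimately show ?thesis by (simp add: frame_parseval_norm[OF e] sum_distrib_left)
qed

end

context metric_lie_algebra
begin

text \<open>
  The metric with eigenvalues \<open>exp (2 * a i)\<close> in the frame \<open>e\<close> has a unitary frame \<open>v\<close> whose structure
  constants are proportional to \<open>\<sigma>\<close>: up to scale it is the image, under an automorphism, of any metric that
  has a frame with structure constants \<open>\<sigma>\<close>.  The proportionality factor is the quotient of the two norms;
  with denominators cleared the condition is closed.
\<close>

definition admissible ::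
    "('n \<Rightarrow> 'n \<Rightarrow> 'n \<Rightarrow> complex) \<Rightarrow> ('n \<Rightarrow> complex ^ 'n) \<Rightarrow> ('n \<Rightarrow> real) \<Rightarrow> ('n \<Rightarrow> complex ^ 'n) \<Rightarrow> bool"
  where "admissible \<sigma> e a v \<longleftrightarrow> unitary_frame h e \<and> unitary_frame (diag_metric e a) v \<and>
    (\<forall>i j. complex_of_real (sqrt (\<Sum>i\<in>UNIV. \<Sum>j\<in>UNIV. \<Sum>k\<in>UNIV. (cmod (\<sigma> i j k))\<^sup>2)) *s br (v i) (v j)
      = complex_of_real (sqrt (energy e a)) *s (\<Sum>k\<in>UNIV. \<sigma> i j k *s v k))"

text \<open>
  Among the admissible metrics one is nearest to \<open>h\<close>, the distance being the norm of the logarithms of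
  the eigenvalues: on a ball in this distance all the data are bounded.
\<close>

lemma nearest_admissible:
  assumes adm: "admissible \<sigma> e0 a0 v0"
  shows "\<exists>e a v. admissible \<sigma> e a v \<and> (\<forall>u b w. admissible \<sigma> u b w \<longrightarrow> (\<Sum>i\<in>UNIV. (a i)\<^sup>2) \<le> (\<Sum>i\<in>UNIV. (b i)\<^sup>2))"
proof -
  let ?F = "\<lambda>E :: complex ^ 'n ^ 'n. \<lambda>i. E $ i" and ?f = "\<lambda>a :: real ^ 'n. \<lambda>i. a $ i"
  define R where "R = norm (\<chi> i. a0 i)"
  define T where "T = {p :: (complex ^ 'n ^ 'n) \<times> (real ^ 'n) \<times> (complex ^ 'n ^ 'n).
     norm (fst (snd p)) \<le> R \<and> admissible \<sigma> (?F (fst p)) (?f (fst (snd p))) (?F (snd (snd p)))}"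
  have iff: "unitary_frame h v \<longleftrightarrow> (\<forall>i j. h (v i) (v j) = (if i = j then 1 else 0))" for v
    using orthonormal_is_frame[of v] unitary_frameD(1)[of h v] by blast
  have iff': "unitary_frame (diag_metric e a) v \<longleftrightarrow> (\<forall>i j. diag_metric e a (v i) (v j) = (if i = j then 1 else 0))"
    if "unitary_frame h e" for e a v
    using hermitian_inner.orthonormal_is_frame[OF diag_metric_hermitian_inner[OF that, of a], of v]
      unitary_frameD(1)[of "diag_metric e a" v] by blast
  have Teq: "T = {p. norm (fst (snd p)) \<le> R} \<inter> {p. \<forall>i j. h (fst p $ i) (fst p $ j) = (if i = j then 1 else 0)}
    \<inter> {p. \<forall>i j. diag_metric (?F (fst p)) (?f (fst (snd p))) (snd (snd p) $ i) (snd (snd p) $ j) = (if i = j then 1 else 0)}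
    \<inter> {p. \<forall>i j. complex_of_real (sqrt (\<Sum>i\<in>UNIV. \<Sum>j\<in>UNIV. \<Sum>k\<in>UNIV. (cmod (\<sigma> i j k))\<^sup>2)) *s br (snd (snd p) $ i) (snd (snd p) $ j)
      = complex_of_real (sqrt (energy (?F (fst p)) (?f (fst (snd p))))) *s (\<Sum>k\<in>UNIV. \<sigma> i j k *s (snd (snd p) $ k))}"
    unfolding T_def admissible_def using iff iff' by blast
  have cont_smult: "continuous_on UNIV (\<lambda>p. c p *s X p)" if "continuous_on UNIV c" "continuous_on UNIV X"
    for c :: "(complex ^ 'n ^ 'n) \<times> (real ^ 'n) \<times> (complex ^ 'n ^ 'n) \<Rightarrow> complex" and X :: "_ \<Rightarrow> complex ^ 'n"
    unfolding vector_scalar_mult_def using that by (intro continuous_intros)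
  have cont_energy: "continuous_on UNIV (\<lambda>p :: (complex ^ 'n ^ 'n) \<times> (real ^ 'n) \<times> (complex ^ 'n ^ 'n). energy (?F (fst p)) (?f (fst (snd p))))"
    unfolding energy_def sc_def by (intro continuous_intros)
  have closedT: "closed T"
    unfolding Teq diag_metric_def
    by (intro closed_Int closed_Collect_all closed_Collect_eq closed_Collect_le cont_smult continuous_intros cont_energy)
  have bnd: "norm (V $ i) \<le> sqrt (exp (2 * R) / m)"
    if m: "m > 0" "\<And>X. Re (h X X) \<ge> m * (norm X)\<^sup>2" and p: "(E, a, V) \<in> T" for m E a V i
  proof (rule real_le_rsqrt)
    have aR: "- R \<le> a $ i" for i
    proof -
      have "norm a \<le> R" using p by (simp add: T_def)
      then show ?thesis using component_le_norm_cart[of a i] by linarith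
    qed
    have E: "unitary_frame h (?F E)" and V: "unitary_frame (diag_metric (?F E) (?f a)) (?F V)"
      using p by (auto simp: T_def admissible_def)
    have "exp (- 2 * R) * (m * (norm (V $ i))\<^sup>2) \<le> exp (- 2 * R) * Re (h (V $ i) (V $ i))"
      by (intro mult_left_mono m(2)) simp
    also have "\<dots> \<le> 1"
      using diag_metric_lower[where a="?f a", OF E aR, of "V $ i"] unitary_frameD(1)[OF V, of i i] by simp
    finally show "(norm (V $ i))\<^sup>2 \<le> exp (2 * R) / m" using m(1) by (simp add: exp_minus field_simps)
  qed
  have "bounded T"
  proof -
    obtain m where m: "m > 0" "\<And>X. Re (h X X) \<ge> m * (norm X)\<^sup>2" using norm_lower_bound by metis
    let ?B = "{V :: complex ^ 'n ^ 'n. norm V \<le> CARD('n) * sqrt (exp (2 * R) / m)}"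
    have "T \<subseteq> {E. unitary_frame h (?F E)} \<times> cball 0 R \<times> ?B"
    proof
      fix p assume p: "p \<in> T"
      obtain E a V where pe: "p = (E, a, V)" by (cases p) auto
      have "norm V \<le> CARD('n) * sqrt (exp (2 * R) / m)"
      proof -
        have "norm V \<le> (\<Sum>i\<in>UNIV. norm (V $ i))" unfolding norm_vec_def[of V] by (rule L2_set_le_sum) simp
        also have "\<dots> \<le> (\<Sum>i\<in>(UNIV :: 'n set). sqrt (exp (2 * R) / m))"
          using bnd[OF m] p unfolding pe by (intro sum_mono) blast
        finally show ?thesis by simp
      qed
      then show "p \<in> {E. unitary_frame h (?F E)} \<times> cball 0 R \<times> ?B"
        using p unfolding pe by (auto simp: T_def admissible_def)
    qed
    moreover have "bounded ?B" unfolding bounded_iff by blast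
    then have "bounded ({E. unitary_frame h (?F E)} \<times> cball (0 :: real ^ 'n) R \<times> ?B)"
      by (intro bounded_Times compact_imp_bounded[OF compact_frames] bounded_cball)
    ultimately show ?thesis by (rule bounded_subset[rotated])
  qed
  with closedT have cT: "compact T" by (simp add: compact_eq_bounded_closed)
  have in_T: "(\<chi> i. u i, \<chi> i. b i, \<chi> i. w i) \<in> T" if "admissible \<sigma> u b w" "norm (\<chi> i. b i) \<le> R" for u b w
    using that by (simp add: T_def)
  have ne: "T \<noteq> {}" using in_T[OF adm] by (auto simp: R_def)
  have "continuous_on T (\<lambda>p. norm (fst (snd p)))" by (intro continuous_intros)
  from continuous_attains_inf[OF cT ne this] obtain p where p: "p \<in> T"
    and min: "\<And>q. q \<in> T \<Longrightarrow> norm (fst (snd p)) \<le> norm (fst (snd q))" by blast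
  have pR: "norm (fst (snd p)) \<le> R" using p by (simp add: T_def)
  have sq: "(norm x)\<^sup>2 = (\<Sum>i\<in>UNIV. (x $ i)\<^sup>2)" for x :: "real ^ 'n"
    unfolding norm_vec_def L2_set_def by (simp add: sum_nonneg)
  have "norm (fst (snd p)) \<le> norm (\<chi> i. b i)" if "admissible \<sigma> u b w" for u b w
    using min[OF in_T[OF that]] pR by (cases "norm (\<chi> i. b i) \<le> R") auto
  then have "(norm (fst (snd p)))\<^sup>2 \<le> (norm (\<chi> i. b i))\<^sup>2" if "admissible \<sigma> u b w" for u b w
    using that by (intro power_mono) auto
  then have "(\<Sum>i\<in>UNIV. (fst (snd p) $ i)\<^sup>2) \<le> (\<Sum>i\<in>UNIV. (b i)\<^sup>2)" if "admissible \<sigma> u b w" for u b w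
    using that unfolding sq by auto
  moreover have "admissible \<sigma> (?F (fst p)) (?f (fst (snd p))) (?F (snd (snd p)))" using p by (simp add: T_def)
  ultimately show ?thesis
    by (intro exI[of _ "?F (fst p)"] exI[of _ "?f (fst (snd p))"] exI[of _ "?F (snd (snd p))"]) blast
qed

text \<open>
  At the nearest point, \<open>A\<close> with eigenvalues \<open>a\<close> in the frame \<open>e\<close> is orthogonal to every direction \<open>D\<close> tangent to a
  group of automorphisms and scalings, because this group preserves admissibility.
\<close>

lemma nearest_admissible_variation:
  assumes adm: "admissible \<sigma> e a v"
    and min: "\<And>u b w. admissible \<sigma> u b w \<Longrightarrow> (\<Sum>i\<in>UNIV. (a i)\<^sup>2) \<le> (\<Sum>i\<in>UNIV. (b i)\<^sup>2)"
    and E: "\<And>t. complex_linear (E t)" and E_inv: "\<And>t X. E t (E (- t) X) = X" and E_zero: "\<And>X. E 0 X = X"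
    and E_deriv: "\<And>X. ((\<lambda>t. E t X) has_vector_derivative D X) (at 0)"
    and E_br: "\<And>t X Y. E t (br X Y) = complex_of_real (r t) *s br (E t X) (E t Y)" and r: "\<And>t. r t > 0"
  shows "(\<Sum>i\<in>UNIV. a i * Re (h (D (e i)) (e i))) = 0"
proof -
  let ?h' = "diag_metric e a"
  have e: "unitary_frame h e" and v: "unitary_frame ?h' v"
    and proportional: "\<And>i j. complex_of_real (sqrt (\<Sum>i\<in>UNIV. \<Sum>j\<in>UNIV. \<Sum>k\<in>UNIV. (cmod (\<sigma> i j k))\<^sup>2)) *s br (v i) (v j)
      = complex_of_real (sqrt (energy e a)) *s (\<Sum>k\<in>UNIV. \<sigma> i j k *s v k)"
    using adm unfolding admissible_def by blast+
  interpret h': hermitian_inner ?h' by (rule diag_metric_hermitian_inner[OF e])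
  interpret m': metric_lie_algebra br ?h' ..
  have diag: "?h' (e i) X = complex_of_real (exp (2 * a i)) * h (e i) X" for i X by (rule diag_metric_eigen[OF e])
  define w0 where "w0 = (\<lambda>i. complex_of_real (exp (- a i)) *s e i)"
  have w0: "unitary_frame ?h' w0"
    unfolding w0_def by (rule frame_scaled[OF hermitian_inner_axioms h'.hermitian_inner_axioms e diag])
  have E_add: "E t (X + Y) = E t X + E t Y" and E_scale: "E t (c *s X) = c *s E t X" for t X Y c
    using E[of t] unfolding complex_linear_def by auto
  have E_inv': "E (- t) (E t X) = X" for t X using E_inv[of "- t" X] by simp
  have E_inj: "X = 0" if "E t X = 0" for t X
  proof -
    have "E (- t) 0 = 0" using E_scale[of "- t" 0 0] by simp
    then show ?thesis using E_inv'[of t X] that by simp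
  qed
  have "0 + (\<Sum>i\<in>UNIV. (8 * 1 * a i + 2 * 0) * Re (?h' (D (w0 i)) (w0 i))) = 0"
  proof (rule first_variation[OF hermitian_inner_axioms h'.hermitian_inner_axioms e diag w0_def _ _ E_add E_scale E_inv E_zero E_deriv,
      where F="\<lambda>_. 0"])
    show "((\<lambda>_. 0) has_real_derivative 0) (at (0 :: real))" by simp
    fix t u b assume u: "unitary_frame h u"
      and ub: "\<And>i X. ?h' (E t (u i)) (E t X) = complex_of_real (exp (2 * b i)) * h (u i) X"
    let ?ht = "\<lambda>X Y. ?h' (E t X) (E t Y)"
    interpret ht: hermitian_inner ?ht by (rule m'.pullback_hermitian_inner[OF E E_inj])
    interpret mt: metric_lie_algebra br ?ht ..
    let ?w = "\<lambda>i. E (- t) (v i)"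
    have w: "unitary_frame ?ht ?w"
      by (rule ht.orthonormal_is_frame) (simp add: E_inv unitary_frameD(1)[OF v])
    have "mt.sc ?w i j k = complex_of_real (r t) * m'.sc v i j k" for i j k
      unfolding mt.sc_def m'.sc_def by (simp add: E_br E_inv h'.scale_left)
    then have "mt.bracket_norm ?w = (r t)\<^sup>2 * m'.bracket_norm v"
      unfolding mt.bracket_norm_def m'.bracket_norm_def using r[of t]
      by (simp add: norm_mult power_mult_distrib sum_distrib_left)
    also have "m'.bracket_norm v = m'.bracket_norm w0" by (rule m'.bracket_norm_frame[OF v w0])
    also have "\<dots> = energy e a" unfolding w0_def by (rule bracket_norm_rescale[OF h'.hermitian_inner_axioms e diag])
    also have "mt.bracket_norm ?w = mt.bracket_norm (\<lambda>i. complex_of_real (exp (- b i)) *s u i)"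
      by (rule mt.bracket_norm_frame[OF w frame_scaled[OF hermitian_inner_axioms ht.hermitian_inner_axioms u ub]])
    also have "\<dots> = energy u b" by (rule bracket_norm_rescale[OF ht.hermitian_inner_axioms u ub])
    finally have "sqrt (energy u b) = r t * sqrt (energy e a)" using r[of t] by (simp add: real_sqrt_mult)
    then have en: "complex_of_real (sqrt (energy u b)) = complex_of_real (r t) * complex_of_real (sqrt (energy e a))"
      by (simp only: of_real_mult)
    have "admissible \<sigma> u b ?w"
      unfolding admissible_def
    proof (intro conjI allI u)
      show "unitary_frame (diag_metric u b) ?w"
        unfolding diag_metric_unique[OF ht.hermitian_axioms u ub] by (rule w)
      fix i j
      let ?c = "complex_of_real (sqrt (\<Sum>i\<in>UNIV. \<Sum>j\<in>UNIV. \<Sum>k\<in>UNIV. (cmod (\<sigma> i j k))\<^sup>2))"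
      have "E t (?c *s br (?w i) (?w j)) = complex_of_real (r t) *s (?c *s br (v i) (v j))"
        by (simp add: E_scale E_br E_inv vector_smult_assoc mult.commute)
      also have "\<dots> = complex_of_real (sqrt (energy u b)) *s (\<Sum>k\<in>UNIV. \<sigma> i j k *s v k)"
        unfolding proportional en by (simp add: vector_smult_assoc)
      also have "\<dots> = E t (complex_of_real (sqrt (energy u b)) *s (\<Sum>k\<in>UNIV. \<sigma> i j k *s ?w k))"
        by (simp add: E_scale complex_linear_sum[OF E] E_inv)
      finally have "E (- t) (E t (?c *s br (?w i) (?w j))) = E (- t) (E t (complex_of_real (sqrt (energy u b)) *s (\<Sum>k\<in>UNIV. \<sigma> i j k *s ?w k)))"
        by (rule arg_cong)
      then show "?c *s br (?w i) (?w j) = complex_of_real (sqrt (energy u b)) *s (\<Sum>k\<in>UNIV. \<sigma> i j k *s ?w k)"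
        unfolding E_inv' .
    qed
    from min[OF this] show "0 + (\<Sum>i\<in>UNIV. 4 * 1 * (a i)\<^sup>2 + 2 * 0 * a i) \<le> 0 + (\<Sum>i\<in>UNIV. 4 * 1 * (b i)\<^sup>2 + 2 * 0 * b i)"
      by (simp flip: sum_distrib_left)
  qed simp_all
  moreover have "Re (?h' (D (w0 i)) (w0 i)) = Re (h (D (e i)) (e i))" for i
  proof -
    have D_scale: "D (c *s X) = c *s D X" for c X
    proof (rule vector_derivative_unique_at[OF E_deriv])
      show "((\<lambda>t. E t (c *s X)) has_vector_derivative c *s D X) (at 0)"
        unfolding E_scale by (rule bounded_linear.has_vector_derivative[OF bounded_linear_vector_scalar_mult E_deriv])
    qed
    have "?h' X (e i) = complex_of_real (exp (2 * a i)) * h X (e i)" for X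
      using arg_cong[OF diag[of i X], of cnj] by (simp add: h'.cnj_sym cnj_sym)
    then have "?h' (D (w0 i)) (w0 i) = complex_of_real (exp (- a i) * exp (- a i) * exp (2 * a i)) * h (D (e i)) (e i)"
      unfolding w0_def by (simp add: D_scale h'.scale_left h'.scale_right scale_left mult_ac)
    also have "exp (- a i) * exp (- a i) * exp (2 * a i) = 1" by (simp flip: exp_add)
    finally show ?thesis by simp
  qed
  ultimately have "8 * (\<Sum>i\<in>UNIV. a i * Re (h (D (e i)) (e i))) = 0" by (simp add: sum_distrib_left mult.assoc)
  then show ?thesis by simp
qed

end

context metric_lie_algebra
begin

lemma flow_scaling:
  assumes e: "unitary_frame h e"
  shows "flow e (\<lambda>_. 1) t X = complex_of_real (exp t) *s X"
  by (rule frame_ext[OF e]) (simp add: h_flow[OF e] scale_left)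

lemma diagonal_kform:
  assumes v: "unitary_frame h v" and w: "unitary_frame h w"
    and K: "\<And>i X. kform w X (w i) = complex_of_real (c + p i) * h X (w i)"
  shows "(\<Sum>i\<in>UNIV. a i * Re (kform v (v i) (v i)))
    = c * (\<Sum>i\<in>UNIV. a i) + (\<Sum>i\<in>UNIV. a i * Re (h (diagonal_map w p (v i)) (v i)))"
proof -
  interpret K: hermitian "kform w" by (rule hermitian_kform)
  have "kform w X X = complex_of_real c * h X X + h (diagonal_map w p X) X" for X
  proof -
    have "kform w X X = kform w X (\<Sum>j\<in>UNIV. h X (w j) *s w j)"
      by (rule arg_cong[OF unitary_frameD(2)[OF w, of X]])
    also have "\<dots> = (\<Sum>j\<in>UNIV. complex_of_real (c + p j) * (h X (w j) * cnj (h X (w j))))"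
      by (simp only: K.sum_right K.scale_right K mult_ac)
    also have "\<dots> = complex_of_real c * (\<Sum>j\<in>UNIV. h X (w j) * cnj (h X (w j))) + (\<Sum>j\<in>UNIV. complex_of_real (p j) * (h X (w j) * cnj (h X (w j))))"
      by (simp add: sum.distrib sum_distrib_left algebra_simps)
    also have "\<dots> = complex_of_real c * h X X + h (diagonal_map w p X) X"
      unfolding diagonal_map_def frame_parseval[OF w, of X X]
      by (simp add: sum_left scale_left cnj_sym mult.assoc)
    finally show ?thesis .
  qed
  then show ?thesis
    unfolding kform_frame[OF v w]
    by (simp add: unitary_frameD(1)[OF v] sum.distrib sum_distrib_left algebra_simps)
qed

text \<open>
  Replace \<open>h2\<close> by the metric nearest to \<open>h\<close> in its orbit under automorphisms and scalings, with eigenvalues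
  \<open>exp (2 * a i)\<close>.  Then \<open>A\<close> is orthogonal to the identity and to the derivations of both solitons, hence to
  both tensors \<open>K\<close>.  So the derivative of the squared norm of the bracket along the geodesic
  joining the two metrics vanishes at both ends (\<open>S1\<close>, \<open>S2\<close>).  This function is a sum of
  exponentials, hence convex, so it is constant, and only structure constants of weight zero occur.  That
  means that \<open>A\<close> is a derivation.  But then \<open>A\<close> is orthogonal to itself, and \<open>A = 0\<close>.
\<close>

theorem soliton_frames_equivalent:
  assumes h2: "hermitian_inner h2"
    and w: "unitary_frame h w" and w_weights: "\<And>i j k. sc w i j k \<noteq> 0 \<Longrightarrow> p k = p i + p j"
    and w_K: "\<And>i X. kform w X (w i) = complex_of_real (c + p i) * h X (w i)"
    and w2: "unitary_frame h2 w2"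
    and w2_weights: "\<And>i j k. metric_lie_algebra.sc br h2 w2 i j k \<noteq> 0 \<Longrightarrow> p2 k = p2 i + p2 j"
    and w2_K: "\<And>i X. metric_lie_algebra.kform br h2 w2 X (w2 i) = complex_of_real (c2 + p2 i) * h2 X (w2 i)"
  shows "\<exists>v s. unitary_frame h v \<and> s > 0 \<and>
    (\<forall>i j k. sc v i j k = complex_of_real s * metric_lie_algebra.sc br h2 w2 i j k)"
proof -
  interpret h2: hermitian_inner h2 by fact
  interpret m2: metric_lie_algebra br h2 ..
  define \<sigma> where "\<sigma> = m2.sc w2"
  have sum_\<sigma>: "(\<Sum>i\<in>UNIV. \<Sum>j\<in>UNIV. \<Sum>k\<in>UNIV. (cmod (\<sigma> i j k))\<^sup>2) = m2.bracket_norm w2"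
    by (simp add: \<sigma>_def m2.bracket_norm_def)
  let ?N = "complex_of_real (sqrt (m2.bracket_norm w2))"
  obtain e0 d where e0: "unitary_frame h e0" and d: "\<And>i X. h2 (e0 i) X = complex_of_real (d i) * h (e0 i) X"
    using spectral[OF h2.hermitian_axioms] by metis
  have dpos: "d i > 0" for i
  proof -
    have "e0 i \<noteq> 0" using unitary_frameD(1)[OF e0, of i i] by auto
    from h2.pos[OF this] show ?thesis using d[of i "e0 i"] unitary_frameD(1)[OF e0, of i i] by simp
  qed
  have d': "h2 (e0 i) X = complex_of_real (exp (2 * (ln (d i) / 2))) * h (e0 i) X" for i X
    using d dpos by simp
  have "energy e0 (\<lambda>i. ln (d i) / 2) = m2.bracket_norm (\<lambda>i. complex_of_real (exp (- (ln (d i) / 2))) *s e0 i)"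
    by (rule bracket_norm_rescale[OF h2 e0 d', symmetric])
  also have "\<dots> = m2.bracket_norm w2"
    by (rule m2.bracket_norm_frame[OF frame_scaled[OF hermitian_inner_axioms h2 e0 d'] w2])
  finally have en0: "energy e0 (\<lambda>i. ln (d i) / 2) = m2.bracket_norm w2" .
  have "admissible \<sigma> e0 (\<lambda>i. ln (d i) / 2) w2"
    unfolding admissible_def sum_\<sigma> en0
  proof (intro conjI allI e0)
    show "unitary_frame (diag_metric e0 (\<lambda>i. ln (d i) / 2)) w2"
      unfolding diag_metric_unique[OF h2.hermitian_axioms e0 d'] by (rule w2)
    show "?N *s br (w2 i) (w2 j) = ?N *s (\<Sum>k\<in>UNIV. \<sigma> i j k *s w2 k)" for i j
      using unitary_frameD(2)[OF w2, of "br (w2 i) (w2 j)"] by (simp add: \<sigma>_def m2.sc_def)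
  qed
  from nearest_admissible[OF this] obtain e a v where adm: "admissible \<sigma> e a v"
    and min: "\<And>u b w. admissible \<sigma> u b w \<Longrightarrow> (\<Sum>i\<in>UNIV. (a i)\<^sup>2) \<le> (\<Sum>i\<in>UNIV. (b i)\<^sup>2)" by blast
  let ?h' = "diag_metric e a"
  have e: "unitary_frame h e" and v: "unitary_frame ?h' v"
    and proportional: "\<And>i j. ?N *s br (v i) (v j) = complex_of_real (sqrt (energy e a)) *s (\<Sum>k\<in>UNIV. \<sigma> i j k *s v k)"
    using adm unfolding admissible_def sum_\<sigma> by blast+
  interpret h': hermitian_inner ?h' by (rule diag_metric_hermitian_inner[OF e])
  interpret m': metric_lie_algebra br ?h' ..
  have diag: "?h' (e i) X = complex_of_real (exp (2 * a i)) * h (e i) X" for i X by (rule diag_metric_eigen[OF e])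
  define w0 where "w0 = (\<lambda>i. complex_of_real (exp (- a i)) *s e i)"
  have w0: "unitary_frame ?h' w0"
    unfolding w0_def by (rule frame_scaled[OF hermitian_inner_axioms h'.hermitian_inner_axioms e diag])
  have en: "energy e a = m'.bracket_norm w0"
    unfolding w0_def by (rule bracket_norm_rescale[OF h'.hermitian_inner_axioms e diag, symmetric])
  have "\<exists>s>0. \<forall>i j k. m'.sc v i j k = complex_of_real s * \<sigma> i j k"
  proof (cases "abelian br")
    case True
    then have "m'.sc v i j k = complex_of_real 1 * \<sigma> i j k" for i j k
      by (simp add: abelian_def m'.sc_def \<sigma>_def m2.sc_def)
    then show ?thesis by (intro exI[of _ 1]) simp
  next
    case False
    have n2: "m2.bracket_norm w2 > 0"
      using m2.bracket_norm_eq_0[OF w2] m2.bracket_norm_nonneg[of w2] False by linarith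
    have n1: "energy e a > 0"
      unfolding en using m'.bracket_norm_eq_0[OF w0] m'.bracket_norm_nonneg[of w0] False by linarith
    have "m'.sc v i j k = complex_of_real (sqrt (energy e a) / sqrt (m2.bracket_norm w2)) * \<sigma> i j k" for i j k
    proof -
      have "?N * m'.sc v i j k = ?h' (?N *s br (v i) (v j)) (v k)" by (simp add: m'.sc_def h'.scale_left)
      also have "\<dots> = complex_of_real (sqrt (energy e a)) * \<sigma> i j k"
        unfolding proportional
        by (simp add: h'.scale_left h'.sum_left unitary_frameD(1)[OF v] if_distrib[of "\<lambda>x. _ * x"] cong: if_cong)
      finally show ?thesis using n2 by (simp add: field_simps)
    qed
    then show ?thesis using n1 n2 by (intro exI[of _ "sqrt (energy e a) / sqrt (m2.bracket_norm w2)"]) simp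
  qed
  then obtain s where s: "s > 0" and sc_v: "\<And>i j k. m'.sc v i j k = complex_of_real s * \<sigma> i j k" by blast
  have v_weights: "p2 k = p2 i + p2 j" if "m'.sc v i j k \<noteq> 0" for i j k
    using that w2_weights[of i j k] unfolding sc_v \<sigma>_def by simp
  have v_K: "m'.kform v X (v i) = complex_of_real (s\<^sup>2 * c2 + s\<^sup>2 * p2 i) * ?h' X (v i)" for i X
  proof -
    interpret K: hermitian "m'.kform v" by (rule m'.hermitian_kform)
    have "m'.kform v (v j) (v i) = complex_of_real (s\<^sup>2) * m2.kform w2 (w2 j) (w2 i)" for j
      unfolding m'.kform_sc[OF v] m2.kform_sc[OF w2] sc_v \<sigma>_def
      by (simp add: sum_distrib_left right_diff_distrib power2_eq_square mult_ac)
    then have kv: "m'.kform v (v j) (v i) = (if j = i then complex_of_real (s\<^sup>2 * c2 + s\<^sup>2 * p2 i) else 0)" for j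
      by (simp add: w2_K unitary_frameD(1)[OF w2] algebra_simps)
    show ?thesis
      by (subst (1) unitary_frameD(2)[OF v, of X])
         (simp only: K.sum_left K.scale_left kv, simp add: if_distrib[of "\<lambda>x. _ * x"] mult.commute cong: if_cong)
  qed
  note variation = nearest_admissible_variation[OF adm min]
  \<comment> \<open>Scalings multiply the bracket by a factor, which admissibility allows.\<close>
  have tr0: "(\<Sum>i\<in>UNIV. a i) = 0"
  proof -
    have "(\<Sum>i\<in>UNIV. a i * Re (h (diagonal_map e (\<lambda>_. 1) (e i)) (e i))) = 0"
    proof (rule variation[where E="flow e (\<lambda>_. 1)" and r="\<lambda>t. exp (- t)"])
      show "flow e (\<lambda>_. 1) t (br X Y) = complex_of_real (exp (- t)) *s br (flow e (\<lambda>_. 1) t X) (flow e (\<lambda>_. 1) t Y)" for t X Y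
      proof -
        have "complex_of_real (exp t) = complex_of_real (exp (- t)) * (complex_of_real (exp t) * complex_of_real (exp t))"
          by (simp flip: of_real_mult exp_add)
        then show ?thesis
          unfolding flow_scaling[OF e] br_scale_left br_scale_right vector_smult_assoc by simp
      qed
    qed (simp_all add: complex_linear_flow flow_inverse[OF e] flow_zero[OF e] flow_derivative)
    then show ?thesis by (simp add: h_diagonal_map[OF e] unitary_frameD(1)[OF e])
  qed
  have tr1: "(\<Sum>i\<in>UNIV. a i * Re (h (diagonal_map w p (e i)) (e i))) = 0"
    by (rule variation[where E="flow w p" and r="\<lambda>t. 1"])
       (simp_all add: complex_linear_flow flow_inverse[OF w] flow_zero[OF w] flow_derivative flow_automorphism[OF w w_weights])
  have tr2: "(\<Sum>i\<in>UNIV. a i * Re (h (h'.diagonal_map v p2 (e i)) (e i))) = 0"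
    by (rule variation[where E="h'.flow v p2" and r="\<lambda>t. 1"])
       (simp_all add: h'.complex_linear_flow h'.flow_inverse[OF v] h'.flow_zero[OF v] h'.flow_derivative m'.flow_automorphism[OF v v_weights])
  let ?w = "\<lambda>i j k. a k - a i - a j" and ?C = "\<lambda>i j k. (cmod (sc e i j k))\<^sup>2"
  have "(\<Sum>i\<in>UNIV. a i * Re (kform e (e i) (e i))) = 0"
    unfolding diagonal_kform[OF e w w_K] tr0 tr1 by simp
  then have S1: "(\<Sum>i\<in>UNIV. \<Sum>j\<in>UNIV. \<Sum>k\<in>UNIV. ?w i j k * ?C i j k) = 0"
    unfolding sum_kform_diagonal[OF e] by simp
  have "(\<Sum>i\<in>UNIV. a i * Re (m'.kform w0 (w0 i) (w0 i))) = 0"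
  proof -
    have "Re (?h' (h'.diagonal_map v p2 (w0 i)) (w0 i)) = Re (h (h'.diagonal_map v p2 (e i)) (e i))" for i
    proof -
      have lin: "h'.diagonal_map v p2 (c *s X) = c *s h'.diagonal_map v p2 X" for c X
        using h'.complex_linear_diagonal_map unfolding complex_linear_def by blast
      have "?h' X (e i) = complex_of_real (exp (2 * a i)) * h X (e i)" for X
        using arg_cong[OF diag[of i X], of cnj] by (simp add: h'.cnj_sym cnj_sym)
      then have "?h' (h'.diagonal_map v p2 (w0 i)) (w0 i)
          = complex_of_real (exp (- a i) * exp (- a i) * exp (2 * a i)) * h (h'.diagonal_map v p2 (e i)) (e i)"
        unfolding w0_def by (simp add: lin h'.scale_left h'.scale_right scale_left mult_ac)
      also have "exp (- a i) * exp (- a i) * exp (2 * a i) = 1" by (simp flip: exp_add)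
      finally show ?thesis by simp
    qed
    moreover have "h'.diagonal_map v (\<lambda>i. s\<^sup>2 * p2 i) X = complex_of_real (s\<^sup>2) *s h'.diagonal_map v p2 X" for X
      unfolding h'.diagonal_map_def by (simp add: vec_eq_iff sum_distrib_left mult_ac)
    ultimately show ?thesis
      unfolding m'.diagonal_kform[OF w0 v v_K] tr0 using tr2
      by (simp add: h'.scale_left mult.left_commute[of _ "s\<^sup>2"] flip: sum_distrib_left of_real_power)
  qed
  then have "(\<Sum>i\<in>UNIV. \<Sum>j\<in>UNIV. \<Sum>k\<in>UNIV. ?w i j k * (cmod (m'.sc w0 i j k))\<^sup>2) = 0"
    unfolding m'.sum_kform_diagonal[OF w0] by simp
  moreover have "(cmod (m'.sc w0 i j k))\<^sup>2 = exp (2 * ?w i j k) * ?C i j k" for i j k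
  proof -
    have "(exp x)\<^sup>2 = exp (2 * x)" for x :: real by (simp add: exp_double)
    then show ?thesis
      unfolding w0_def sc_rescale[OF h'.hermitian_inner_axioms e diag] by (simp add: norm_mult power_mult_distrib)
  qed
  ultimately have S2: "(\<Sum>i\<in>UNIV. \<Sum>j\<in>UNIV. \<Sum>k\<in>UNIV. ?w i j k * (exp (2 * ?w i j k) * ?C i j k)) = 0" by simp
  have total: "(\<Sum>i\<in>UNIV. \<Sum>j\<in>UNIV. \<Sum>k\<in>UNIV. ?w i j k * (exp (2 * ?w i j k) - 1) * ?C i j k) = 0"
  proof -
    have split: "w * (x - 1) * C = w * (x * C) - w * C" for w x C :: real by (simp add: algebra_simps)
    show ?thesis unfolding split sum_subtractf S1 S2 by simp
  qed
  have nn: "x * (exp (2 * x) - 1) \<ge> 0" for x :: real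
    by (cases "x \<ge> 0") (auto intro: mult_nonneg_nonneg mult_nonpos_nonpos)
  have z: "?w i j k * (exp (2 * ?w i j k) - 1) * ?C i j k = 0" for i j k
  proof -
    let ?f = "\<lambda>i j k. ?w i j k * (exp (2 * ?w i j k) - 1) * ?C i j k"
    have f: "?f i j k \<ge> 0" for i j k by (rule mult_nonneg_nonneg[OF nn]) simp
    have "?f i j k \<le> (\<Sum>k\<in>UNIV. ?f i j k)" by (rule member_le_sum) (use f in auto)
    also have "\<dots> \<le> (\<Sum>j\<in>UNIV. \<Sum>k\<in>UNIV. ?f i j k)"
      by (rule member_le_sum[of j UNIV "\<lambda>j. \<Sum>k\<in>UNIV. ?f i j k"]) (use f in \<open>auto intro: sum_nonneg\<close>)
    also have "\<dots> \<le> (\<Sum>i\<in>UNIV. \<Sum>j\<in>UNIV. \<Sum>k\<in>UNIV. ?f i j k)"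
      by (rule member_le_sum[of i UNIV "\<lambda>i. \<Sum>j\<in>UNIV. \<Sum>k\<in>UNIV. ?f i j k"]) (use f in \<open>auto intro!: sum_nonneg\<close>)
    finally have "?f i j k \<le> 0" unfolding total .
    then show ?thesis using f by (rule antisym)
  qed
  have a_weights: "a k = a i + a j" if "sc e i j k \<noteq> 0" for i j k
    using z[where i=i and j=j and k=k] that by auto
  have "(\<Sum>i\<in>UNIV. a i * Re (h (diagonal_map e a (e i)) (e i))) = 0"
    by (rule variation[where E="flow e a" and r="\<lambda>t. 1"])
       (simp_all add: complex_linear_flow flow_inverse[OF e] flow_zero[OF e] flow_derivative flow_automorphism[OF e a_weights])
  then have "(\<Sum>i\<in>UNIV. (a i)\<^sup>2) = 0"
    by (simp add: h_diagonal_map[OF e] unitary_frameD(1)[OF e] power2_eq_square)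
  then have a0: "a i = 0" for i by (simp add: sum_nonneg_eq_0_iff)
  have "?h' X Y = h X Y" for X Y
    unfolding diag_metric_def a0 using frame_parseval[OF e, of X Y] by (simp add: cnj_sym)
  then have "?h' = h" by (intro ext)
  then show ?thesis using v s sc_v unfolding \<sigma>_def by auto
qed

end

theorem (in complex_lie_algebra) solitons_homothetic:
  assumes uni: "unimodular br" and s1: "algebraic_HCF_soliton br g1" and s2: "algebraic_HCF_soliton br g2"
  shows "homothetic br g1 g2"
proof -
  let ?h1 = "herm_of g1" and ?h2 = "herm_of g2"
  obtain w p c where g1: "hermitian_metric g1" and w: "unitary_frame ?h1 w"
    and pw: "\<And>i j k. metric_lie_algebra.sc br ?h1 w i j k \<noteq> 0 \<Longrightarrow> p k = p i + p j"
    and Kw: "\<And>i X. metric_lie_algebra.kform br ?h1 w X (w i) = complex_of_real (c + p i) * ?h1 X (w i)"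
    using soliton_normal_form[OF uni s1] by blast
  obtain w2 p2 c2 where g2: "hermitian_metric g2" and w2: "unitary_frame ?h2 w2"
    and pw2: "\<And>i j k. metric_lie_algebra.sc br ?h2 w2 i j k \<noteq> 0 \<Longrightarrow> p2 k = p2 i + p2 j"
    and Kw2: "\<And>i X. metric_lie_algebra.kform br ?h2 w2 X (w2 i) = complex_of_real (c2 + p2 i) * ?h2 X (w2 i)"
    using soliton_normal_form[OF uni s2] by blast
  interpret h1: hermitian_inner ?h1 by (rule herm_of_hermitian_inner[OF g1])
  interpret h2: hermitian_inner ?h2 by (rule herm_of_hermitian_inner[OF g2])
  interpret m1: metric_lie_algebra br ?h1 ..
  interpret m2: metric_lie_algebra br ?h2 ..
  obtain v s where v: "unitary_frame ?h1 v" and s: "s > 0"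
    and sc: "\<And>i j k. m1.sc v i j k = complex_of_real s * m2.sc w2 i j k"
    using m1.soliton_frames_equivalent[OF h2.hermitian_inner_axioms w pw Kw w2 pw2 Kw2] by blast
  define F where "F X = complex_of_real s *s (\<Sum>i\<in>UNIV. ?h1 X (v i) *s w2 i)" for X
  have F: "complex_linear F"
    unfolding complex_linear_def F_def
    by (auto simp: h1.add_left h1.scale_left vec_eq_iff sum.distrib sum_distrib_left algebra_simps)
  note Flin = F[unfolded complex_linear_def]
  have F_comp: "?h2 (F X) (w2 j) = s * ?h1 X (v j)" for X j
    unfolding F_def
    by (simp add: h2.scale_left h2.sum_left unitary_frameD(1)[OF w2] if_distrib[of "\<lambda>x. _ * x"] cong: if_cong)
  have h2F: "?h2 (F X) (F Y) = complex_of_real (s\<^sup>2) * ?h1 X Y" for X Y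
    unfolding h2.frame_parseval[OF w2, of "F X" "F Y"] F_comp h1.frame_parseval[OF v, of X Y]
    by (simp add: sum_distrib_left power2_eq_square mult_ac)
  have lin: "linear F"
    using Flin by (intro linearI) (auto simp: scaleR_eq_smult)
  have "inj F"
  proof (rule linear_injective_0[OF lin, THEN iffD2], intro allI impI)
    fix X assume "F X = 0"
    then have "?h1 X X = 0" using h2F[of X X] s by simp
    then show "X = 0" by (simp add: h1.definite)
  qed
  then have bij: "bij F" using linear_inj_imp_surj[OF lin] by (simp add: bij_def)
  have Fv: "F (v i) = complex_of_real s *s w2 i" for i
    unfolding F_def by (simp add: unitary_frameD(1)[OF v] if_distrib[of "\<lambda>x. x *s _"] cong: if_cong)
  have br_frame: "F (br (v i) (v j)) = br (F (v i)) (F (v j))" for i j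
  proof (rule h2.frame_ext[OF w2])
    fix k
    have "?h2 (F (br (v i) (v j))) (w2 k) = complex_of_real s * (complex_of_real s * m2.sc w2 i j k)"
      unfolding F_comp using sc[of i j k] by (simp add: m1.sc_def)
    then show "?h2 (F (br (v i) (v j))) (w2 k) = ?h2 (br (F (v i)) (F (v j))) (w2 k)"
      unfolding Fv by (simp add: br_scale_left br_scale_right h2.scale_left m2.sc_def)
  qed
  have ext: "f X = g X" if "complex_linear f" "complex_linear g" "\<And>i. f (v i) = g (v i)" for f g :: "complex ^ 'n \<Rightarrow> complex ^ 'n" and X
  proof -
    have "f (\<Sum>i\<in>UNIV. ?h1 X (v i) *s v i) = g (\<Sum>i\<in>UNIV. ?h1 X (v i) *s v i)"
      using that unfolding complex_linear_sum[OF that(1)] complex_linear_sum[OF that(2)] complex_linear_def by simp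
    then show ?thesis using unitary_frameD(2)[OF v, of X] by simp
  qed
  have "F (br X Y) = br (F X) (F Y)" for X Y
  proof (rule ext[of "\<lambda>X. F (br X Y)" "\<lambda>X. br (F X) (F Y)"])
    show "complex_linear (\<lambda>X. F (br X Y))" "complex_linear (\<lambda>X. br (F X) (F Y))"
      unfolding complex_linear_def using Flin by (auto simp: br_add_left br_scale_left)
    show "F (br (v i) Y) = br (F (v i)) (F Y)" for i
    proof (rule ext[of "\<lambda>Y. F (br (v i) Y)" "\<lambda>Y. br (F (v i)) (F Y)"])
      show "complex_linear (\<lambda>Y. F (br (v i) Y))" "complex_linear (\<lambda>Y. br (F (v i)) (F Y))"
        unfolding complex_linear_def using Flin by (auto simp: br_add_right br_scale_right)
    qed (rule br_frame)
  qed
  then have "complex_automorphism br F"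
    unfolding complex_automorphism_def using lin bij Flin by blast
  moreover have "g2 (F X) (F Y) = s\<^sup>2 * g1 X Y" for X Y
    using arg_cong[OF h2F[of X Y], of Re] by (simp add: herm_of_def)
  ultimately show ?thesis
    unfolding homothetic_def using s by (intro exI[of _ "s\<^sup>2"]) auto
qed

section \<open>Solitons and static metrics on unimodular complex Lie groups\<close>

theorem theorem1p2:
  fixes G :: "('a, 'b) monoid_scheme"
    and \<T> :: "'a topology"
    and \<A> :: "('a set \<times> ('a \<Rightarrow> complex ^ 'n)) set"
    and br :: "complex ^ 'n \<Rightarrow> complex ^ 'n \<Rightarrow> complex ^ 'n"
  assumes "complex_lie_group G \<T> \<A>"
    and "(U, \<phi>) \<in> \<A>" and "\<one>\<^bsub>G\<^esub> \<in> U"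
    and "br = lie_bracket G U \<phi>"
    and "unimodular br"
  shows "(\<forall>g1 g2. algebraic_HCF_soliton br g1 \<and> algebraic_HCF_soliton br g2 \<longrightarrow> homothetic br g1 g2)
    \<and> (\<not> abelian br \<longrightarrow> ((\<exists>g. static br g) \<longleftrightarrow> semisimple br))
    \<and> (semisimple br \<longrightarrow> (\<forall>g. canonical_metric br g \<longrightarrow> (\<exists>c<0. static_with br g c)))"
proof -
  interpret complex_lie_algebra br
    unfolding assms(4) by (rule complex_lie_group.lie_algebra[OF assms(1-3)])
  note uni = \<open>unimodular br\<close>
  have "homothetic br g1 g2" if "algebraic_HCF_soliton br g1" "algebraic_HCF_soliton br g2" for g1 g2
    by (rule solitons_homothetic[OF uni that])
  moreover have "(\<exists>g. static br g) \<longleftrightarrow> semisimple br" if "\<not> abelian br"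
    using static_imp_semisimple[OF uni _ that] semisimple_imp_static[OF uni] unfolding static_def by blast
  moreover have "\<exists>c<0. static_with br g c" if "canonical_metric br g" for g
    using canonical_metric_static[OF uni that] by (intro exI[of _ "- 1 / 4"]) simp
  ultimately show ?thesis by blast
qed

end
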